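(* For every countable limit ordinal $\lambda$ there is a countable linear ordering whose Scott sentence complexity is $\Sigma^{\mathrm{in}}_{\lambda+3}$.
   Context: Infinitary formulas: $\Sigma^{\mathrm{in}}_0=\Pi^{\mathrm{in}}_0$ are the finitary quantifier-free formulas; for $\alpha\ge1$, a $\Sigma^{\mathrm{in}}_\alpha$ formula is a countable disjunction of formulas $\exists\bar x\,\varphi$ with $\varphi\in\Pi^{\mathrm{in}}_\beta$, $\beta<\alpha$, and $\Pi^{\mathrm{in}}_\alpha$ is dual; $d\text{-}\Sigma^{\mathrm{in}}_\alpha$ formulas are conjunctions of a $\Sigma^{\mathrm{in}}_\alpha$ and a $\Pi^{\mathrm{in}}_\alpha$ formula. A Scott sentence of a countable structure is an $L_{\omega_1\omega}$ sentence whose countable models are exactly its isomorphic copies. The Scott sentence complexity of a structure is the least class among $\Pi^{\mathrm{in}}_\alpha,\Sigma^{\mathrm{in}}_\alpha,d\text{-}\Sigma^{\mathrm{in}}_\alpha$ ($\alpha\ge1$) in which it has a Scott sentence, classes ordered by inclusion up to equivalence ($\Pi_\alpha,\Sigma_\alpha\subseteq d\text{-}\Sigma_\alpha\subseteq \Sigma_{\alpha+1}\cap\Pi_{\alpha+1}$). *)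

theory Defs
  imports Complex_Main
begin

section \<open>Countable ordinals\<close>

text \<open>
  Every countable well-order is isomorphic to one whose field is a set of natural numbers, so the
  order types of the well-orders on sets of natural numbers are exactly the countable ordinals.
\<close>

quotient_type cord = "nat rel" / partial: "\<lambda>r s. (r, s) \<in> ordIso"
proof (rule part_equivpI)
  have "Well_order ({} :: nat rel)"
    by (simp add: well_order_on_empty)
  then show "\<exists>r :: nat rel. (r, r) \<in> ordIso"
    using ordIso_reflexive by blast
  show "symp (\<lambda>r s. (r, s :: nat rel) \<in> ordIso)"
    by (auto intro: sympI ordIso_symmetric)
  show "transp (\<lambda>r s. (r, s :: nat rel) \<in> ordIso)"
    by (auto intro: transpI ordIso_transitive)
qed

lemma ordIso_refl_iff: "(r, r) \<in> ordIso \<longleftrightarrow> Well_order r"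
  using ordIso_reflexive by (auto simp: ordIso_def)

instantiation cord :: "{zero, linorder}"
begin

lift_definition zero_cord :: cord is "{}"
  by (simp add: ordIso_refl_iff well_order_on_empty)

lift_definition less_eq_cord :: "cord \<Rightarrow> cord \<Rightarrow> bool" is "\<lambda>r s. (r, s) \<in> ordLeq"
  by (meson ordIso_ordLeq_trans ordIso_symmetric ordLeq_ordIso_trans)

lift_definition less_cord :: "cord \<Rightarrow> cord \<Rightarrow> bool" is "\<lambda>r s. (r, s) \<in> ordLess"
  by (meson ordIso_ordLess_trans ordIso_symmetric ordLess_ordIso_trans)

instance
proof
  fix a b c :: cord
  show "(a < b) = (a \<le> b \<and> \<not> b \<le> a)"
    by transfer (metis ordIso_refl_iff not_ordLeq_iff_ordLess ordLess_imp_ordLeq)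
  show "a \<le> a"
    by transfer (simp add: ordIso_refl_iff ordLeq_reflexive)
  show "a \<le> b \<Longrightarrow> b \<le> c \<Longrightarrow> a \<le> c"
    by transfer (rule ordLeq_transitive)
  show "a \<le> b \<Longrightarrow> b \<le> a \<Longrightarrow> a = b"
    by transfer (simp add: ordIso_iff_ordLeq)
  show "a \<le> b \<or> b \<le> a"
    by transfer (simp add: ordIso_refl_iff ordLeq_total)
qed

end

instance cord :: wellorder
proof (rule wf_wellorderI)
  have "{(x, y). x < y} \<subseteq> inv_image ordLess rep_cord"
    by (auto simp: less_cord.rep_eq)
  then show "wf {(x :: cord, y). x < y}"
    using wf_inv_image[OF wf_ordLess] wf_subset by blast
qed intro_classes

definition osuc :: "cord \<Rightarrow> cord"
  where "osuc a = (LEAST b. a < b)"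

definition limit_ord :: "cord \<Rightarrow> bool"
  where "limit_ord l \<longleftrightarrow> l \<noteq> 0 \<and> (\<forall>b. l \<noteq> osuc b)"

lemma zero_le_cord: "0 \<le> (a :: cord)"
  by transfer (simp add: ordIso_refl_iff ordLeq_def embed_def well_order_on_empty)

lemma ex_greater_cord: "\<exists>b. (a :: cord) < b"
proof transfer
  fix r :: "nat rel"
  assume "(r, r) \<in> ordIso"
  then have r: "Well_order r"
    by (simp add: ordIso_refl_iff)
  define r1 where "r1 = dir_image r Suc"
  have iso: "(r, r1) \<in> ordIso"
    unfolding r1_def using r by (intro dir_image_ordIso) auto
  have r1: "Well_order r1"
    unfolding r1_def using r by (intro Well_order_dir_image) auto
  have nz: "0 \<notin> Field r1"
    by (auto simp: r1_def dir_image_def Field_def)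
  define s where "s = r1 \<union> (insert 0 (Field r1)) \<times> {0}"
  have F: "Field s = insert 0 (Field r1)"
    by (auto simp: s_def Field_def)
  have sub: "r1 \<subseteq> Field r1 \<times> Field r1"
    by (auto simp: Field_def)
  have lin: "Refl r1" "trans r1" "antisym r1" "Total r1" "wf (r1 - Id)"
    using r1 by (auto simp: order_on_defs)
  have "Refl s"
    using lin(1) F by (auto simp: s_def refl_on_def)
  moreover have "trans s"
    using lin(2) sub nz unfolding s_def trans_def by blast
  moreover have "antisym s"
    using lin(3) sub nz unfolding s_def antisym_def by blast
  moreover have "Total s"
    using lin(4) unfolding F by (auto simp: s_def total_on_def)
  moreover have "wf (s - Id)"
  proof -
    have "s - Id = (r1 - Id) \<union> Field r1 \<times> {0}"
      using nz by (auto simp: s_def)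
    moreover have "wf (Field r1 \<times> {0})"
      using nz by (intro wf_subset[OF wf_measure[of "\<lambda>x. if x = 0 then 1 else 0"]]) (auto intro: gr0I)
    moreover have "Domain (r1 - Id) \<inter> Range (Field r1 \<times> {0}) = {}"
      using nz by (auto simp: Field_def)
    ultimately show ?thesis
      using lin(5) by (metis wf_Un)
  qed
  ultimately have s: "Well_order s"
    by (auto simp: order_on_defs Field_def)
  have "underS s 0 = Field r1"
    using nz by (auto simp: underS_def s_def Field_def)
  moreover have "Restr s (Field r1) = r1"
    using nz sub by (auto simp: s_def)
  ultimately have "(r1, s) \<in> ordLess"
    using underS_Restr_ordLess[OF s, of 0] F by simp
  then have "(r, s) \<in> ordLess"
    using iso ordIso_ordLess_trans by blast
  with s show "\<exists>s\<in>{s :: nat rel. (s, s) \<in> ordIso}. (r, s) \<in> ordLess"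
    by (auto simp: ordIso_refl_iff)
qed

lemma less_osuc: "a < osuc a"
  unfolding osuc_def using ex_greater_cord by (rule LeastI_ex)

lemma osuc_le_iff: "osuc a \<le> b \<longleftrightarrow> a < b"
  by (metis Least_le less_osuc osuc_def less_le_trans)


section \<open>Infinitary formulas in the language of orderings\<close>

text \<open>
  The vocabulary has one binary relation symbol; variables are natural numbers. In \<open>Conj I F\<close> and
  \<open>Disj I F\<close> the connective ranges over the members \<open>F i\<close> with \<open>i \<in> I\<close>, so \<open>I\<close> gives the countable,
  possibly finite or empty, index set and the values of \<open>F\<close> outside \<open>I\<close> are irrelevant.
\<close>

datatype fm =
    Eq nat nat
  | Le nat nat
  | Neg fm
  | Conj "nat set" "nat \<Rightarrow> fm"
  | Disj "nat set" "nat \<Rightarrow> fm"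
  | Exists nat fm
  | Forall nat fm

primrec fv :: "fm \<Rightarrow> nat set" where
  "fv (Eq x y) = {x, y}"
| "fv (Le x y) = {x, y}"
| "fv (Neg p) = fv p"
| "fv (Conj I F) = (\<Union>i\<in>I. fv (F i))"
| "fv (Disj I F) = (\<Union>i\<in>I. fv (F i))"
| "fv (Exists x p) = fv p - {x}"
| "fv (Forall x p) = fv p - {x}"

primrec sat :: "'a set \<Rightarrow> 'a rel \<Rightarrow> fm \<Rightarrow> (nat \<Rightarrow> 'a) \<Rightarrow> bool" where
  "sat A R (Eq x y) e \<longleftrightarrow> e x = e y"
| "sat A R (Le x y) e \<longleftrightarrow> (e x, e y) \<in> R"
| "sat A R (Neg p) e \<longleftrightarrow> \<not> sat A R p e"
| "sat A R (Conj I F) e \<longleftrightarrow> (\<forall>i\<in>I. sat A R (F i) e)"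
| "sat A R (Disj I F) e \<longleftrightarrow> (\<exists>i\<in>I. sat A R (F i) e)"
| "sat A R (Exists x p) e \<longleftrightarrow> (\<exists>a\<in>A. sat A R p (e(x := a)))"
| "sat A R (Forall x p) e \<longleftrightarrow> (\<forall>a\<in>A. sat A R p (e(x := a)))"

text \<open>
  The quantifier path above a subformula of a sentence is finite, so every subformula of a sentence
  has only finitely many free variables, as required in \<open>L\<^bsub>\<omega>\<^sub>1\<omega>\<^esub>\<close>.
\<close>

definition sentence :: "fm \<Rightarrow> bool"
  where "sentence p \<longleftrightarrow> fv p = {}"

definition is_struct :: "'a set \<Rightarrow> 'a rel \<Rightarrow> bool"
  where "is_struct A R \<longleftrightarrow> A \<noteq> {} \<and> R \<subseteq> A \<times> A"

definition models :: "'a set \<Rightarrow> 'a rel \<Rightarrow> fm \<Rightarrow> bool"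
  where "models A R p \<longleftrightarrow> (\<forall>e. range e \<subseteq> A \<longrightarrow> sat A R p e)"

definition isomorphic :: "'a set \<Rightarrow> 'a rel \<Rightarrow> 'b set \<Rightarrow> 'b rel \<Rightarrow> bool"
  where "isomorphic A R B S \<longleftrightarrow>
    (\<exists>f. bij_betw f A B \<and> (\<forall>x\<in>A. \<forall>y\<in>A. (x, y) \<in> R \<longleftrightarrow> (f x, f y) \<in> S))"

inductive qf :: "fm \<Rightarrow> bool" where
  "qf (Eq x y)"
| "qf (Le x y)"
| "qf p \<Longrightarrow> qf (Neg p)"
| "finite I \<Longrightarrow> (\<And>i. i \<in> I \<Longrightarrow> qf (F i)) \<Longrightarrow> qf (Conj I F)"
| "finite I \<Longrightarrow> (\<And>i. i \<in> I \<Longrightarrow> qf (F i)) \<Longrightarrow> qf (Disj I F)"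

definition Exs :: "nat list \<Rightarrow> fm \<Rightarrow> fm"
  where "Exs xs p = foldr Exists xs p"

definition Alls :: "nat list \<Rightarrow> fm \<Rightarrow> fm"
  where "Alls xs p = foldr Forall xs p"

definition And :: "fm \<Rightarrow> fm \<Rightarrow> fm"
  where "And p q = Conj {0, 1} (\<lambda>i. if i = 0 then p else q)"

inductive Sigma_in :: "cord \<Rightarrow> fm \<Rightarrow> bool" and Pi_in :: "cord \<Rightarrow> fm \<Rightarrow> bool" where
  "qf p \<Longrightarrow> Sigma_in 0 p"
| "qf p \<Longrightarrow> Pi_in 0 p"
| "0 < \<alpha> \<Longrightarrow> (\<forall>i\<in>I. \<exists>xs \<beta> p. F i = Exs xs p \<and> \<beta> < \<alpha> \<and> Pi_in \<beta> p) \<Longrightarrow> Sigma_in \<alpha> (Disj I F)"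
| "0 < \<alpha> \<Longrightarrow> (\<forall>i\<in>I. \<exists>xs \<beta> p. F i = Alls xs p \<and> \<beta> < \<alpha> \<and> Sigma_in \<beta> p) \<Longrightarrow> Pi_in \<alpha> (Conj I F)"

definition d_Sigma_in :: "cord \<Rightarrow> fm \<Rightarrow> bool"
  where "d_Sigma_in \<alpha> r \<longleftrightarrow> (\<exists>p q. Sigma_in \<alpha> p \<and> Pi_in \<alpha> q \<and> r = And p q)"


section \<open>Scott sentence complexity\<close>

text \<open>
  Up to isomorphism the countable structures are those whose universe is a set of natural numbers;
  these are the structures over which the next definitions quantify.
\<close>

definition scott_sentence :: "'a set \<Rightarrow> 'a rel \<Rightarrow> fm \<Rightarrow> bool"
  where "scott_sentence A R p \<longleftrightarrow> sentence p \<and>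
    (\<forall>(B :: nat set) S. is_struct B S \<longrightarrow> (models B S p \<longleftrightarrow> isomorphic A R B S))"

definition equivalent :: "fm \<Rightarrow> fm \<Rightarrow> bool"
  where "equivalent p q \<longleftrightarrow>
    (\<forall>(B :: nat set) S. is_struct B S \<longrightarrow> (models B S p \<longleftrightarrow> models B S q))"

datatype cclass = Pi_class cord | Sigma_class cord | d_Sigma_class cord

primrec index :: "cclass \<Rightarrow> cord" where
  "index (Pi_class \<alpha>) = \<alpha>"
| "index (Sigma_class \<alpha>) = \<alpha>"
| "index (d_Sigma_class \<alpha>) = \<alpha>"

primrec in_class :: "fm \<Rightarrow> cclass \<Rightarrow> bool" where
  "in_class p (Pi_class \<alpha>) \<longleftrightarrow> Pi_in \<alpha> p"
| "in_class p (Sigma_class \<alpha>) \<longleftrightarrow> Sigma_in \<alpha> p"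
| "in_class p (d_Sigma_class \<alpha>) \<longleftrightarrow> d_Sigma_in \<alpha> p"

definition class_le :: "cclass \<Rightarrow> cclass \<Rightarrow> bool"
  where "class_le C D \<longleftrightarrow>
    (\<forall>p. sentence p \<and> in_class p C \<longrightarrow> (\<exists>q. sentence q \<and> in_class q D \<and> equivalent p q))"

definition has_scott_sentence_in :: "'a set \<Rightarrow> 'a rel \<Rightarrow> cclass \<Rightarrow> bool"
  where "has_scott_sentence_in A R C \<longleftrightarrow> (\<exists>p. scott_sentence A R p \<and> in_class p C)"

definition scott_complexity :: "'a set \<Rightarrow> 'a rel \<Rightarrow> cclass \<Rightarrow> bool"
  where "scott_complexity A R C \<longleftrightarrow>
    0 < index C \<and> has_scott_sentence_in A R C \<and>
    (\<forall>D. 0 < index D \<and> has_scott_sentence_in A R D \<longrightarrow> class_le C D)"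

end

theory Submission
  imports Defs "HOL-Library.Countable_Set" "HOL-Library.Multiset_Order" "HOL-Library.Product_Lexorder"
begin

text \<open>
  Let \<open>P\<close> be the dense shuffle of the ordinals \<open>\<omega>^b + 1\<close> for \<open>b < lam\<close> and \<open>R\<close> that for \<open>b \<le> lam\<close>.
  The ordering \<open>A = P + 2 + R\<close> has the required complexity.

  Back-and-forth equivalence of rank \<open>d < lam\<close> does not separate \<open>\<omega>^lam\<close> from \<open>\<omega>^b\<close> with \<open>d \<le> b < lam\<close>,
  so \<open>R\<close> and \<open>P + R\<close> are equivalent of rank \<open>lam + 1\<close>. Hence \<open>B = P + R\<close> is the directed union of
  substructures isomorphic to \<open>A\<close>, obtained by deleting a final segment of \<open>P\<close> after a block of order
  type 2, and each of them is elementary in \<open>B\<close> for formulas of rank \<open>lam + 1\<close>. So every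
  \<open>\<Pi>\<close>-sentence of rank \<open>lam + 3\<close> true in \<open>A\<close> holds in \<open>B\<close>, but \<open>B\<close> is not isomorphic to \<open>A\<close>.

  Conversely, once a point of the middle block is named, tuples of \<open>A\<close> that are equivalent of rank
  \<open>lam\<close> lie in the same automorphism orbit. As rank \<open>lam\<close> equivalence is \<open>\<Pi>\<close>-definable at level \<open>lam\<close>,
  this yields a Scott sentence with one existential quantifier in front of a \<open>\<Pi>\<close>-formula of rank
  \<open>lam + 2\<close>.
\<close>

section \<open>Countable ordinals\<close>

text \<open>Doubling fixes limit ordinals: each back-and-forth step costs two quantifier
  alternations, yet rank \<open>lam\<close> equivalence to a fixed tuple is still \<Pi> of level
  \<open>lam\<close>. The three further levels go to the implication from equivalence to
  extendability, to the quantifier over all tuples, and to the named point. A named point is needed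
  because rank \<open>lam\<close> sees the exponents (labels) of blocks and the positions in them,
  but not the boundary between \<open>P\<close> and \<open>R\<close>: two blocks with the same
  label, one on each side, look alike, although blocks with label \<open>lam\<close> occur to the
  left of only one of them. The top point added to each power of \<omega> is the only point of its
  block without immediate successor, which makes blocks recognisable. The separator 2 is \<omega>^0
  + 1, a block that occurs densely in \<open>P\<close>; so cutting \<open>P\<close> off after such a
  block gives \<open>A\<close> again. For the least class it suffices to exclude \<Pi> of level
  \<open>lam + 3\<close>, which includes every class not containing \<Sigma> of level
  \<open>lam + 3\<close>.\<close>

lemma countable_lessThan_cord: "countable {..<l :: cord}"
proof -
  \<comment> \<open>A smaller ordinal is the type of a proper initial segment, and such a segment is
    determined by one natural number.\<close>
  define f where "f n = abs_cord (Restr (rep_cord l) (underS (rep_cord l) n))" for n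
  have "b \<in> range f" if "b < l" for b
  proof -
    have w: "Well_order (rep_cord l)" "Well_order (rep_cord b)"
      unfolding ordIso_refl_iff[symmetric] by (rule Quotient3_rep_reflp[OF Quotient3_cord])+
    have "(rep_cord b, rep_cord l) \<in> ordLess"
      using that by (simp add: less_cord.rep_eq)
    then obtain a where "(rep_cord b, Restr (rep_cord l) (underS (rep_cord l) a)) \<in> ordIso"
      using ordLess_iff_ordIso_Restr[OF w] by blast
    then have "abs_cord (rep_cord b) = f a"
      unfolding f_def using Quotient3_cord by (rule Quotient3_rel_abs[rotated])
    then show ?thesis
      using Quotient3_abs_rep[OF Quotient3_cord] by auto
  qed
  then have "{..<l} \<subseteq> range f" by auto
  then show ?thesis
    by (rule countable_subset) simp
qed

lemma countable_atMost_cord: "countable {..l :: cord}"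
proof -
  have "{..l} = insert l {..<l}" by auto
  then show ?thesis by (simp add: countable_lessThan_cord)
qed

lemma less_osuc_iff: "a < osuc b \<longleftrightarrow> a \<le> b"
  by (meson less_osuc linorder_not_less osuc_le_iff)

lemma osuc_pos [simp]: "0 < osuc a"
  by (simp add: less_osuc_iff zero_le_cord)

lemma osuc_neq_0 [simp]: "osuc a \<noteq> 0"
  by (metis less_irrefl osuc_pos)

lemma limit_ord_osuc_less: "limit_ord l \<Longrightarrow> a < l \<Longrightarrow> osuc a < l"
  by (metis limit_ord_def nless_le osuc_le_iff)

lemma limit_ord_pos: "limit_ord l \<Longrightarrow> 0 < l"
  by (metis limit_ord_def nless_le zero_le_cord)

lemma cord_cases:
  obtains "a = 0" | b where "a = osuc b" | "limit_ord a"
  using limit_ord_def by blast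

text \<open>Expressing a back-and-forth relation of rank \<open>a\<close> takes two quantifier alternations per step.\<close>


definition dbl :: "cord \<Rightarrow> cord" where
  "dbl = wfrec {(x, y). x < y}
    (\<lambda>f a. if \<exists>b. a = osuc b then osuc (osuc (f (THE b. a = osuc b))) else a)"

lemma osuc_inject: "osuc a = osuc b \<longleftrightarrow> a = b"
  by (metis less_osuc less_osuc_iff linorder_less_linear linorder_not_less)

lemma dbl_osuc: "dbl (osuc b) = osuc (osuc (dbl b))"
  by (subst def_wfrec[OF dbl_def[THEN eq_reflection] wf])
    (auto simp: osuc_inject cut_def less_osuc)

lemma dbl_not_osuc: "(\<And>b. a \<noteq> osuc b) \<Longrightarrow> dbl a = a"
  by (subst def_wfrec[OF dbl_def[THEN eq_reflection] wf]) auto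

lemma dbl_0 [simp]: "dbl 0 = 0"
  by (rule dbl_not_osuc) (metis less_irrefl osuc_pos)

lemma dbl_limit: "limit_ord a \<Longrightarrow> dbl a = a"
  by (rule dbl_not_osuc) (auto simp: limit_ord_def)

text \<open>Together with \<open>dbl_limit\<close> this makes \<open>dbl\<close> continuous at
  limits; it is the ordinal product 2 * a, and doubling never escapes a limit.\<close>

lemma dbl_less_limit: "limit_ord l \<Longrightarrow> a < l \<Longrightarrow> dbl a < l"
proof (induction a rule: less_induct)
  case (less a)
  show ?case
  proof (cases a rule: cord_cases)
    case (2 b)
    then have "b < a" by (simp add: less_osuc)
    then show ?thesis
      using less 2 by (simp add: dbl_osuc limit_ord_osuc_less)
  qed (use less in \<open>auto simp: dbl_limit\<close>)
qed

lemma dbl_less: "d < a \<Longrightarrow> osuc (osuc (dbl d)) \<le> dbl a"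
proof (induction a rule: less_induct)
  case (less a)
  show ?case
  proof (cases a rule: cord_cases)
    case 1
    then show ?thesis using less.prems zero_le_cord leD by blast
  next
    case (2 b)
    then have "d = b \<or> d < b" "b < a"
      using less.prems less_osuc by (auto simp: less_osuc_iff)
    then show ?thesis
      using less.IH[of b] 2 by (auto simp: dbl_osuc osuc_le_iff less_osuc_iff)
        (metis less_osuc order.strict_trans order_le_less)
  next
    case 3
    then show ?thesis
      using less.prems by (simp add: dbl_limit osuc_le_iff dbl_less_limit limit_ord_osuc_less)
  qed
qed

section \<open>Back-and-forth relations\<close>

definition piso :: "'a rel \<Rightarrow> 'b rel \<Rightarrow> ('a \<times> 'b) set \<Rightarrow> bool" where
  "piso R S \<rho> \<longleftrightarrow> (\<forall>x y x' y'. (x, y) \<in> \<rho> \<longrightarrow> (x', y') \<in> \<rho> \<longrightarrow>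
     (x = x' \<longleftrightarrow> y = y') \<and> ((x, x') \<in> R \<longleftrightarrow> (y, y') \<in> S))"

lemma pisoD:
  assumes "piso R S \<rho>" "(x, y) \<in> \<rho>" "(x', y') \<in> \<rho>"
  shows "x = x' \<longleftrightarrow> y = y'" "(x, x') \<in> R \<longleftrightarrow> (y, y') \<in> S"
  using assms unfolding piso_def by blast+

lemma piso_subset: "piso R S \<rho> \<Longrightarrow> \<rho>' \<subseteq> \<rho> \<Longrightarrow> piso R S \<rho>'"
  unfolding piso_def by blast

lemma piso_converse: "piso S R (\<rho>\<inverse>) \<longleftrightarrow> piso R S \<rho>"
  unfolding piso_def by auto

lemma converse_insert: "(insert (x, y) r)\<inverse> = insert (y, x) (r\<inverse>)"
  by auto

text \<open>Moves are finite sets rather than single points because a whole block of like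
  quantifiers counts as one alternation. Both directions are demanded at every rank, so \<Sigma> and
  \<Pi> formulas are preserved alike. A finite relation stands for a pair of tuples whose order and
  repetitions do not matter.\<close>

inductive bf :: "'a set \<Rightarrow> 'a rel \<Rightarrow> 'b set \<Rightarrow> 'b rel \<Rightarrow> cord \<Rightarrow> ('a \<times> 'b) set \<Rightarrow> bool"
  for A R B S where
  bfI: "finite \<rho> \<Longrightarrow> \<rho> \<subseteq> A \<times> B \<Longrightarrow> piso R S \<rho> \<Longrightarrow>
    (\<And>d C. d < a \<Longrightarrow> finite C \<Longrightarrow> C \<subseteq> A \<Longrightarrow> \<exists>\<rho>'. \<rho> \<subseteq> \<rho>' \<and> C \<subseteq> Domain \<rho>' \<and> bf A R B S d \<rho>') \<Longrightarrow>
    (\<And>d D. d < a \<Longrightarrow> finite D \<Longrightarrow> D \<subseteq> B \<Longrightarrow> \<exists>\<rho>'. \<rho> \<subseteq> \<rho>' \<and> D \<subseteq> Range \<rho>' \<and> bf A R B S d \<rho>') \<Longrightarrow>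
    bf A R B S a \<rho>"

lemma bfD:
  assumes "bf A R B S a \<rho>"
  shows "finite \<rho>" "\<rho> \<subseteq> A \<times> B" "piso R S \<rho>"
  using assms by (auto elim: bf.cases)

lemma bf_forth:
  assumes "bf A R B S a \<rho>" "d < a" "finite C" "C \<subseteq> A"
  obtains \<rho>' where "\<rho> \<subseteq> \<rho>'" "C \<subseteq> Domain \<rho>'" "bf A R B S d \<rho>'"
  using assms(1)
proof cases
  case bfI
  show ?thesis using bfI(4)[OF assms(2-4)] that by blast
qed

lemma bf_back:
  assumes "bf A R B S a \<rho>" "d < a" "finite D" "D \<subseteq> B"
  obtains \<rho>' where "\<rho> \<subseteq> \<rho>'" "D \<subseteq> Range \<rho>'" "bf A R B S d \<rho>'"
  using assms(1)
proof cases
  case bfI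
  show ?thesis using bfI(5)[OF assms(2-4)] that by blast
qed

lemma bf_mono:
  assumes bf: "bf A R B S a \<rho>" and "\<rho>' \<subseteq> \<rho>" "b \<le> a"
  shows "bf A R B S b \<rho>'"
proof (rule bfI)
  show "finite \<rho>'" "\<rho>' \<subseteq> A \<times> B" "piso R S \<rho>'"
    using assms bfD[OF bf] by (auto intro: finite_subset piso_subset)
next
  fix d C assume "d < b" "finite C" "C \<subseteq> A"
  then obtain \<rho>'' where "\<rho> \<subseteq> \<rho>''" "C \<subseteq> Domain \<rho>''" "bf A R B S d \<rho>''"
    using bf_forth[OF bf order.strict_trans2] assms(3) by metis
  then show "\<exists>\<rho>''. \<rho>' \<subseteq> \<rho>'' \<and> C \<subseteq> Domain \<rho>'' \<and> bf A R B S d \<rho>''"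
    using assms(2) by (intro exI[of _ \<rho>'']) auto
next
  fix d D assume "d < b" "finite D" "D \<subseteq> B"
  then obtain \<rho>'' where "\<rho> \<subseteq> \<rho>''" "D \<subseteq> Range \<rho>''" "bf A R B S d \<rho>''"
    using bf_back[OF bf order.strict_trans2] assms(3) by metis
  then show "\<exists>\<rho>''. \<rho>' \<subseteq> \<rho>'' \<and> D \<subseteq> Range \<rho>'' \<and> bf A R B S d \<rho>''"
    using assms(2) by (intro exI[of _ \<rho>'']) auto
qed

lemma bf_converse: "bf A R B S a \<rho> \<Longrightarrow> bf B S A R a (\<rho>\<inverse>)"
proof (induction rule: bf.induct)
  case (bfI \<rho> a)
  show ?case
  proof (rule bf.bfI)
    fix d D assume *: "d < a" "finite D" "D \<subseteq> B"
    obtain \<rho>' where "\<rho> \<subseteq> \<rho>'" "D \<subseteq> Range \<rho>'" "bf B S A R d (\<rho>'\<inverse>)"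
      using bfI(5)[OF *] by blast
    then show "\<exists>\<rho>'. \<rho>\<inverse> \<subseteq> \<rho>' \<and> D \<subseteq> Domain \<rho>' \<and> bf B S A R d \<rho>'"
      by (intro exI[of _ "\<rho>'\<inverse>"]) auto
  next
    fix d D assume *: "d < a" "finite D" "D \<subseteq> A"
    obtain \<rho>' where "\<rho> \<subseteq> \<rho>'" "D \<subseteq> Domain \<rho>'" "bf B S A R d (\<rho>'\<inverse>)"
      using bfI(4)[OF *] by blast
    then show "\<exists>\<rho>'. \<rho>\<inverse> \<subseteq> \<rho>' \<and> D \<subseteq> Range \<rho>' \<and> bf B S A R d \<rho>'"
      by (intro exI[of _ "\<rho>'\<inverse>"]) auto
  qed (use bfI in \<open>auto simp: piso_converse\<close>)
qed

section \<open>Isomorphisms and their construction by back-and-forth\<close>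

definition iso_map :: "'a set \<Rightarrow> 'a rel \<Rightarrow> 'b set \<Rightarrow> 'b rel \<Rightarrow> ('a \<Rightarrow> 'b) \<Rightarrow> bool" where
  "iso_map A R B S f \<longleftrightarrow> bij_betw f A B \<and> (\<forall>x\<in>A. \<forall>y\<in>A. (x, y) \<in> R \<longleftrightarrow> (f x, f y) \<in> S)"

lemma isomorphic_iso_map: "isomorphic A R B S \<longleftrightarrow> (\<exists>f. iso_map A R B S f)"
  unfolding isomorphic_def iso_map_def ..

lemma iso_map_inv: "iso_map A R B S f \<Longrightarrow> iso_map B S A R (inv_into A f)"
  unfolding iso_map_def
  using bij_betw_inv_into[of f A B]
  by (auto simp: f_inv_into_f bij_betw_def inv_into_into)

lemma iso_map_comp: "iso_map A R B S f \<Longrightarrow> iso_map B S C T g \<Longrightarrow> iso_map A R C T (g \<circ> f)"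
  unfolding iso_map_def by (auto intro: bij_betw_trans simp: bij_betw_apply)

lemma isomorphic_sym: "isomorphic A R B S \<Longrightarrow> isomorphic B S A R"
  unfolding isomorphic_iso_map by (blast intro: iso_map_inv)

lemma isomorphic_trans: "isomorphic A R B S \<Longrightarrow> isomorphic B S C T \<Longrightarrow> isomorphic A R C T"
  unfolding isomorphic_iso_map by (blast intro: iso_map_comp)

lemma bf_iso_map:
  assumes h: "iso_map B S C T h"
  shows "bf A R B S a \<rho> \<Longrightarrow> bf A R C T a (map_prod id h ` \<rho>)"
proof (induction rule: bf.induct)
  case (bfI \<rho> a)
  have inj: "inj_on h B" and im: "h ` B = C"
    using h by (auto simp: iso_map_def bij_betw_def)
  show ?case
  proof (rule bf.bfI)
    show "piso R T (map_prod id h ` \<rho>)"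
      unfolding piso_def
    proof (intro allI impI)
      fix x y x' y' assume "(x, y) \<in> map_prod id h ` \<rho>" "(x', y') \<in> map_prod id h ` \<rho>"
      then obtain z z' where z: "(x, z) \<in> \<rho>" "(x', z') \<in> \<rho>" "y = h z" "y' = h z'"
        by auto
      then have "z \<in> B" "z' \<in> B" using bfI(2) by auto
      then have "h z = h z' \<longleftrightarrow> z = z'" "(h z, h z') \<in> T \<longleftrightarrow> (z, z') \<in> S"
        using h inj by (auto simp: iso_map_def inj_on_def)
      then show "(x = x' \<longleftrightarrow> y = y') \<and> ((x, x') \<in> R \<longleftrightarrow> (y, y') \<in> T)"
        using pisoD[OF bfI(3) z(1,2)] z(3,4) by simp
    qed
  next
    fix d D assume *: "d < a" "finite D" "D \<subseteq> A"
    obtain \<rho>' where "\<rho> \<subseteq> \<rho>'" "D \<subseteq> Domain \<rho>'" "bf A R C T d (map_prod id h ` \<rho>')"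
      using bfI(4)[OF *] by blast
    moreover have "Domain (map_prod id h ` \<rho>') = Domain \<rho>'"
      by (auto simp: Domain_iff) (metis id_apply image_eqI map_prod_simp)
    ultimately show "\<exists>\<rho>'. map_prod id h ` \<rho> \<subseteq> \<rho>' \<and> D \<subseteq> Domain \<rho>' \<and> bf A R C T d \<rho>'"
      by (intro exI[of _ "map_prod id h ` \<rho>'"]) auto
  next
    fix d D assume *: "d < a" "finite D" "D \<subseteq> C"
    then have "finite (inv_into B h ` D)" "inv_into B h ` D \<subseteq> B"
      using im by (auto intro: inv_into_into)
    from bfI(5)[OF *(1) this]
    obtain \<rho>' where \<rho>': "\<rho> \<subseteq> \<rho>'" "inv_into B h ` D \<subseteq> Range \<rho>'" "bf A R C T d (map_prod id h ` \<rho>')"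
      by blast
    have "D \<subseteq> Range (map_prod id h ` \<rho>')"
    proof
      fix y assume "y \<in> D"
      then obtain x where "(x, inv_into B h y) \<in> \<rho>'"
        using \<rho>'(2) by blast
      moreover have "h (inv_into B h y) = y"
        using \<open>y \<in> D\<close> *(3) im by (auto simp: f_inv_into_f)
      ultimately show "y \<in> Range (map_prod id h ` \<rho>')"
        by (metis Range.RangeI id_apply image_eqI map_prod_simp)
    qed
    then show "\<exists>\<rho>'. map_prod id h ` \<rho> \<subseteq> \<rho>' \<and> D \<subseteq> Range \<rho>' \<and> bf A R C T d \<rho>'"
      using \<rho>' by (intro exI[of _ "map_prod id h ` \<rho>'"]) auto
  next
    show "finite (map_prod id h ` \<rho>)" using bfI(1) by simp
    show "map_prod id h ` \<rho> \<subseteq> A \<times> C" using bfI(2) im by auto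
  qed
qed

lemma bf_Id_on: "finite C \<Longrightarrow> C \<subseteq> A \<Longrightarrow> bf A R A R a (Id_on C)"
proof (induction a arbitrary: C rule: less_induct)
  case (less a)
  show ?case
  proof (rule bfI)
    fix d D assume *: "d < a" "finite D" "D \<subseteq> A"
    then have "bf A R A R d (Id_on (C \<union> D))"
      using less by (intro less.IH) auto
    then show "\<exists>\<rho>'. Id_on C \<subseteq> \<rho>' \<and> D \<subseteq> Domain \<rho>' \<and> bf A R A R d \<rho>'"
      "\<exists>\<rho>'. Id_on C \<subseteq> \<rho>' \<and> D \<subseteq> Range \<rho>' \<and> bf A R A R d \<rho>'"
      by (intro exI[of _ "Id_on (C \<union> D)"]; auto)+
  next
    show "finite (Id_on C)" using less.prems by (simp add: Id_on_def)
    show "Id_on C \<subseteq> A \<times> A" using less.prems by auto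
    show "piso R R (Id_on C)" by (auto simp: piso_def)
  qed
qed

text \<open>The family \<open>P\<close> is left abstract because it is instantiated twice: by rank
  \<open>l\<close> equivalences containing a named pair, and by label-preserving block maps.
  Enumerating both universes alternately yields an increasing chain whose union is the
  isomorphism.\<close>

lemma isomorphic_if_back_and_forth:
  assumes "countable A" "countable B" "A \<noteq> {}" "B \<noteq> {}"
    and start: "P \<rho>0"
    and piso: "\<And>\<rho>. P \<rho> \<Longrightarrow> \<rho> \<subseteq> A \<times> B \<and> piso R S \<rho>"
    and forth: "\<And>\<rho> x. P \<rho> \<Longrightarrow> x \<in> A \<Longrightarrow> \<exists>y. P (insert (x, y) \<rho>)"
    and bck: "\<And>\<rho> y. P \<rho> \<Longrightarrow> y \<in> B \<Longrightarrow> \<exists>x. P (insert (x, y) \<rho>)"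
  shows "isomorphic A R B S"
proof -
  \<comment> \<open>\<open>from_nat_into\<close> may enumerate with repetitions, so finite universes
    need no separate treatment.\<close>
  have step: "\<exists>\<rho>'. P \<rho>' \<and> (\<rho> \<subseteq> \<rho>' \<and> from_nat_into A n \<in> Domain \<rho>' \<and> from_nat_into B n \<in> Range \<rho>')"
    if "P \<rho>" for \<rho> n
  proof -
    obtain y where 1: "P (insert (from_nat_into A n, y) \<rho>)"
      using forth[OF \<open>P \<rho>\<close>] from_nat_into[OF \<open>A \<noteq> {}\<close>] by metis
    obtain x where "P (insert (x, from_nat_into B n) (insert (from_nat_into A n, y) \<rho>))"
      using bck[OF 1] from_nat_into[OF \<open>B \<noteq> {}\<close>] by metis
    then show ?thesis by blast
  qed
  obtain s where s: "\<And>n. P (s n)"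
    "\<And>n. s n \<subseteq> s (Suc n) \<and> from_nat_into A n \<in> Domain (s (Suc n)) \<and> from_nat_into B n \<in> Range (s (Suc n))"
    using dependent_nat_choice[of "\<lambda>n. P"
      "\<lambda>n \<rho> \<rho>'. \<rho> \<subseteq> \<rho>' \<and> from_nat_into A n \<in> Domain \<rho>' \<and> from_nat_into B n \<in> Range \<rho>'"]
      start step by metis
  have mono: "s m \<subseteq> s n" if "m \<le> n" for m n
    using lift_Suc_mono_le[of s] s(2) that by auto
  define U where "U = (\<Union>n. s n)"
  have U: "piso R S U"
    unfolding piso_def
  proof (intro allI impI)
    fix x y x' y' assume "(x, y) \<in> U" "(x', y') \<in> U"
    then obtain m n where "(x, y) \<in> s m" "(x', y') \<in> s n"
      by (auto simp: U_def)
    then have *: "(x, y) \<in> s (max m n)" "(x', y') \<in> s (max m n)"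
      using mono max.cobounded1 max.cobounded2 by blast+
    show "(x = x' \<longleftrightarrow> y = y') \<and> ((x, x') \<in> R \<longleftrightarrow> (y, y') \<in> S)"
      using pisoD[OF conjunct2[OF piso[OF s(1)]] *] by simp
  qed
  have sub: "U \<subseteq> A \<times> B"
    using piso[OF s(1)] unfolding U_def by blast
  have dom: "\<exists>y. (x, y) \<in> U" if "x \<in> A" for x
    using s(2) from_nat_into_surj[OF \<open>countable A\<close> that] unfolding U_def by (metis DomainE UN_I UNIV_I)
  have ran: "\<exists>x. (x, y) \<in> U" if "y \<in> B" for y
    using s(2) from_nat_into_surj[OF \<open>countable B\<close> that] unfolding U_def by (metis RangeE UN_I UNIV_I)
  define f where "f x = (SOME y. (x, y) \<in> U)" for x
  have f: "(x, f x) \<in> U" if "x \<in> A" for x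
    unfolding f_def using dom[OF that] by (rule someI_ex)
  have "bij_betw f A B"
  proof (rule bij_betw_imageI)
    show "inj_on f A"
      using f pisoD(1)[OF U] by (metis inj_onI)
    show "f ` A = B"
    proof
      show "B \<subseteq> f ` A"
      proof
        fix y assume "y \<in> B"
        then obtain x where x: "(x, y) \<in> U" using ran by blast
        then have "x \<in> A" "f x = y" using f sub pisoD(1)[OF U] by blast+
        then show "y \<in> f ` A" by blast
      qed
    qed (use f sub in auto)
  qed
  moreover have "(x, y) \<in> R \<longleftrightarrow> (f x, f y) \<in> S" if "x \<in> A" "y \<in> A" for x y
    using pisoD(2)[OF U f f] that by blast
  ultimately show ?thesis
    unfolding isomorphic_def by blast
qed

section \<open>Infinitary formulas\<close>

lemma sat_cong: "(\<And>v. v \<in> fv p \<Longrightarrow> e v = e' v) \<Longrightarrow> sat A R p e = sat A R p e'"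
proof (induction p arbitrary: e e')
  case (Exists x p)
  have "sat A R p (e(x := a)) = sat A R p (e'(x := a))" for a
    using Exists.prems by (intro Exists.IH) auto
  then show ?case by simp
next
  case (Forall x p)
  have "sat A R p (e(x := a)) = sat A R p (e'(x := a))" for a
    using Forall.prems by (intro Forall.IH) auto
  then show ?case by simp
next
  case (Conj I F)
  have "sat A R (F i) e = sat A R (F i) e'" if "i \<in> I" for i
    using Conj.prems that by (intro Conj.IH) auto
  then show ?case by simp
next
  case (Disj I F)
  have "sat A R (F i) e = sat A R (F i) e'" if "i \<in> I" for i
    using Disj.prems that by (intro Disj.IH) auto
  then show ?case by simp
next
  case (Neg p)
  have "sat A R p e = sat A R p e'"
    using Neg.prems by (intro Neg.IH) auto
  then show ?case by simp
qed auto

lemma sat_iso_map: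
  assumes h: "iso_map A R B S h"
  shows "range e \<subseteq> A \<Longrightarrow> sat A R p e = sat B S p (h \<circ> e)"
proof (induction p arbitrary: e)
  case (Eq x y)
  then have "e x \<in> A" "e y \<in> A" by auto
  then show ?case using h by (auto simp: iso_map_def bij_betw_def inj_on_def)
next
  case (Le x y)
  then have "e x \<in> A" "e y \<in> A" by auto
  then show ?case using h by (auto simp: iso_map_def)
next
  case (Exists x p)
  have "sat A R p (e(x := a)) = sat B S p ((h \<circ> e)(x := h a))" if "a \<in> A" for a
  proof -
    have "range (e(x := a)) \<subseteq> A" using Exists.prems that by auto
    then show ?thesis using Exists.IH[of "e(x := a)"] by (simp only: fun_upd_comp)
  qed
  moreover have "B = h ` A" using h by (auto simp: iso_map_def bij_betw_def)
  ultimately show ?case by (simp only: sat.simps ball_simps bex_simps cong: ball_cong bex_cong)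
next
  case (Forall x p)
  have "sat A R p (e(x := a)) = sat B S p ((h \<circ> e)(x := h a))" if "a \<in> A" for a
  proof -
    have "range (e(x := a)) \<subseteq> A" using Forall.prems that by auto
    then show ?thesis using Forall.IH[of "e(x := a)"] by (simp only: fun_upd_comp)
  qed
  moreover have "B = h ` A" using h by (auto simp: iso_map_def bij_betw_def)
  ultimately show ?case by (simp only: sat.simps ball_simps bex_simps cong: ball_cong bex_cong)
qed auto

lemma models_iso_map:
  assumes h: "iso_map A R B S h" and "models A R p"
  shows "models B S p"
  unfolding models_def
proof safe
  fix e :: "nat \<Rightarrow> 'b" assume e: "range e \<subseteq> B"
  let ?g = "inv_into A h"
  have g: "iso_map B S A R ?g" using h by (rule iso_map_inv)
  then have "range (?g \<circ> e) \<subseteq> A"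
    using e by (auto simp: iso_map_def bij_betw_def)
  then show "sat B S p e"
    using assms(2) sat_iso_map[OF g e] by (simp add: models_def)
qed

section \<open>Quantifier blocks and invariance of formulas under back-and-forth relations\<close>

lemma fv_Exs [simp]: "fv (Exs xs p) = fv p - set xs"
  by (induction xs) (auto simp: Exs_def)

lemma fv_Alls [simp]: "fv (Alls xs p) = fv p - set xs"
  by (induction xs) (auto simp: Alls_def)

lemma Exs_Cons: "Exs (x # xs) p = Exists x (Exs xs p)"
  by (simp add: Exs_def)

lemma Alls_Cons: "Alls (x # xs) p = Forall x (Alls xs p)"
  by (simp add: Alls_def)

text \<open>Lets a whole quantifier block act at once, to match a single move of
  \<open>bf\<close>.\<close>

definition agree_off :: "nat set \<Rightarrow> 'a set \<Rightarrow> (nat \<Rightarrow> 'a) \<Rightarrow> (nat \<Rightarrow> 'a) \<Rightarrow> bool" where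
  "agree_off V A e e' \<longleftrightarrow> (\<forall>v. v \<notin> V \<longrightarrow> e' v = e v) \<and> (\<forall>v\<in>V. e' v \<in> A)"

lemma agree_off_empty [simp]: "agree_off {} A e e' \<longleftrightarrow> e' = e"
  by (auto simp: agree_off_def)

lemma agree_off_insert:
  assumes "A \<noteq> {}"
  shows "agree_off (insert x V) A e e' \<longleftrightarrow> (\<exists>a\<in>A. agree_off V A (e(x := a)) e')"
proof
  assume *: "agree_off (insert x V) A e e'"
  then show "\<exists>a\<in>A. agree_off V A (e(x := a)) e'"
    by (intro bexI[of _ "e' x"]) (auto simp: agree_off_def)
qed (auto simp: agree_off_def split: if_splits)

lemma agree_off_not_empty: "agree_off V A e e' \<Longrightarrow> V \<noteq> {} \<Longrightarrow> A \<noteq> {}"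
  by (auto simp: agree_off_def)

lemma sat_Exs: "sat A R (Exs xs p) e \<longleftrightarrow> (\<exists>e'. agree_off (set xs) A e e' \<and> sat A R p e')"
proof (induction xs arbitrary: e)
  case (Cons x xs)
  show ?case
  proof (cases "A = {}")
    case True
    then show ?thesis
      using agree_off_not_empty[of "set (x # xs)" A e] by (auto simp: Exs_Cons)
  next
    case False
    then show ?thesis
      unfolding Exs_Cons sat.simps Cons.IH list.set agree_off_insert[OF False] by blast
  qed
qed (simp add: Exs_def)

lemma sat_Alls: "sat A R (Alls xs p) e \<longleftrightarrow> (\<forall>e'. agree_off (set xs) A e e' \<longrightarrow> sat A R p e')"
proof (induction xs arbitrary: e)
  case (Cons x xs)
  show ?case
  proof (cases "A = {}")
    case True
    then show ?thesis
      using agree_off_not_empty[of "set (x # xs)" A e] by (auto simp: Alls_Cons)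
  next
    case False
    then show ?thesis
      unfolding Alls_Cons sat.simps Cons.IH list.set agree_off_insert[OF False] by blast
  qed
qed (simp add: Alls_def)

text \<open>Assignments are total whereas \<rho> is finite, so only the values of the free variables
  can be required to correspond.\<close>

definition bf_invariant :: "'a set \<Rightarrow> 'a rel \<Rightarrow> 'b set \<Rightarrow> 'b rel \<Rightarrow> cord \<Rightarrow> fm \<Rightarrow> bool" where
  "bf_invariant A R B S b p \<longleftrightarrow> (\<forall>a \<rho> e e'. b \<le> a \<longrightarrow> bf A R B S a \<rho> \<longrightarrow>
     (\<forall>v\<in>fv p. (e v, e' v) \<in> \<rho>) \<longrightarrow> sat A R p e = sat B S p e')"

lemma bf_invariantD:
  "bf_invariant A R B S b p \<Longrightarrow> b \<le> a \<Longrightarrow> bf A R B S a \<rho> \<Longrightarrow>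
    (\<And>v. v \<in> fv p \<Longrightarrow> (e v, e' v) \<in> \<rho>) \<Longrightarrow> sat A R p e = sat B S p e'"
  unfolding bf_invariant_def by blast

lemma qf_piso:
  assumes "piso R S \<rho>"
  shows "qf p \<Longrightarrow> (\<And>v. v \<in> fv p \<Longrightarrow> (e v, e' v) \<in> \<rho>) \<Longrightarrow> sat A R p e = sat B S p e'"
proof (induction rule: qf.induct)
  case (1 x y)
  show ?case using pisoD(1)[OF assms 1(1)[of x] 1(1)[of y]] by simp
next
  case (2 x y)
  show ?case using pisoD(2)[OF assms 2(1)[of x] 2(1)[of y]] by simp
next
  case (3 p)
  have "sat A R p e = sat B S p e'" using 3(3) by (intro 3(2)) auto
  then show ?case by simp
next
  case (4 I F)
  have "sat A R (F i) e = sat B S (F i) e'" if "i \<in> I" for i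
    using 4(4) that by (intro 4(3)) auto
  then show ?case by simp
next
  case (5 I F)
  have "sat A R (F i) e = sat B S (F i) e'" if "i \<in> I" for i
    using 5(4) that by (intro 5(3)) auto
  then show ?case by simp
qed

lemma bf_extend_env:
  assumes bf: "bf A R B S a \<rho>" "d < a" and e: "\<And>v. v \<in> V - set xs \<Longrightarrow> (e v, e' v) \<in> \<rho>"
    and e1: "agree_off (set xs) A e e1"
  obtains \<rho>' e1' where "bf A R B S d \<rho>'" "agree_off (set xs) B e' e1'" "\<And>v. v \<in> V \<Longrightarrow> (e1 v, e1' v) \<in> \<rho>'"
proof -
  have "e1 ` set xs \<subseteq> A" using e1 by (auto simp: agree_off_def)
  from bf_forth[OF bf _ this] obtain \<rho>' where \<rho>': "\<rho> \<subseteq> \<rho>'" "e1 ` set xs \<subseteq> Domain \<rho>'" "bf A R B S d \<rho>'"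
    by auto
  define e1' where "e1' v = (if v \<in> set xs then SOME y. (e1 v, y) \<in> \<rho>' else e' v)" for v
  have 1: "(e1 v, e1' v) \<in> \<rho>'" if "v \<in> set xs" for v
    using \<rho>'(2) that by (auto simp: e1'_def Domain_iff intro: someI)
  show thesis
  proof
    show "agree_off (set xs) B e' e1'"
      using 1 bfD(2)[OF \<rho>'(3)] by (auto simp: agree_off_def) (auto simp: e1'_def)
    show "(e1 v, e1' v) \<in> \<rho>'" if "v \<in> V" for v
    proof (cases "v \<in> set xs")
      case False
      then show ?thesis
        using e[of v] e1 \<rho>'(1) that by (auto simp: agree_off_def e1'_def)
    qed (rule 1)
  qed (fact \<rho>'(3))
qed

lemma bf_sat_Exs:
  assumes bf: "bf A R B S a \<rho>" "d < a" and inv: "bf_invariant A R B S d p"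
    and e: "\<And>v. v \<in> fv p - set xs \<Longrightarrow> (e v, e' v) \<in> \<rho>"
  shows "sat A R (Exs xs p) e = sat B S (Exs xs p) e'" "sat A R (Alls xs p) e = sat B S (Alls xs p) e'"
proof -
  have 1: "\<exists>e1'. agree_off (set xs) B e' e1' \<and> sat A R p e1 = sat B S p e1'"
    if "agree_off (set xs) A e e1" for e1
    using bf_extend_env[OF bf e that] bf_invariantD[OF inv order_refl] by metis
  have 2: "\<exists>e1. agree_off (set xs) A e e1 \<and> sat A R p e1 = sat B S p e1'"
    if e1': "agree_off (set xs) B e' e1'" for e1'
  proof -
    have e': "(e' v, e v) \<in> \<rho>\<inverse>" if "v \<in> fv p - set xs" for v
      using e[OF that] by simp
    obtain \<rho>' e1 where *: "bf B S A R d \<rho>'" "agree_off (set xs) A e e1"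
        "\<And>v. v \<in> fv p \<Longrightarrow> (e1' v, e1 v) \<in> \<rho>'"
      using bf_extend_env[OF bf_converse[OF bf(1)] bf(2) e' e1'] by metis
    have "sat A R p e1 = sat B S p e1'"
      by (rule bf_invariantD[OF inv order_refl bf_converse[OF *(1)]]) (simp add: *(3))
    then show ?thesis using * by blast
  qed
  show "sat A R (Exs xs p) e = sat B S (Exs xs p) e'" "sat A R (Alls xs p) e = sat B S (Alls xs p) e'"
    unfolding sat_Exs sat_Alls using 1 2 by metis+
qed

text \<open>A quantifier block lowers the level and is answered by one move, which lowers the rank;
  conjunctions and disjunctions cost nothing.\<close>

lemma bf_invariant_Sigma_Pi:
  shows "Sigma_in b p \<Longrightarrow> bf_invariant A R B S b p"
    and "Pi_in b p \<Longrightarrow> bf_invariant A R B S b p"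
proof (induction rule: Sigma_in_Pi_in.inducts)
  case (1 p)
  then show ?case
    unfolding bf_invariant_def using qf_piso[OF bfD(3)] by blast
next
  case (2 p)
  then show ?case
    unfolding bf_invariant_def using qf_piso[OF bfD(3)] by blast
next
  case (3 \<alpha> I F)
  show ?case
    unfolding bf_invariant_def
  proof (intro allI impI)
    fix a \<rho> and e :: "nat \<Rightarrow> 'a" and e' :: "nat \<Rightarrow> 'b"
    assume *: "\<alpha> \<le> a" "bf A R B S a \<rho>" "\<forall>v\<in>fv (Disj I F). (e v, e' v) \<in> \<rho>"
    have "sat A R (F i) e = sat B S (F i) e'" if "i \<in> I" for i
    proof -
      obtain xs \<beta> p where p: "F i = Exs xs p" "\<beta> < \<alpha>" "bf_invariant A R B S \<beta> p"
        using 3(2) \<open>i \<in> I\<close> by blast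
      have "(e v, e' v) \<in> \<rho>" if "v \<in> fv p - set xs" for v
        using *(3) p(1) \<open>i \<in> I\<close> that by force
      then show ?thesis
        using bf_sat_Exs(1)[OF *(2) _ p(3)] p(1,2) *(1) by auto
    qed
    then show "sat A R (Disj I F) e = sat B S (Disj I F) e'" by simp
  qed
next
  case (4 \<alpha> I F)
  show ?case
    unfolding bf_invariant_def
  proof (intro allI impI)
    fix a \<rho> and e :: "nat \<Rightarrow> 'a" and e' :: "nat \<Rightarrow> 'b"
    assume *: "\<alpha> \<le> a" "bf A R B S a \<rho>" "\<forall>v\<in>fv (Conj I F). (e v, e' v) \<in> \<rho>"
    have "sat A R (F i) e = sat B S (F i) e'" if "i \<in> I" for i
    proof -
      obtain xs \<beta> p where p: "F i = Alls xs p" "\<beta> < \<alpha>" "bf_invariant A R B S \<beta> p"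
        using 4(2) \<open>i \<in> I\<close> by blast
      have "(e v, e' v) \<in> \<rho>" if "v \<in> fv p - set xs" for v
        using *(3) p(1) \<open>i \<in> I\<close> that by force
      then show ?thesis
        using bf_sat_Exs(2)[OF *(2) _ p(3)] p(1,2) *(1) by auto
    qed
    then show "sat A R (Conj I F) e = sat B S (Conj I F) e'" by simp
  qed
qed

text \<open>A universal instance is caught by a large enough substructure, where the sentence holds;
  the existential witnesses found there keep their \<Pi> matrix of level \<open>l + 1\<close> in
  \<open>B\<close>. Preservation thus gains two levels over the assumed rank.\<close>

lemma Pi_transfer_from_substructures:
  assumes p: "sentence p" "Pi_in (osuc (osuc (osuc l))) p"
    and sub: "\<And>D. finite D \<Longrightarrow> D \<subseteq> B \<Longrightarrow> \<exists>A. D \<subseteq> A \<and> A \<subseteq> B \<and> models A (R A) p \<and>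
       (\<forall>C. finite C \<longrightarrow> C \<subseteq> A \<longrightarrow> bf A (R A) B S (osuc l) (Id_on C))"
  shows "models B S p"
proof -
  obtain I F where pF: "p = Conj I F"
    and F: "\<And>i. i \<in> I \<Longrightarrow> \<exists>xs b q. F i = Alls xs q \<and> b < osuc (osuc (osuc l)) \<and> Sigma_in b q"
    using p(2) by (cases rule: Pi_in.cases) auto
  have "sat B S (F i) e" if i: "i \<in> I" and e: "range e \<subseteq> B" for i e
  proof -
    obtain xs b q where q: "F i = Alls xs q" "b < osuc (osuc (osuc l))" "Sigma_in b q"
      using F[OF i] by blast
    have fvq: "fv q \<subseteq> set xs"
      using p(1) i fv_Alls[of xs q, folded q(1)] by (auto simp: pF sentence_def)
    have "sat B S q e1" if e1: "agree_off (set xs) B e e1" for e1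
    proof -
      have "e1 ` set xs \<subseteq> B" "range e1 \<subseteq> B"
        using e1 e unfolding agree_off_def by (auto simp: image_subset_iff)
      then obtain A where A: "insert (e1 0) (e1 ` set xs) \<subseteq> A" "A \<subseteq> B" "models A (R A) p"
        and bf: "\<And>C. finite C \<Longrightarrow> C \<subseteq> A \<Longrightarrow> bf A (R A) B S (osuc l) (Id_on C)"
        using sub[of "insert (e1 0) (e1 ` set xs)"] by (auto simp: image_subset_iff)
      \<comment> \<open>Variables outside \<open>xs\<close> may have values outside
        \<open>A\<close>; they are reset to \<open>e1 0\<close>, which was put into the finite set
        to be covered for this purpose.\<close>
      define e2 where "e2 v = (if v \<in> set xs then e1 v else e1 0)" for v
      have e2: "range e2 \<subseteq> A" "\<And>v. v \<in> set xs \<Longrightarrow> e2 v = e1 v"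
        using A(1) by (auto simp: e2_def)
      have "sat A (R A) (F i) e2"
        using A(3) e2(1) i by (auto simp: models_def pF)
      then have sat: "sat A (R A) q e2"
        unfolding q(1) sat_Alls using e2(1) by (auto simp: agree_off_def)
      have "sat B S q e2"
        using q(3)
      proof (cases rule: Sigma_in.cases)
        case 1
        have "sat A (R A) q e2 = sat B S q e2"
          using bf[of "e2 ` set xs"] e2(1) fvq
          by (intro qf_piso[OF bfD(3) 1(2), of A _ B _ _ "Id_on (e2 ` set xs)"]) auto
        then show ?thesis using sat by simp
      next
        case (2 J G)
        then obtain j where j: "j \<in> J" "sat A (R A) (G j) e2"
          using sat by auto
        obtain ys c r where r: "G j = Exs ys r" "c < b" "Pi_in c r"
          using 2(3) j(1) by blast
        \<comment> \<open>Two strict descents from \<open>l + 3\<close> leave at most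
          \<open>l + 1\<close>, exactly the rank available.\<close>
        have c: "c \<le> osuc l" using r(2) q(2) by (metis less_osuc_iff order.strict_trans2)
        obtain e3 where e3: "agree_off (set ys) A e2 e3" "sat A (R A) r e3"
          using j(2) unfolding r(1) sat_Exs by blast
        have fvr: "fv r \<subseteq> set ys \<union> set xs"
          using fvq j(1) fv_Exs[of ys r, folded r(1)] 2(1) by auto
        have sub3: "e3 ` (set ys \<union> set xs) \<subseteq> A"
        proof safe
          fix v assume "v \<in> set xs"
          then show "e3 v \<in> A"
            using e3(1) e2(1) by (cases "v \<in> set ys") (auto simp: agree_off_def)
        qed (use e3(1) in \<open>auto simp: agree_off_def\<close>)
        have "sat A (R A) r e3 = sat B S r e3"
          by (rule bf_invariantD[OF bf_invariant_Sigma_Pi(2)[OF r(3)] c bf[OF _ sub3]])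
            (use fvr in auto)
        then have "sat B S (G j) e2"
          unfolding r(1) sat_Exs using e3 A(2) by (auto simp: agree_off_def)
        then show ?thesis using j(1) 2(1) by auto
      qed
      then show ?thesis
        using sat_cong[of q e1 e2] e2(2) fvq by (metis subsetD)
    qed
    then show ?thesis unfolding q(1) sat_Alls by blast
  qed
  then show ?thesis by (auto simp: models_def pF)
qed

subsection \<open>Definable classes of structures\<close>

lemma Sigma_in_mono:
  assumes "Sigma_in a p" "0 < a" "a \<le> b"
  shows "Sigma_in b p"
  using assms(1)
proof (cases rule: Sigma_in.cases)
  case (2 I F)
  then show ?thesis
    using assms(2,3) by (auto intro!: Sigma_in_Pi_in.intros(3)) (meson order.strict_trans2)+
qed (use assms in simp)

lemma Pi_in_mono:
  assumes "Pi_in a p" "0 < a" "a \<le> b"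
  shows "Pi_in b p"
  using assms(1)
proof (cases rule: Pi_in.cases)
  case (2 I F)
  then show ?thesis
    using assms(2,3) by (auto intro!: Sigma_in_Pi_in.intros(4)) (meson order.strict_trans2)+
qed (use assms in simp)

text \<open>The positive levels have no \<open>Neg\<close>; negation is pushed inwards by dualising
  every block, down to the quantifier-free level, which is closed under it.\<close>

lemma negation_exists:
  shows "Sigma_in a p \<Longrightarrow> \<exists>q. Pi_in a q \<and> fv q = fv p \<and>
    (\<forall>(A :: 'a set) R e. sat A R q e \<longleftrightarrow> \<not> sat A R p e)"
    and "Pi_in a p \<Longrightarrow> \<exists>q. Sigma_in a q \<and> fv q = fv p \<and>
    (\<forall>(A :: 'a set) R e. sat A R q e \<longleftrightarrow> \<not> sat A R p e)"
proof (induction rule: Sigma_in_Pi_in.inducts)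
  case (1 p)
  then show ?case
    by (intro exI[of _ "Neg p"]) (auto intro: Sigma_in_Pi_in.intros qf.intros)
next
  case (2 p)
  then show ?case
    by (intro exI[of _ "Neg p"]) (auto intro: Sigma_in_Pi_in.intros qf.intros)
next
  case (3 \<alpha> I F)
  have "\<forall>i\<in>I. \<exists>r. (\<exists>xs \<beta> p. r = Alls xs p \<and> \<beta> < \<alpha> \<and> Sigma_in \<beta> p) \<and> fv r = fv (F i) \<and>
      (\<forall>(A :: 'a set) R e. sat A R r e \<longleftrightarrow> \<not> sat A R (F i) e)"
  proof
    fix i assume "i \<in> I"
    then obtain xs \<beta> p q where p: "F i = Exs xs p" "\<beta> < \<alpha>" "Sigma_in \<beta> q" "fv q = fv p"
      "\<And>(A :: 'a set) R e. sat A R q e \<longleftrightarrow> \<not> sat A R p e"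
      using 3(2) by blast
    then show "\<exists>r. (\<exists>xs \<beta> p. r = Alls xs p \<and> \<beta> < \<alpha> \<and> Sigma_in \<beta> p) \<and> fv r = fv (F i) \<and>
      (\<forall>(A :: 'a set) R e. sat A R r e \<longleftrightarrow> \<not> sat A R (F i) e)"
      by (intro exI[of _ "Alls xs q"]) (auto simp: sat_Exs sat_Alls)
  qed
  then obtain G where G: "\<And>i. i \<in> I \<Longrightarrow> \<exists>xs \<beta> p. G i = Alls xs p \<and> \<beta> < \<alpha> \<and> Sigma_in \<beta> p"
    "\<And>i. i \<in> I \<Longrightarrow> fv (G i) = fv (F i)"
    "\<And>i (A :: 'a set) R e. i \<in> I \<Longrightarrow> sat A R (G i) e \<longleftrightarrow> \<not> sat A R (F i) e"
    by metis
  show ?case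
    using G 3(1) by (intro exI[of _ "Conj I G"]) (simp add: Sigma_in_Pi_in.intros(4))
next
  case (4 \<alpha> I F)
  have "\<forall>i\<in>I. \<exists>r. (\<exists>xs \<beta> p. r = Exs xs p \<and> \<beta> < \<alpha> \<and> Pi_in \<beta> p) \<and> fv r = fv (F i) \<and>
      (\<forall>(A :: 'a set) R e. sat A R r e \<longleftrightarrow> \<not> sat A R (F i) e)"
  proof
    fix i assume "i \<in> I"
    then obtain xs \<beta> p q where p: "F i = Alls xs p" "\<beta> < \<alpha>" "Pi_in \<beta> q" "fv q = fv p"
      "\<And>(A :: 'a set) R e. sat A R q e \<longleftrightarrow> \<not> sat A R p e"
      using 4(2) by blast
    then show "\<exists>r. (\<exists>xs \<beta> p. r = Exs xs p \<and> \<beta> < \<alpha> \<and> Pi_in \<beta> p) \<and> fv r = fv (F i) \<and>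
      (\<forall>(A :: 'a set) R e. sat A R r e \<longleftrightarrow> \<not> sat A R (F i) e)"
      by (intro exI[of _ "Exs xs q"]) (auto simp: sat_Exs sat_Alls)
  qed
  then obtain G where G: "\<And>i. i \<in> I \<Longrightarrow> \<exists>xs \<beta> p. G i = Exs xs p \<and> \<beta> < \<alpha> \<and> Pi_in \<beta> p"
    "\<And>i. i \<in> I \<Longrightarrow> fv (G i) = fv (F i)"
    "\<And>i (A :: 'a set) R e. i \<in> I \<Longrightarrow> sat A R (G i) e \<longleftrightarrow> \<not> sat A R (F i) e"
    by metis
  show ?case
    using G 4(1) by (intro exI[of _ "Disj I G"]) (simp add: Sigma_in_Pi_in.intros(3))
qed

text \<open>Definability is stated for predicates of structure and assignment, so that levels can be
  computed without writing formulas. The arguments are the variables below \<open>n\<close>; the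
  next quantifier block binds variables from \<open>n\<close> on.\<close>

definition expresses :: "fm \<Rightarrow> nat \<Rightarrow> (nat set \<Rightarrow> nat rel \<Rightarrow> (nat \<Rightarrow> nat) \<Rightarrow> bool) \<Rightarrow> bool" where
  "expresses p n P \<longleftrightarrow> fv p \<subseteq> {..<n} \<and>
    (\<forall>B S e. is_struct B S \<longrightarrow> range e \<subseteq> B \<longrightarrow> (sat B S p e \<longleftrightarrow> P B S e))"

definition Sigma_definable where
  "Sigma_definable a n P \<longleftrightarrow> (\<exists>p. Sigma_in a p \<and> expresses p n P)"

definition Pi_definable where
  "Pi_definable a n P \<longleftrightarrow> (\<exists>p. Pi_in a p \<and> expresses p n P)"

lemma Pi_definable_Not: "Pi_definable a n (\<lambda>B S e. \<not> P B S e) \<longleftrightarrow> Sigma_definable a n P"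
proof
  assume "Pi_definable a n (\<lambda>B S e. \<not> P B S e)"
  then obtain p where p: "Pi_in a p" "expresses p n (\<lambda>B S e. \<not> P B S e)"
    by (auto simp: Pi_definable_def)
  then show "Sigma_definable a n P"
    using negation_exists(2)[OF p(1), where 'a = nat] p(2)
    by (force simp: Sigma_definable_def expresses_def)
next
  assume "Sigma_definable a n P"
  then obtain p where p: "Sigma_in a p" "expresses p n P"
    by (auto simp: Sigma_definable_def)
  then show "Pi_definable a n (\<lambda>B S e. \<not> P B S e)"
    using negation_exists(1)[OF p(1), where 'a = nat] p(2)
    by (force simp: Pi_definable_def expresses_def)
qed

lemma Sigma_definable_Not: "Sigma_definable a n (\<lambda>B S e. \<not> P B S e) \<longleftrightarrow> Pi_definable a n P"
  by (simp flip: Pi_definable_Not)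

lemma Sigma_definable_cong:
  assumes "Sigma_definable a n P" "\<And>B S e. is_struct B S \<Longrightarrow> range e \<subseteq> B \<Longrightarrow> P B S e \<longleftrightarrow> Q B S e"
  shows "Sigma_definable a n Q"
  using assms unfolding Sigma_definable_def expresses_def by metis

lemma Pi_definable_cong:
  assumes "Pi_definable a n P" "\<And>B S e. is_struct B S \<Longrightarrow> range e \<subseteq> B \<Longrightarrow> P B S e \<longleftrightarrow> Q B S e"
  shows "Pi_definable a n Q"
  using assms unfolding Pi_definable_def expresses_def by metis

text \<open>Block length \<open>k t\<close> and level may vary with the disjunct; the dual form uses
  this to speak of tuples of all lengths and of all smaller ranks at once.\<close>

lemma Sigma_definable_Ex:
  assumes T: "countable T" "0 < b"
    and Q: "\<And>t. t \<in> T \<Longrightarrow> \<exists>c<b. Pi_definable c (n + k t) (Q t)"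
  shows "Sigma_definable b n (\<lambda>B S e. \<exists>t\<in>T. \<exists>e'. agree_off {n..<n + k t} B e e' \<and> Q t B S e')"
proof -
  obtain c q where q: "\<And>t. t \<in> T \<Longrightarrow> c t < b \<and> Pi_in (c t) (q t) \<and> expresses (q t) (n + k t) (Q t)"
    using Q unfolding Pi_definable_def by metis
  define p where "p = Disj (to_nat_on T ` T) (\<lambda>i. Exs [n..<n + k (from_nat_into T i)] (q (from_nat_into T i)))"
  have "Sigma_in b p"
    unfolding p_def
    by (rule Sigma_in_Pi_in.intros(3)[OF T(2)]) (use q T(1) in \<open>auto intro!: exI\<close>)
  moreover have "expresses p n (\<lambda>B S e. \<exists>t\<in>T. \<exists>e'. agree_off {n..<n + k t} B e e' \<and> Q t B S e')"
    unfolding expresses_def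
  proof (intro conjI allI impI)
    show "fv p \<subseteq> {..<n}"
      using q T(1) by (fastforce simp: p_def expresses_def)
    fix B S and e :: "nat \<Rightarrow> nat" assume B: "is_struct B S" "range e \<subseteq> B"
    have "sat B S (q t) e' \<longleftrightarrow> Q t B S e'" if "t \<in> T" "agree_off {n..<n + k t} B e e'" for t e'
    proof -
      have "range e' \<subseteq> B" using that(2) B(2) by (auto simp: agree_off_def image_subset_iff)
      then show ?thesis using q[OF that(1)] B(1) by (simp add: expresses_def)
    qed
    then show "sat B S p e \<longleftrightarrow> (\<exists>t\<in>T. \<exists>e'. agree_off {n..<n + k t} B e e' \<and> Q t B S e')"
      using T(1) by (auto simp: p_def sat_Exs)
  qed
  ultimately show ?thesis unfolding Sigma_definable_def by blast
qed

lemma Pi_definable_All: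
  assumes T: "countable T" "0 < b"
    and Q: "\<And>t. t \<in> T \<Longrightarrow> \<exists>c<b. Sigma_definable c (n + k t) (Q t)"
  shows "Pi_definable b n (\<lambda>B S e. \<forall>t\<in>T. \<forall>e'. agree_off {n..<n + k t} B e e' \<longrightarrow> Q t B S e')"
proof -
  have "\<exists>c<b. Pi_definable c (n + k t) (\<lambda>B S e. \<not> Q t B S e)" if "t \<in> T" for t
    using Q[OF that] by (simp only: Pi_definable_Not)
  from Sigma_definable_Ex[OF T this] show ?thesis
    by (subst Sigma_definable_Not[symmetric]) (simp only: not_all ball_simps not_imp not_not)
qed

lemma Sigma_definable_or:
  assumes "Sigma_definable b n P" "Sigma_definable b n Q" "0 < b"
  shows "Sigma_definable b n (\<lambda>B S e. P B S e \<or> Q B S e)"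
proof -
  obtain p where p: "Sigma_in b p" "expresses p n P"
    using assms by (auto simp: Sigma_definable_def)
  obtain q where q: "Sigma_in b q" "expresses q n Q"
    using assms by (auto simp: Sigma_definable_def)
  obtain I F where F: "p = Disj I F" "\<forall>i\<in>I. \<exists>xs \<beta> p. F i = Exs xs p \<and> \<beta> < b \<and> Pi_in \<beta> p"
    using p(1) assms(3) by (cases rule: Sigma_in.cases) auto
  obtain J G where G: "q = Disj J G" "\<forall>i\<in>J. \<exists>xs \<beta> p. G i = Exs xs p \<and> \<beta> < b \<and> Pi_in \<beta> p"
    using q(1) assms(3) by (cases rule: Sigma_in.cases) auto
  \<comment> \<open>Even and odd indices keep the two families apart, so that the result is a single
    disjunction of the same level.\<close>
  define r where "r = Disj ((\<lambda>i. 2 * i) ` I \<union> (\<lambda>i. 2 * i + 1) ` J)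
    (\<lambda>i. if even i then F (i div 2) else G (i div 2))"
  have "Sigma_in b r"
    unfolding r_def
    by (rule Sigma_in_Pi_in.intros(3)[OF assms(3)]) (use F(2) G(2) in auto)
  moreover have "expresses r n (\<lambda>B S e. P B S e \<or> Q B S e)"
    using p(2) q(2) unfolding expresses_def r_def F(1) G(1) by (auto simp: bex_Un)
  ultimately show ?thesis unfolding Sigma_definable_def by blast
qed

lemma Pi_definable_and:
  assumes "Pi_definable b n P" "Pi_definable b n Q" "0 < b"
  shows "Pi_definable b n (\<lambda>B S e. P B S e \<and> Q B S e)"
  using assms(1,2)[folded Sigma_definable_Not]
  by (subst Sigma_definable_Not[symmetric]) (simp only: de_Morgan_conj Sigma_definable_or assms(3))

lemma Sigma_definable_mono: "Sigma_definable a n P \<Longrightarrow> 0 < a \<Longrightarrow> a \<le> b \<Longrightarrow> Sigma_definable b n P"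
  unfolding Sigma_definable_def using Sigma_in_mono by blast

lemma Sigma_definable_if_Pi: "Pi_definable a n P \<Longrightarrow> a < b \<Longrightarrow> Sigma_definable b n P"
  by (rule Sigma_definable_cong, rule Sigma_definable_Ex[of "{()}" b n "\<lambda>_. 0" "\<lambda>_. P"])
    (auto intro: order.strict_trans1[OF zero_le_cord])

lemma Sigma_definable_arity: "Sigma_definable a n P \<Longrightarrow> n \<le> m \<Longrightarrow> Sigma_definable a m P"
  unfolding Sigma_definable_def expresses_def by (meson lessThan_subset_iff subset_trans)

section \<open>Scott sentences from back-and-forth relations\<close>

text \<open>Variable \<open>i\<close> holds the partner of the \<open>i\<close>-th entry; in this
  way a finite relation becomes the argument of a formula.\<close>

definition tuple_rel :: "'a list \<Rightarrow> (nat \<Rightarrow> 'b) \<Rightarrow> ('a \<times> 'b) set" where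
  "tuple_rel as e = (\<lambda>i. (as ! i, e i)) ` {..<length as}"

lemma finite_tuple_rel [simp]: "finite (tuple_rel as e)"
  by (simp add: tuple_rel_def)

lemma tuple_rel_iff: "(x, y) \<in> tuple_rel as e \<longleftrightarrow> (\<exists>i<length as. x = as ! i \<and> y = e i)"
  by (auto simp: tuple_rel_def)

lemma tuple_rel_subset: "set as \<subseteq> A \<Longrightarrow> range e \<subseteq> B \<Longrightarrow> tuple_rel as e \<subseteq> A \<times> B"
  by (force simp: tuple_rel_iff)

lemma tuple_rel_append:
  assumes "\<And>i. i < length as \<Longrightarrow> e' i = e i"
  shows "tuple_rel as e \<subseteq> tuple_rel (as @ cs) e'"
  using assms by (force simp: tuple_rel_iff nth_append)

lemma tuple_rel_append_Domain: "set cs \<subseteq> Domain (tuple_rel (as @ cs) e)"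
proof
  fix c assume "c \<in> set cs"
  then obtain i where "i < length cs" "c = cs ! i" by (auto simp: in_set_conv_nth)
  then have "(c, e (length as + i)) \<in> tuple_rel (as @ cs) e"
    by (auto simp: tuple_rel_iff intro!: exI[of _ "length as + i"])
  then show "c \<in> Domain (tuple_rel (as @ cs) e)" by blast
qed

lemma tuple_rel_append_Range: "e ` {length as..<length as + length cs} \<subseteq> Range (tuple_rel (as @ cs) e)"
proof safe
  fix i assume "i \<in> {length as..<length as + length cs}"
  then have "((as @ cs) ! i, e i) \<in> tuple_rel (as @ cs) e"
    by (auto simp: tuple_rel_iff)
  then show "e i \<in> Range (tuple_rel (as @ cs) e)" by blast
qed

lemma tuple_rel_append_subset:
  assumes "tuple_rel as e \<subseteq> \<rho>" "\<And>i. i < length as \<Longrightarrow> e' i = e i"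
    "\<And>j. j < length cs \<Longrightarrow> (cs ! j, e' (length as + j)) \<in> \<rho>"
  shows "tuple_rel (as @ cs) e' \<subseteq> \<rho>"
proof safe
  fix x y assume "(x, y) \<in> tuple_rel (as @ cs) e'"
  then obtain i where i: "i < length as + length cs" "x = (as @ cs) ! i" "y = e' i"
    by (auto simp: tuple_rel_iff)
  show "(x, y) \<in> \<rho>"
  proof (cases "i < length as")
    case True
    then have "(x, y) \<in> tuple_rel as e" using assms(2) i by (auto simp: nth_append tuple_rel_iff)
    then show ?thesis using assms(1) by blast
  next
    case False
    then show ?thesis using assms(3)[of "i - length as"] i by (auto simp: nth_append)
  qed
qed

text \<open>One back-and-forth step in the shape of a formula: moves in \<open>B\<close> become
  quantifiers over blocks of variables, moves in the fixed structure \<open>A\<close> become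
  conjunctions and disjunctions over lists.\<close>

lemma bf_tuple_rel_iff:
  assumes as: "set as \<subseteq> A" and e: "range e \<subseteq> B" and a: "0 < a"
  shows "bf A R B S a (tuple_rel as e) \<longleftrightarrow>
    (\<forall>t\<in>{..<a} \<times> UNIV. \<forall>e'. agree_off {length as..<length as + snd t} B e e' \<longrightarrow>
       (\<exists>cs\<in>{cs. set cs \<subseteq> A \<and> length cs = snd t}. bf A R B S (fst t) (tuple_rel (as @ cs) e'))) \<and>
    (\<forall>t\<in>{..<a} \<times> {cs. set cs \<subseteq> A}. \<exists>e'. agree_off {length as..<length as + length (snd t)} B e e' \<and>
       bf A R B S (fst t) (tuple_rel (as @ snd t) e'))"
    (is "_ \<longleftrightarrow> ?L \<and> ?R")
proof (intro iffI conjI)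
  assume bf: "bf A R B S a (tuple_rel as e)"
  show ?L
  proof (intro ballI allI impI)
    fix t e' assume t: "t \<in> {..<a} \<times> UNIV" "agree_off {length as..<length as + snd t} B e e'"
    define d k where "d = fst t" and "k = snd t"
    have e': "agree_off {length as..<length as + k} B e e'" "d \<in> {..<a}"
      using t by (auto simp: d_def k_def)
    then have d: "d < a" "e' ` {length as..<length as + k} \<subseteq> B"
      by (auto simp: agree_off_def)
    from bf_back[OF bf d(1) _ d(2)] obtain \<rho>' where \<rho>': "tuple_rel as e \<subseteq> \<rho>'"
      "e' ` {length as..<length as + k} \<subseteq> Range \<rho>'" "bf A R B S d \<rho>'" by auto
    have "\<forall>j<k. \<exists>c. (c, e' (length as + j)) \<in> \<rho>'"
      using \<rho>'(2) by (force simp: image_subset_iff Range_iff)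
    then obtain c where c: "\<And>j. j < k \<Longrightarrow> (c j, e' (length as + j)) \<in> \<rho>'" by metis
    have "tuple_rel (as @ map c [0..<k]) e' \<subseteq> \<rho>'"
      using \<rho>'(1) c e' by (intro tuple_rel_append_subset[of as e]) (auto simp: agree_off_def)
    then have "bf A R B S d (tuple_rel (as @ map c [0..<k]) e')"
      using bf_mono[OF \<rho>'(3)] by simp
    moreover have "set (map c [0..<k]) \<subseteq> A"
    proof safe
      fix x assume "x \<in> set (map c [0..<k])"
      then obtain j where "j < k" "x = c j" by auto
      then show "x \<in> A" using c[of j] bfD(2)[OF \<rho>'(3)] by blast
    qed
    ultimately show "\<exists>cs\<in>{cs. set cs \<subseteq> A \<and> length cs = snd t}. bf A R B S (fst t) (tuple_rel (as @ cs) e')"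
      unfolding d_def k_def by (intro bexI[of _ "map c [0..<snd t]"]) auto
  qed
  show ?R
  proof
    fix t assume t: "t \<in> {..<a} \<times> {cs. set cs \<subseteq> A}"
    define d cs where "d = fst t" and "cs = snd t"
    have d: "d < a" "set cs \<subseteq> A" using t by (auto simp: d_def cs_def)
    from bf_forth[OF bf d(1) _ d(2)] obtain \<rho>' where \<rho>': "tuple_rel as e \<subseteq> \<rho>'"
      "set cs \<subseteq> Domain \<rho>'" "bf A R B S d \<rho>'" by auto
    have "\<forall>c\<in>set cs. \<exists>y. (c, y) \<in> \<rho>'"
      using \<rho>'(2) by blast
    then obtain f where f: "\<And>c. c \<in> set cs \<Longrightarrow> (c, f c) \<in> \<rho>'" by metis
    define e' where "e' v = (if v \<in> {length as..<length as + length cs} then f (cs ! (v - length as)) else e v)" for v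
    have "tuple_rel (as @ cs) e' \<subseteq> \<rho>'"
      using \<rho>'(1) f by (intro tuple_rel_append_subset[of as e]) (auto simp: e'_def)
    then have "bf A R B S d (tuple_rel (as @ cs) e')"
      using bf_mono[OF \<rho>'(3)] by simp
    moreover have "agree_off {length as..<length as + length cs} B e e'"
      using bfD(2)[OF \<rho>'(3)] f by (auto simp: agree_off_def e'_def) (metis SigmaD2 add.commute less_diff_conv2 nth_mem subsetD)
    ultimately show "\<exists>e'. agree_off {length as..<length as + length (snd t)} B e e' \<and>
        bf A R B S (fst t) (tuple_rel (as @ snd t) e')"
      unfolding d_def cs_def by blast
  qed
next
  assume *: "?L \<and> ?R"
  show "bf A R B S a (tuple_rel as e)"
  proof (rule bfI)
    \<comment> \<open>The instance of rank 0 with the empty tuple yields the partial isomorphism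
      condition; such an instance exists because the rank is positive.\<close>
    have "\<exists>cs. length cs = 0 \<and> bf A R B S 0 (tuple_rel (as @ cs) e)"
      using *[THEN conjunct1, THEN bspec, of "(0, 0)"] a by auto
    then show "piso R S (tuple_rel as e)"
      using bfD(3) by fastforce
  next
    fix d C assume d: "d < a" "finite C" "C \<subseteq> A"
    then obtain cs where cs: "set cs = C" using finite_list by blast
    then obtain e' where e': "agree_off {length as..<length as + length cs} B e e'"
      "bf A R B S d (tuple_rel (as @ cs) e')"
      using *[THEN conjunct2, THEN bspec, of "(d, cs)"] d by auto
    show "\<exists>\<rho>'. tuple_rel as e \<subseteq> \<rho>' \<and> C \<subseteq> Domain \<rho>' \<and> bf A R B S d \<rho>'"
      using e' tuple_rel_append[of as e' e] tuple_rel_append_Domain[of cs as e'] cs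
      by (intro exI[of _ "tuple_rel (as @ cs) e'"]) (auto simp: agree_off_def)
  next
    fix d D assume d: "d < a" "finite D" "D \<subseteq> B"
    then obtain ds where ds: "set ds = D" using finite_list by blast
    define e' where "e' v = (if v \<in> {length as..<length as + length ds} then ds ! (v - length as) else e v)" for v
    have "agree_off {length as..<length as + length ds} B e e'"
      using ds d(3) by (auto simp: agree_off_def e'_def) (metis add.commute less_diff_conv2 nth_mem subsetD)
    then obtain cs where cs: "length cs = length ds" "bf A R B S d (tuple_rel (as @ cs) e')"
      using *[THEN conjunct1, THEN bspec, of "(d, length ds)"] d by auto
    have "D \<subseteq> e' ` {length as..<length as + length cs}"
    proof
      fix y assume "y \<in> D"
      then obtain i where "i < length ds" "y = ds ! i" using ds by (auto simp: in_set_conv_nth)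
      then have "y = e' (length as + i)" "length as + i \<in> {length as..<length as + length cs}"
        using cs(1) by (auto simp: e'_def)
      then show "y \<in> e' ` {length as..<length as + length cs}" by blast
    qed
    then show "\<exists>\<rho>'. tuple_rel as e \<subseteq> \<rho>' \<and> D \<subseteq> Range \<rho>' \<and> bf A R B S d \<rho>'"
      using cs tuple_rel_append[of as e' e cs] tuple_rel_append_Range[of e' as cs]
      by (intro exI[of _ "tuple_rel (as @ cs) e'"]) (auto simp: e'_def)
  qed (use tuple_rel_subset[OF as e] in auto)
qed

lemma bf_0_iff:
  "bf A R B S 0 \<rho> \<longleftrightarrow> finite \<rho> \<and> \<rho> \<subseteq> A \<times> B \<and> piso R S \<rho>"
  using bfD[of A R B S 0 \<rho>] by (metis bfI linorder_not_less zero_le_cord)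

lemma countable_bounded_lists: "countable A \<Longrightarrow> countable {cs. set cs \<subseteq> A}"
  using countable_lists[of A] by (simp add: lists_eq_set)

text \<open>The possible answers in \<open>A\<close> form a countable disjunction of level
  \<open>dbl d + 1\<close>. The conjunction over all moves and all \<open>d < a\<close> lies above
  these levels, and \<open>dbl a\<close> is large enough by \<open>dbl_less\<close>.\<close>

lemma bf_Pi_definable:
  assumes A: "countable A"
  shows "set as \<subseteq> A \<Longrightarrow> Pi_definable (dbl a) (length as) (\<lambda>B S e. bf A R B S a (tuple_rel as e))"
proof (induction a arbitrary: as rule: less_induct)
  case (less a)
  let ?n = "length as"
  show ?case
  proof (cases "a = 0")
    case True
    \<comment> \<open>Rank 0 is the finite diagram of the tuple: equalities and order relations,
      each asserted or negated.\<close>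
    define lit where "lit b p = (if b then p else Neg p)" for b p
    define atm where "atm i j = And (lit (as ! i = as ! j) (Eq i j)) (lit ((as ! i, as ! j) \<in> R) (Le i j))" for i j
    define p where "p = Conj {..<?n} (\<lambda>i. Conj {..<?n} (atm i))"
    have "qf p"
      unfolding p_def atm_def And_def lit_def by (auto intro!: qf.intros)
    then have "Pi_in 0 p" by (rule Sigma_in_Pi_in.intros)
    moreover have "expresses p ?n (\<lambda>B S e. bf A R B S a (tuple_rel as e))"
      unfolding expresses_def
    proof (intro conjI allI impI)
      show "fv p \<subseteq> {..<?n}"
        by (auto simp: p_def atm_def And_def lit_def split: if_splits)
      fix B S and e :: "nat \<Rightarrow> nat" assume B: "is_struct B S" "range e \<subseteq> B"
      have "sat B S (atm i j) e \<longleftrightarrow> (as ! i = as ! j \<longleftrightarrow> e i = e j) \<and>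
          ((as ! i, as ! j) \<in> R \<longleftrightarrow> (e i, e j) \<in> S)" for i j
        unfolding atm_def And_def lit_def by auto
      then have "sat B S p e \<longleftrightarrow> (\<forall>i<?n. \<forall>j<?n. (as ! i = as ! j \<longleftrightarrow> e i = e j) \<and>
          ((as ! i, as ! j) \<in> R \<longleftrightarrow> (e i, e j) \<in> S))"
        unfolding p_def by auto
      also have "\<dots> \<longleftrightarrow> piso R S (tuple_rel as e)"
        unfolding piso_def tuple_rel_iff by blast
      finally show "sat B S p e \<longleftrightarrow> bf A R B S a (tuple_rel as e)"
        using tuple_rel_subset[OF less.prems B(2)] True by (simp add: bf_0_iff)
    qed
    ultimately show ?thesis
      using True by (auto simp: Pi_definable_def)
  next
    case False
    then have a: "0 < a" using zero_le_cord[of a] by simp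
    have a': "0 < dbl a" using dbl_less[OF a] osuc_pos by (metis order.strict_trans2)
    have lev: "osuc (dbl d) < dbl a" if "d < a" for d
      using dbl_less[OF that] by (simp add: osuc_le_iff)
    have 1: "Sigma_definable (osuc (dbl d)) (?n + k) (\<lambda>B S e. \<exists>cs\<in>{cs. set cs \<subseteq> A \<and> length cs = k}.
        bf A R B S d (tuple_rel (as @ cs) e))" if "d < a" for d k
    proof -
      have "countable {cs. set cs \<subseteq> A \<and> length cs = k}"
        using countable_bounded_lists[OF A] by (rule countable_subset[rotated]) auto
      moreover have "\<exists>c<osuc (dbl d). Pi_definable c (?n + k + 0) (\<lambda>B S e. bf A R B S d (tuple_rel (as @ cs) e))"
        if "cs \<in> {cs. set cs \<subseteq> A \<and> length cs = k}" for cs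
        using less.IH[OF \<open>d < a\<close>, of "as @ cs"] that less.prems less_osuc by auto
      ultimately show ?thesis
        using Sigma_definable_Ex[of "{cs. set cs \<subseteq> A \<and> length cs = k}" "osuc (dbl d)" "?n + k" "\<lambda>_. 0"
            "\<lambda>cs B S e. bf A R B S d (tuple_rel (as @ cs) e)"] by simp
    qed
    have 2: "Sigma_definable (osuc (dbl d)) ?n (\<lambda>B S e. \<exists>e'. agree_off {?n..<?n + length cs} B e e' \<and>
        bf A R B S d (tuple_rel (as @ cs) e'))" if "d < a" "set cs \<subseteq> A" for d cs
    proof -
      have "\<exists>c<osuc (dbl d). Pi_definable c (?n + length cs) (\<lambda>B S e. bf A R B S d (tuple_rel (as @ cs) e))"
        using less.IH[OF \<open>d < a\<close>, of "as @ cs"] that less.prems less_osuc by auto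
      then show ?thesis
        using Sigma_definable_Ex[of "{()}" "osuc (dbl d)" ?n "\<lambda>_. length cs"
            "\<lambda>_ B S e. bf A R B S d (tuple_rel (as @ cs) e)"] by simp
    qed
    have T1: "countable ({..<a} \<times> (UNIV :: nat set))" and T2: "countable ({..<a} \<times> {cs. set cs \<subseteq> A})"
      using countable_lessThan_cord countable_bounded_lists[OF A] by (auto intro: countable_SIGMA)
    have P1: "Pi_definable (dbl a) ?n (\<lambda>B S e. \<forall>t\<in>{..<a} \<times> UNIV. \<forall>e'. agree_off {?n..<?n + snd t} B e e' \<longrightarrow>
      (\<exists>cs\<in>{cs. set cs \<subseteq> A \<and> length cs = snd t}. bf A R B S (fst t) (tuple_rel (as @ cs) e')))"
    proof (rule Pi_definable_All[OF T1 a'])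
      fix t assume "t \<in> {..<a} \<times> (UNIV :: nat set)"
      then have "fst t < a" by auto
      then show "\<exists>c<dbl a. Sigma_definable c (?n + snd t) (\<lambda>B S e'. \<exists>cs\<in>{cs. set cs \<subseteq> A \<and> length cs = snd t}.
          bf A R B S (fst t) (tuple_rel (as @ cs) e'))"
        using 1[of "fst t" "snd t"] lev by (intro exI[of _ "osuc (dbl (fst t))"]) simp
    qed
    \<comment> \<open>The vacuous block of length 0 brings the condition into the form required by
      \<open>Pi_definable_All\<close>.\<close>
    have P2: "Pi_definable (dbl a) ?n (\<lambda>B S e. \<forall>t\<in>{..<a} \<times> {cs. set cs \<subseteq> A}.
      \<forall>e1. agree_off {?n..<?n + 0} B e e1 \<longrightarrow> (\<exists>e'. agree_off {?n..<?n + length (snd t)} B e1 e' \<and>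
        bf A R B S (fst t) (tuple_rel (as @ snd t) e')))"
    proof (rule Pi_definable_All[OF T2 a', where k = "\<lambda>_. 0"])
      fix t assume "t \<in> {..<a} \<times> {cs. set cs \<subseteq> A}"
      then have "fst t < a" "set (snd t) \<subseteq> A" by auto
      then show "\<exists>c<dbl a. Sigma_definable c (?n + 0) (\<lambda>B S e1. \<exists>e'. agree_off {?n..<?n + length (snd t)} B e1 e' \<and>
          bf A R B S (fst t) (tuple_rel (as @ snd t) e'))"
        using 2[of "fst t" "snd t"] lev by (intro exI[of _ "osuc (dbl (fst t))"]) simp
    qed
    show ?thesis
      by (rule Pi_definable_cong[OF Pi_definable_and[OF P1 P2 a']])
        (subst bf_tuple_rel_iff[OF less.prems _ a], simp_all)
  qed
qed

text \<open>
  The extension property makes rank-\<open>l\<close> equivalence over the parameter \<open>a0\<close> coincide with being in the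
  same automorphism orbit; a sentence expressing this property for \<open>A\<close> is then a Scott sentence.
\<close>

theorem Sigma_scott_sentence_exists:
  assumes A: "countable A" "is_struct A R" "a0 \<in> A" and l: "limit_ord l"
    and ext: "\<And>\<rho> x. bf A R A R l \<rho> \<Longrightarrow> (a0, a0) \<in> \<rho> \<Longrightarrow> x \<in> A \<Longrightarrow> \<exists>y. bf A R A R l (insert (x, y) \<rho>)"
  shows "\<exists>p. scott_sentence A R p \<and> Sigma_in (osuc (osuc (osuc l))) p"
proof -
  let ?bf = "\<lambda>as B S e. bf A R B S l (tuple_rel as e)"
  have bfdef: "Pi_definable l (length as) (?bf as)" if "set as \<subseteq> A" for as
    using bf_Pi_definable[OF A(1) that, of l] dbl_limit[OF l] by simp
  have bfex: "\<exists>c<osuc l. Pi_definable c n (?bf as)" if "set as \<subseteq> A" "n = length as" for as n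
    using bfdef[OF that(1)] that(2) less_osuc by blast
  have nbf: "Sigma_definable (osuc l) (length as) (\<lambda>B S e. \<not> ?bf as B S e)" if "set as \<subseteq> A" for as
    by (rule Sigma_definable_mono[OF _ limit_ord_pos[OF l] order_less_imp_le[OF less_osuc]])
      (use bfdef[OF that] in \<open>simp only: Sigma_definable_Not\<close>)
  define T where "T = {as. set as \<subseteq> A}"
  have T: "countable T" unfolding T_def by (rule countable_bounded_lists[OF A(1)])
  \<comment> \<open>Variable 0 holds the named point and variables 1, ..., \<open>length as\<close>
    hold the tuple, so \<open>?n as\<close> is the next free variable.\<close>
  let ?n = "\<lambda>as. Suc (length as)"
  \<comment> \<open>\<open>P1\<close> is the forth and \<open>P2\<close> the back condition. Each is
    a disjunction of a negated \<Pi> formula of level \<open>l\<close> and a claim of a witness,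
    hence \<Sigma> of level \<open>l + 1\<close>.\<close>
  define P1 where "P1 t B S e \<longleftrightarrow> \<not> ?bf (a0 # fst t) B S e \<or>
    (\<exists>e'. agree_off {?n (fst t)..<?n (fst t) + 1} B e e' \<and> ?bf (a0 # fst t @ [snd t]) B S e')"
    for t and B :: "nat set" and S e
  define P2 where "P2 as B S e \<longleftrightarrow> \<not> ?bf (a0 # as) B S e \<or> (\<exists>b\<in>A. ?bf (a0 # as @ [b]) B S e)"
    for as and B :: "nat set" and S e
  have P1: "Sigma_definable (osuc l) (1 + length (fst t)) (P1 t)" if "t \<in> T \<times> A" for t
  proof -
    have "Sigma_definable (osuc l) (?n (fst t)) (\<lambda>B S e. \<exists>u\<in>{()}. \<exists>e'.
        agree_off {?n (fst t)..<?n (fst t) + 1} B e e' \<and> ?bf (a0 # fst t @ [snd t]) B S e')"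
      using that A(3)
      by (intro Sigma_definable_Ex[where k = "\<lambda>_. 1"] bfex) (auto simp: T_def)
    then show ?thesis
      using Sigma_definable_or[OF nbf[of "a0 # fst t"]] that A(3) unfolding P1_def
      by (auto simp: T_def)
  qed
  have P2: "Sigma_definable (osuc l) (1 + ?n as) (P2 as)" if "as \<in> T" for as
  proof -
    have "Sigma_definable (osuc l) (1 + ?n as) (\<lambda>B S e. \<exists>b\<in>A. \<exists>e'.
        agree_off {1 + ?n as..<1 + ?n as + 0} B e e' \<and> ?bf (a0 # as @ [b]) B S e')"
      using that A(3)
      by (intro Sigma_definable_Ex[OF A(1), where k = "\<lambda>_. 0"] bfex) (auto simp: T_def)
    then have 1: "Sigma_definable (osuc l) (1 + ?n as) (\<lambda>B S e. \<exists>b\<in>A. ?bf (a0 # as @ [b]) B S e)"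
      by simp
    have 2: "Sigma_definable (osuc l) (1 + ?n as) (\<lambda>B S e. \<not> ?bf (a0 # as) B S e)"
      using Sigma_definable_arity[OF nbf[of "a0 # as"], of "1 + ?n as"] that A(3) by (auto simp: T_def)
    show ?thesis
      unfolding P2_def by (rule Sigma_definable_or[OF 2 1 osuc_pos])
  qed
  \<comment> \<open>Variable 0 looks like \<open>a0\<close>, and every tuple satisfies both
    conditions: \<Pi> of level \<open>l + 2\<close>. Quantifying variable 0 existentially gives the
    sentence.\<close>
  define Q where "Q B S e \<longleftrightarrow> (?bf [a0] B S e \<and>
    (\<forall>t\<in>T \<times> A. \<forall>e'. agree_off {1..<1 + length (fst t)} B e e' \<longrightarrow> P1 t B S e')) \<and>
    (\<forall>as\<in>T. \<forall>e'. agree_off {1..<1 + ?n as} B e e' \<longrightarrow> P2 as B S e')" for B S e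
  have pos: "0 < osuc (osuc l)" "osuc l < osuc (osuc l)" by (simp_all add: less_osuc)
  have Q0: "Pi_definable (osuc (osuc l)) 1 (?bf [a0])"
  proof -
    have "Pi_definable (osuc (osuc l)) 1 (\<lambda>B S e. \<forall>t\<in>{()}. \<forall>e'. agree_off {1..<1 + 0} B e e' \<longrightarrow> ?bf [a0] B S e')"
      using Sigma_definable_if_Pi[OF bfdef[of "[a0]"] less_osuc] A(3) pos
      by (intro Pi_definable_All[where k = "\<lambda>_. 0"]) auto
    then show ?thesis by simp
  qed
  have Q1: "Pi_definable (osuc (osuc l)) 1 (\<lambda>B S e. \<forall>t\<in>T \<times> A. \<forall>e'. agree_off {1..<1 + length (fst t)} B e e' \<longrightarrow> P1 t B S e')"
    using P1 pos T A(1) by (intro Pi_definable_All) (auto intro: countable_SIGMA)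
  have Q2: "Pi_definable (osuc (osuc l)) 1 (\<lambda>B S e. \<forall>as\<in>T. \<forall>e'. agree_off {1..<1 + ?n as} B e e' \<longrightarrow> P2 as B S e')"
    using P2 pos T by (intro Pi_definable_All) auto
  have "Pi_definable (osuc (osuc l)) 1 Q"
    unfolding Q_def by (rule Pi_definable_and[OF Pi_definable_and[OF Q0 Q1 pos(1)] Q2 pos(1)])
  then have "Sigma_definable (osuc (osuc (osuc l))) 0 (\<lambda>B S e. \<exists>u\<in>{()}. \<exists>e'. agree_off {0..<0 + 1} B e e' \<and> Q B S e')"
    using less_osuc by (intro Sigma_definable_Ex[where k = "\<lambda>_. 1"]) auto
  then obtain p where p: "Sigma_in (osuc (osuc (osuc l))) p" "fv p = {}"
    "\<And>B S e. is_struct B S \<Longrightarrow> range e \<subseteq> B \<Longrightarrow> sat B S p e \<longleftrightarrow> (\<exists>e'. agree_off {0} B e e' \<and> Q B S e')"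
    by (auto simp: Sigma_definable_def expresses_def)
  have forward: "isomorphic A R B S" if B: "is_struct B S" "range e \<subseteq> B" and Q: "Q B S e" for B S e
  proof -
    \<comment> \<open>\<open>Q\<close> says precisely that these relations form a back-and-forth
      family, so rank \<open>l\<close> equivalence itself builds the isomorphism.\<close>
    let ?P = "\<lambda>\<rho>. bf A R B S l \<rho> \<and> (a0, e 0) \<in> \<rho>"
    have enum: "\<exists>as e'. as \<in> T \<and> agree_off {1..<1 + length as} B e e' \<and> tuple_rel (a0 # as) e' = \<rho>"
      if \<rho>: "?P \<rho>" for \<rho>
    proof -
      obtain ps where ps: "set ps = \<rho>" using finite_list[OF bfD(1)[OF conjunct1[OF \<rho>]]] by blast
      define as where "as = map fst ps"
      define e' where "e' v = (if v \<in> {1..<1 + length as} then snd (ps ! (v - 1)) else e v)" for v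
      have sub: "set ps \<subseteq> A \<times> B" using ps bfD(2)[OF conjunct1[OF \<rho>]] by simp
      have "as \<in> T" using sub by (auto simp: as_def T_def)
      moreover have "agree_off {1..<1 + length as} B e e'"
      proof -
        have "snd (ps ! (v - 1)) \<in> B" if "v \<in> {1..<1 + length as}" for v
        proof -
          have "ps ! (v - 1) \<in> set ps" using that by (intro nth_mem) (auto simp: as_def)
          then show ?thesis using sub by (metis SigmaE snd_conv subsetD)
        qed
        then show ?thesis by (auto simp: agree_off_def e'_def)
      qed
      moreover have "tuple_rel (a0 # as) e' = insert (a0, e 0) (set ps)"
      proof -
        have "tuple_rel (a0 # as) e' = (\<lambda>i. ((a0 # as) ! i, e' i)) ` insert 0 (Suc ` {..<length ps})"
          unfolding tuple_rel_def lessThan_Suc_eq_insert_0[symmetric] by (simp add: as_def)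
        also have "\<dots> = insert (a0, e 0) ((\<lambda>i. ps ! i) ` {..<length ps})"
          by (auto simp: image_image e'_def as_def intro!: image_cong)
        also have "(!) ps ` {..<length ps} = set ps"
          by (simp add: lessThan_atLeast0 nth_image)
        finally show ?thesis .
      qed
      ultimately show ?thesis using ps conjunct2[OF \<rho>] by (metis insert_absorb)
    qed
    show ?thesis
    proof (rule isomorphic_if_back_and_forth[where P = ?P])
      show "countable A" "countable B" "A \<noteq> {}" "B \<noteq> {}"
        using A B by (auto simp: is_struct_def)
      show "?P (tuple_rel [a0] e)"
        using Q by (auto simp: Q_def tuple_rel_def)
    next
      fix \<rho> assume "?P \<rho>"
      then show "\<rho> \<subseteq> A \<times> B \<and> piso R S \<rho>" using bfD(2,3)[of A R B S l \<rho>] by simp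
    next
      fix \<rho> x assume \<rho>: "?P \<rho>" and x: "x \<in> A"
      obtain as e' where as: "as \<in> T" "agree_off {1..<1 + length as} B e e'" "tuple_rel (a0 # as) e' = \<rho>"
        using enum[OF \<rho>] by blast
      have "P1 (as, x) B S e'" using Q as x by (auto simp: Q_def)
      then obtain e'' where e'': "agree_off {?n as..<?n as + 1} B e' e''" "?bf (a0 # as @ [x]) B S e''"
        using \<rho> as(3) by (auto simp: P1_def)
      have "insert (x, e'' (?n as)) (tuple_rel (a0 # as) e') \<subseteq> tuple_rel ((a0 # as) @ [x]) e''"
        using e''(1) tuple_rel_append[of "a0 # as" e'' e' "[x]"]
        by (auto simp: agree_off_def tuple_rel_iff nth_append intro!: exI[of _ "?n as"])
      then have "bf A R B S l (insert (x, e'' (?n as)) \<rho>)"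
        using bf_mono[OF e''(2)] as(3) by auto
      then show "\<exists>y. ?P (insert (x, y) \<rho>)" using \<rho> by blast
    next
      fix \<rho> y assume \<rho>: "?P \<rho>" and y: "y \<in> B"
      obtain as e' where as: "as \<in> T" "agree_off {1..<1 + length as} B e e'" "tuple_rel (a0 # as) e' = \<rho>"
        using enum[OF \<rho>] by blast
      define e'' where "e'' = e'(?n as := y)"
      have e'': "agree_off {1..<1 + ?n as} B e e''" using as(2) y by (auto simp: agree_off_def e''_def)
      have eq: "tuple_rel (a0 # as) e'' = \<rho>"
        using as(3) by (auto simp: tuple_rel_def e''_def)
      have "P2 as B S e''" using Q as e'' by (auto simp: Q_def)
      then obtain b where b: "b \<in> A" "?bf (a0 # as @ [b]) B S e''"
        using \<rho> eq by (auto simp: P2_def)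
      have "insert (b, y) (tuple_rel (a0 # as) e'') \<subseteq> tuple_rel ((a0 # as) @ [b]) e''"
        using tuple_rel_append[of "a0 # as" e'' e'' "[b]"]
        by (auto simp: e''_def tuple_rel_iff nth_append intro!: exI[of _ "?n as"])
      then have "bf A R B S l (insert (b, y) \<rho>)"
        using bf_mono[OF b(2)] eq by auto
      then show "\<exists>x. ?P (insert (x, y) \<rho>)" using \<rho> by blast
    qed
  qed
  have backward: "\<exists>e'. agree_off {0} B e e' \<and> Q B S e'" if B: "is_struct B S" "range e \<subseteq> B" and iso: "isomorphic A R B S"
    for B S e
  proof -
    obtain h where h: "iso_map A R B S h" using iso by (auto simp: isomorphic_iso_map)
    define g where "g = inv_into A h"
    have g: "iso_map B S A R g" unfolding g_def using h by (rule iso_map_inv)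
    have gh: "g (h x) = x" if "x \<in> A" for x
      using h that by (simp add: g_def iso_map_def bij_betw_def)
    have hg: "h (g y) = y" if "y \<in> B" for y
      using h that by (simp add: g_def iso_map_def bij_betw_def f_inv_into_f)
    have hB: "h x \<in> B" if "x \<in> A" for x using h that by (auto simp: iso_map_def bij_betw_def)
    \<comment> \<open>The extension property concerns relations from \<open>A\<close> to itself; it
      is reached along \<open>g\<close> and carried back along \<open>h\<close>.\<close>
    have ext': "\<exists>y\<in>B. bf A R B S l (insert (x, y) \<rho>)"
      if \<rho>: "bf A R B S l \<rho>" "(a0, h a0) \<in> \<rho>" and x: "x \<in> A" for \<rho> x
    proof -
      have "(a0, a0) \<in> map_prod id g ` \<rho>"
        using \<rho>(2) gh[OF A(3)] by (metis id_apply image_eqI map_prod_simp)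
      from ext[OF bf_iso_map[OF g \<rho>(1)] this x]
      obtain y where y: "bf A R A R l (insert (x, y) (map_prod id g ` \<rho>))" ..
      have "map_prod id h ` insert (x, y) (map_prod id g ` \<rho>) = insert (x, h y) \<rho>"
      proof -
        have "map_prod id h ` map_prod id g ` \<rho> = (\<lambda>t. t) ` \<rho>"
          unfolding image_image by (rule image_cong) (use bfD(2)[OF \<rho>(1)] hg in auto)
        then show ?thesis by simp
      qed
      then have "bf A R B S l (insert (x, h y) \<rho>)"
        using bf_iso_map[OF h y] by simp
      then show ?thesis using bfD(2)[OF \<open>bf A R B S l (insert (x, h y) \<rho>)\<close>] by blast
    qed
    have ext2: "\<exists>x\<in>A. bf A R B S l (insert (x, y) \<rho>)"
      if \<rho>: "bf A R B S l \<rho>" "(a0, h a0) \<in> \<rho>" and y: "y \<in> B" for \<rho> y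
    proof -
      have 1: "bf A R A R l (map_prod id g ` \<rho>)" by (rule bf_iso_map[OF g \<rho>(1)])
      have 2: "(a0, a0) \<in> (map_prod id g ` \<rho>)\<inverse>"
        using \<rho>(2) gh[OF A(3)] by (metis converse_iff id_apply image_eqI map_prod_simp)
      have "g y \<in> A" using g y by (auto simp: iso_map_def bij_betw_def)
      from ext[OF bf_converse[OF 1] 2 this]
      obtain x where "bf A R A R l (insert (g y, x) ((map_prod id g ` \<rho>)\<inverse>))" ..
      from bf_converse[OF this] have x: "bf A R A R l (insert (x, g y) (map_prod id g ` \<rho>))"
        by (simp add: converse_insert)
      have "map_prod id h ` insert (x, g y) (map_prod id g ` \<rho>) = insert (x, y) \<rho>"
      proof -
        have "map_prod id h ` map_prod id g ` \<rho> = (\<lambda>t. t) ` \<rho>"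
          unfolding image_image by (rule image_cong) (use bfD(2)[OF \<rho>(1)] hg in auto)
        then show ?thesis using hg[OF y] by simp
      qed
      then have "bf A R B S l (insert (x, y) \<rho>)"
        using bf_iso_map[OF h x] by simp
      then show ?thesis using bfD(2)[OF \<open>bf A R B S l (insert (x, y) \<rho>)\<close>] by blast
    qed
    define e' where "e' = e(0 := h a0)"
    have e': "agree_off {0} B e e'" using hB[OF A(3)] by (auto simp: e'_def agree_off_def)
    have in0: "(a0, h a0) \<in> tuple_rel (a0 # as) e1" if "e1 0 = h a0" for as e1
      using that by (auto simp: tuple_rel_iff intro!: exI[of _ 0])
    have "bf A R A R l (Id_on {a0})" using A(3) by (intro bf_Id_on) auto
    then have "bf A R B S l (tuple_rel [a0] e')"
      using bf_iso_map[OF h, of A R l "Id_on {a0}"] by (simp add: Id_on_def tuple_rel_def e'_def lessThan_Suc)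
    moreover have "P1 t B S e1" if t: "t \<in> T \<times> A" and e1: "agree_off {1..<1 + length (fst t)} B e' e1" for t e1
    proof (cases "?bf (a0 # fst t) B S e1")
      case True
      have "e1 0 = h a0" "snd t \<in> A" using e1 t by (auto simp: agree_off_def e'_def)
      from ext'[OF True in0[of e1, OF this(1)] this(2)]
      obtain y where y: "y \<in> B" "bf A R B S l (insert (snd t, y) (tuple_rel (a0 # fst t) e1))" ..
      have "tuple_rel ((a0 # fst t) @ [snd t]) (e1(?n (fst t) := y)) \<subseteq> insert (snd t, y) (tuple_rel (a0 # fst t) e1)"
        by (rule tuple_rel_append_subset[of "a0 # fst t" e1]) auto
      then have "?bf (a0 # fst t @ [snd t]) B S (e1(?n (fst t) := y))"
        using bf_mono[OF y(2)] by simp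
      then show ?thesis
        unfolding P1_def using y(1)
        by (intro disjI2 exI[of _ "e1(?n (fst t) := y)"]) (auto simp: agree_off_def)
    qed (simp add: P1_def)
    moreover have "P2 as B S e1" if as: "as \<in> T" and e1: "agree_off {1..<1 + ?n as} B e' e1" for as e1
    proof (cases "?bf (a0 # as) B S e1")
      case True
      have "e1 0 = h a0" "e1 (?n as) \<in> B" using e1 by (auto simp: agree_off_def e'_def)
      from ext2[OF True in0[of e1, OF this(1)] this(2)]
      obtain x where x: "x \<in> A" "bf A R B S l (insert (x, e1 (?n as)) (tuple_rel (a0 # as) e1))" ..
      have "tuple_rel ((a0 # as) @ [x]) e1 \<subseteq> insert (x, e1 (?n as)) (tuple_rel (a0 # as) e1)"
        by (rule tuple_rel_append_subset[of "a0 # as" e1]) auto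
      then have "?bf (a0 # as @ [x]) B S e1"
        using bf_mono[OF x(2)] by simp
      then show ?thesis unfolding P2_def using x(1) by blast
    qed (simp add: P2_def)
    ultimately have "Q B S e'" unfolding Q_def by simp
    then show ?thesis using e' by blast
  qed
  have "scott_sentence A R p"
    unfolding scott_sentence_def sentence_def
  proof (intro conjI allI impI)
    fix B :: "nat set" and S assume B: "is_struct B S"
    obtain b where b: "b \<in> B" using B by (auto simp: is_struct_def)
    show "models B S p \<longleftrightarrow> isomorphic A R B S"
    proof
      assume "models B S p"
      then have "sat B S p (\<lambda>_. b)" using b by (auto simp: models_def)
      then obtain e' where "agree_off {0} B (\<lambda>_. b) e'" "Q B S e'"
        using p(3)[OF B, of "\<lambda>_. b"] b by auto
      moreover then have "range e' \<subseteq> B" using b by (auto simp: agree_off_def) (metis gr0I)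
      ultimately show "isomorphic A R B S" using forward[OF B] by blast
    next
      assume "isomorphic A R B S"
      then show "models B S p" using backward[OF B] p(3)[OF B] by (auto simp: models_def)
    qed
  qed (fact p(2))
  then show ?thesis using p(1) by blast
qed

section \<open>Inclusions between the complexity classes\<close>

lemma Pi_in_if_Sigma_in: "Sigma_in a p \<Longrightarrow> a < b \<Longrightarrow> Pi_in b (Conj {0} (\<lambda>_. p))"
  by (rule Sigma_in_Pi_in.intros(4))
    (auto simp: Alls_def intro!: exI[of _ "[]"] intro: order.strict_trans1[OF zero_le_cord])

lemma d_Sigma_in_imp_Pi_in:
  assumes "d_Sigma_in a r" "0 < a" "a < b"
  shows "\<exists>q. Pi_in b q \<and> fv q = fv r \<and> (\<forall>(B :: nat set) S e. sat B S q e = sat B S r e)"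
proof -
  obtain p q where p: "Sigma_in a p" "Pi_in a q" "r = And p q"
    using assms(1) by (auto simp: d_Sigma_in_def)
  obtain I F where F: "q = Conj I F" "\<forall>i\<in>I. \<exists>xs \<beta> p. F i = Alls xs p \<and> \<beta> < a \<and> Sigma_in \<beta> p"
    using p(2) assms(2) by (cases rule: Pi_in.cases) auto
  let ?G = "\<lambda>i. if i = 0 then p else F (i - 1)"
  have "Pi_in b (Conj (insert 0 (Suc ` I)) ?G)"
  proof (rule Sigma_in_Pi_in.intros(4))
    have "\<exists>xs \<beta> q. p = Alls xs q \<and> \<beta> < b \<and> Sigma_in \<beta> q"
      using p(1) assms(3) by (intro exI[of _ "[]"]) (auto simp: Alls_def)
    then show "\<forall>i\<in>insert 0 (Suc ` I). \<exists>xs \<beta> q. ?G i = Alls xs q \<and> \<beta> < b \<and> Sigma_in \<beta> q"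
      using F(2) assms(3) by auto (meson order.strict_trans)
  qed (use assms in auto)
  then show ?thesis
    using F(1) p(3) by (intro exI[of _ "Conj (insert 0 (Suc ` I)) ?G"]) (auto simp: And_def)
qed

text \<open>Every class that does not contain \<Sigma> of level \<open>a\<close> is included in
  \<Pi> of level \<open>a\<close>, so it is enough to rule out this one class.\<close>

lemma scott_complexity_SigmaI:
  assumes S: "scott_sentence A R p" "Sigma_in a p" and a: "0 < a"
    and nPi: "\<And>q. scott_sentence A R q \<Longrightarrow> \<not> Pi_in a q"
  shows "scott_complexity A R (Sigma_class a)"
  unfolding scott_complexity_def
proof (intro conjI allI impI)
  show "0 < index (Sigma_class a)" using a by simp
  show "has_scott_sentence_in A R (Sigma_class a)"
    using S by (auto simp: has_scott_sentence_in_def)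
  fix D assume D: "0 < index D \<and> has_scott_sentence_in A R D"
  then obtain q where q: "scott_sentence A R q" "in_class q D"
    by (auto simp: has_scott_sentence_in_def)
  have same: "scott_sentence A R q'" if "fv q' = fv q" "\<And>(B :: nat set) S e. sat B S q' e = sat B S q e" for q'
    using q(1) that by (simp add: scott_sentence_def sentence_def models_def)
  show "class_le (Sigma_class a) D"
  proof (cases D)
    case (Pi_class b)
    have "\<not> b \<le> a" using nPi[OF q(1)] q(2) Pi_in_mono[of b q a] D Pi_class by auto
    then have "a < b" by simp
    then show ?thesis
      unfolding class_le_def Pi_class
      by (auto intro!: exI[of _ "Conj {0} (\<lambda>_. r)" for r] Pi_in_if_Sigma_in
          simp: sentence_def equivalent_def models_def)
  next
    case (Sigma_class b)
    have "\<not> b < a"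
    proof
      assume "b < a"
      then have "Pi_in a (Conj {0} (\<lambda>_. q))" using q(2) Sigma_class Pi_in_if_Sigma_in by simp
      then show False using nPi same by simp
    qed
    then show ?thesis
      unfolding class_le_def Sigma_class using Sigma_in_mono[OF _ a]
      by (auto simp: equivalent_def)
  next
    case (d_Sigma_class b)
    have "\<not> b < a"
    proof
      assume "b < a"
      then obtain q' where "Pi_in a q'" "fv q' = fv q" "\<And>(B :: nat set) S e. sat B S q' e = sat B S q e"
        using d_Sigma_in_imp_Pi_in[of b q a] q(2) D d_Sigma_class by auto
      then show False using nPi same by blast
    qed
    then have ab: "a \<le> b" by simp
    \<comment> \<open>The empty conjunction serves as a trivially true \<Pi> part.\<close>
    have "d_Sigma_in b (And r (Conj {} (\<lambda>_. r)))" if "Sigma_in a r" for r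
      unfolding d_Sigma_in_def using Sigma_in_mono[OF that a ab] a ab
      by (auto intro!: Sigma_in_Pi_in.intros(4) exI)
    moreover have "sentence r \<Longrightarrow> sentence (And r (Conj {} (\<lambda>_. r)))" "equivalent r (And r (Conj {} (\<lambda>_. r)))" for r
      by (auto simp: sentence_def And_def equivalent_def models_def)
    ultimately show ?thesis
      unfolding class_le_def d_Sigma_class by (metis in_class.simps)
  qed
qed

section \<open>Ordinals below a power of \<open>\<omega>\<close> as multisets of exponents\<close>

text \<open>
  The multiset \<open>{#b1, \<dots>, bk#}\<close> with \<open>b1 \<ge> \<dots> \<ge> bk\<close> stands for the Cantor normal form
  \<open>\<omega>^b1 + \<dots> + \<omega>^bk\<close>; the multiset order is the order of ordinals, and \<open>oplus\<close> is ordinal addition.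
\<close>

lemma less_multiset_top_difference:
  fixes M N :: "'a :: linorder multiset"
  shows "M < N \<longleftrightarrow> (\<exists>g. count M g < count N g \<and> (\<forall>x>g. count M x = count N x))"
proof
  assume "M < N"
  then have ne: "M \<noteq> N" and *: "\<And>y. count N y < count M y \<Longrightarrow> \<exists>x>y. count M x < count N x"
    by (auto simp: less_multiset\<^sub>H\<^sub>O)
  define D where "D = {x. count M x \<noteq> count N x}"
  have "D \<subseteq> set_mset M \<union> set_mset N"
  proof
    fix x assume "x \<in> D"
    then have "count M x \<noteq> count N x" by (simp add: D_def)
    then have "count M x > 0 \<or> count N x > 0" by linarith
    then show "x \<in> set_mset M \<union> set_mset N" by (simp only: count_greater_zero_iff Un_iff)
  qed
  then have fin: "finite D" by (rule finite_subset) simp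
  have "D \<noteq> {}" using ne by (auto simp: D_def multiset_eq_iff)
  then have max: "Max D \<in> D" "\<And>x. x > Max D \<Longrightarrow> x \<notin> D"
    using fin by (auto dest: Max_ge)
  have "count M (Max D) < count N (Max D)"
  proof (rule ccontr)
    assume "\<not> ?thesis"
    moreover have "count M (Max D) \<noteq> count N (Max D)" using max(1) unfolding D_def by blast
    ultimately have "count N (Max D) < count M (Max D)" by linarith
    then obtain x where "x > Max D" "count M x < count N x" using * by blast
    then show False using max(2)[of x] by (simp add: D_def)
  qed
  moreover have "count M x = count N x" if "x > Max D" for x
    using max(2)[OF that] by (simp add: D_def)
  ultimately show "\<exists>g. count M g < count N g \<and> (\<forall>x>g. count M x = count N x)"
    by blast
next
  assume "\<exists>g. count M g < count N g \<and> (\<forall>x>g. count M x = count N x)"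
  then obtain g where g: "count M g < count N g" "\<And>x. x > g \<Longrightarrow> count M x = count N x" by blast
  have "\<exists>x>y. count M x < count N x" if "count N y < count M y" for y
    using g that by (metis less_asym linorder_neqE order_less_irrefl)
  then show "M < N"
    using g(1) by (auto simp: less_multiset\<^sub>H\<^sub>O)
qed

text \<open>Exponents of \<open>M\<close> below the leading exponent of \<open>K\<close> are
  absorbed, since \<omega>^x + \<omega>^k = \<omega>^k for x < k.\<close>

definition oplus :: "'a :: linorder multiset \<Rightarrow> 'a multiset \<Rightarrow> 'a multiset" (infixl "\<oplus>" 65) where
  "M \<oplus> K = filter_mset (\<lambda>x. \<forall>k\<in>#K. k \<le> x) M + K"

lemma oplus_empty [simp]: "M \<oplus> {#} = M" "{#} \<oplus> M = M"
  by (simp_all add: oplus_def)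

lemma count_oplus:
  "count (M \<oplus> K) x = (if \<forall>k\<in>#K. k \<le> x then count M x + count K x else count K x)"
  by (simp add: oplus_def)

lemma oplus_assoc: "(M \<oplus> K) \<oplus> L = M \<oplus> (K \<oplus> L)"
proof (rule multiset_eqI)
  fix x
  have 1: "(\<forall>k\<in>#K \<oplus> L. k \<le> x) \<longleftrightarrow> (\<forall>k\<in>#K. k \<le> x) \<and> (\<forall>k\<in>#L. k \<le> x)"
  proof
    assume *: "\<forall>k\<in>#K \<oplus> L. k \<le> x"
    have L: "\<forall>k\<in>#L. k \<le> x" using * by (auto simp: oplus_def)
    have "k \<le> x" if "k \<in># K" for k
    proof (cases "\<forall>l\<in>#L. l \<le> k")
      case True
      then show ?thesis using * that by (auto simp: oplus_def)
    next
      case False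
      then show ?thesis using L by force
    qed
    then show "(\<forall>k\<in>#K. k \<le> x) \<and> (\<forall>k\<in>#L. k \<le> x)" using L by blast
  qed (auto simp: oplus_def)
  show "count ((M \<oplus> K) \<oplus> L) x = count (M \<oplus> (K \<oplus> L)) x"
    unfolding count_oplus[of "M \<oplus> K"] count_oplus[of M "K \<oplus> L"] 1
    by (auto simp: count_oplus)
qed

text \<open>At and above the top difference of \<open>K\<close> and \<open>L\<close>, both absorb
  the same part of \<open>M\<close>, so that difference survives the addition.\<close>

lemma oplus_less_cancel: "M \<oplus> K < M \<oplus> L" if KL: "K < L"
proof -
  obtain g where g: "count K g < count L g" "\<And>x. x > g \<Longrightarrow> count K x = count L x"
    using KL by (auto simp: less_multiset_top_difference)
  have eq: "(\<forall>k\<in>#K. k \<le> x) \<longleftrightarrow> (\<forall>k\<in>#L. k \<le> x)" if "x > g" for x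
  proof -
    have "k \<in># K \<longleftrightarrow> k \<in># L" if "k > x" for k
      using g(2)[of k] \<open>x > g\<close> that by (metis count_greater_zero_iff order.strict_trans)
    then show ?thesis by (meson linorder_not_le)
  qed
  have up: "count (M \<oplus> K) x = count (M \<oplus> L) x" if "x > g" for x
    using eq[OF that] g(2)[OF that] by (simp add: count_oplus)
  have "(\<forall>k\<in>#K. k \<le> g) \<longleftrightarrow> (\<forall>k\<in>#L. k \<le> g)"
  proof -
    have "k \<in># K \<longleftrightarrow> k \<in># L" if "k > g" for k
      using g(2)[of k] that by (metis count_greater_zero_iff)
    then show ?thesis by (meson linorder_not_le)
  qed
  then have "count (M \<oplus> K) g < count (M \<oplus> L) g"
    using g(1) by (simp add: count_oplus)
  then show ?thesis
    using up by (auto simp: less_multiset_top_difference)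
qed

lemma oplus_less_iff: "M \<oplus> K < M \<oplus> L \<longleftrightarrow> K < L"
  by (metis oplus_less_cancel less_asym linorder_less_linear)

lemma oplus_cancel: "M \<oplus> K = M \<oplus> L \<longleftrightarrow> K = L"
  by (metis oplus_less_cancel less_irrefl linorder_less_linear)

lemma oplus_exists: "M \<le> N \<Longrightarrow> \<exists>K. N = M \<oplus> K"
proof (cases "M = N")
  case True
  then show ?thesis by (metis oplus_empty(1))
next
  case False
  assume "M \<le> N"
  then have "M < N" using False by simp
  then obtain g where g: "count M g < count N g" "\<And>x. x > g \<Longrightarrow> count M x = count N x"
    by (auto simp: less_multiset_top_difference)
  \<comment> \<open>Below the top difference \<open>g\<close>, all of \<open>N\<close> belongs to
    the remainder; at \<open>g\<close> only the surplus over \<open>M\<close> does.\<close>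
  define K where "K = filter_mset (\<lambda>x. x \<le> g) N - replicate_mset (count M g) g"
  have cK: "count K x = (if x = g then count N g - count M g else if x < g then count N x else 0)" for x
    by (auto simp: K_def)
  have "g \<in># K" using g(1) cK[of g] by (simp flip: count_greater_zero_iff)
  moreover have "k \<le> g" if "k \<in># K" for k
    using that cK[of k] by (auto simp flip: count_greater_zero_iff split: if_splits)
  ultimately have le: "(\<forall>k\<in>#K. k \<le> x) \<longleftrightarrow> g \<le> x" for x by force
  have "N = M \<oplus> K"
    by (rule multiset_eqI) (use g in \<open>auto simp: count_oplus le cK\<close>)
  then show ?thesis by blast
qed

section \<open>Distances between ordinals and their equivalence modulo powers of \<omega>\<close>

definition ominus :: "'a :: linorder multiset \<Rightarrow> 'a multiset \<Rightarrow> 'a multiset" (infixl "\<ominus>" 65) where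
  "N \<ominus> M = (THE K. N = M \<oplus> K)"

lemma ominus_oplus: "(M \<oplus> K) \<ominus> M = K"
  unfolding ominus_def by (auto simp: oplus_cancel)

lemma oplus_ominus: "M \<le> N \<Longrightarrow> M \<oplus> (N \<ominus> M) = N"
  using oplus_exists ominus_oplus by metis

lemma ominus_self [simp]: "M \<ominus> M = {#}"
  using ominus_oplus[of M "{#}"] by simp

lemma ominus_empty [simp]: "M \<ominus> {#} = M"
  using ominus_oplus[of "{#}" M] by simp

lemma ominus_trans: "M \<le> N \<Longrightarrow> N \<le> L \<Longrightarrow> L \<ominus> M = (N \<ominus> M) \<oplus> (L \<ominus> N)"
  by (metis ominus_oplus oplus_assoc oplus_ominus)

lemma ominus_eq_empty_iff: "M \<le> N \<Longrightarrow> N \<ominus> M = {#} \<longleftrightarrow> N = M"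
  by (metis ominus_self oplus_empty(1) oplus_ominus)

text \<open>
  \<open>eqv a K K'\<close> says that, modulo \<open>\<omega>^a\<close>, the ordinals \<open>K\<close> and \<open>K'\<close> have the same remainder and
  that the quotients are both zero or both nonzero. It implies back-and-forth equivalence of rank \<open>a\<close>.
\<close>

definition eqv :: "'a :: linorder \<Rightarrow> 'a multiset \<Rightarrow> 'a multiset \<Rightarrow> bool" where
  "eqv a K K' \<longleftrightarrow> filter_mset (\<lambda>x. x < a) K = filter_mset (\<lambda>x. x < a) K' \<and>
     ((\<forall>k\<in>#K. k < a) \<longleftrightarrow> (\<forall>k\<in>#K'. k < a))"

lemma eqv_refl [simp]: "eqv a K K"
  by (simp add: eqv_def)

lemma eqv_sym: "eqv a K K' \<Longrightarrow> eqv a K' K"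
  by (auto simp: eqv_def)

text \<open>Without an exponent of at least \<open>a\<close> the remainder is everything, so
  equivalence is equality; otherwise only the exponents below \<open>a\<close> count.\<close>

lemma eqv_cases:
  assumes "eqv a K K'"
  obtains "K = K'"
  | "\<exists>k\<in>#K. a \<le> k" "\<exists>k\<in>#K'. a \<le> k" "\<And>x. x < a \<Longrightarrow> count K x = count K' x"
proof (cases "\<forall>k\<in>#K. k < a")
  case True
  then have "filter_mset (\<lambda>x. x < a) K = K" "filter_mset (\<lambda>x. x < a) K' = K'"
    using assms by (auto simp: eqv_def filter_mset_eq_conv)
  then show ?thesis using that(1) assms by (simp add: eqv_def)
next
  case False
  have "count K x = count K' x" if "x < a" for x
    using assms that by (metis count_filter_mset eqv_def)
  moreover have "\<exists>k\<in>#K. a \<le> k" "\<exists>k\<in>#K'. a \<le> k"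
    using False assms unfolding eqv_def by (meson linorder_not_less)+
  ultimately show ?thesis using that(2) by blast
qed

lemma eqvI:
  assumes "\<exists>k\<in>#K. a \<le> k" "\<exists>k\<in>#K'. a \<le> k" "\<And>x. x < a \<Longrightarrow> count K x = count K' x"
  shows "eqv a K K'"
  using assms unfolding eqv_def by (auto intro!: multiset_eqI simp: not_less)

lemma eqv_mono: "eqv a K K' \<Longrightarrow> d \<le> a \<Longrightarrow> eqv d K K'"
  by (erule eqv_cases) (auto intro!: eqvI intro: order_trans)

lemma eqv_empty_iff: "eqv a K K' \<Longrightarrow> K = {#} \<longleftrightarrow> K' = {#}"
  by (erule eqv_cases) auto

text \<open>An exponent of \<open>L\<close> that is at least \<open>a\<close> absorbs everything of
  \<open>K\<close> below \<open>a\<close>; if there is none, \<open>L\<close> absorbs nothing of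
  \<open>K\<close> from \<open>a\<close> upwards.\<close>

lemma eqv_oplus:
  assumes "eqv a K K'" "eqv a L L'"
  shows "eqv a (K \<oplus> L) (K' \<oplus> L')"
  using assms(2)
proof (cases rule: eqv_cases)
  case 1
  show ?thesis
    using assms(1)
  proof (cases rule: eqv_cases)
    case 2
    have L: "eqv a (K \<oplus> L) (K' \<oplus> L)"
    proof (cases "\<exists>l\<in>#L. a \<le> l")
      case True
      then obtain l where "l \<in># L" "a \<le> l" by blast
      then have "\<not> (\<forall>k\<in>#L. k \<le> x)" if "x < a" for x using that by force
      then show ?thesis
        using True by (intro eqvI) (auto simp: oplus_def)
    next
      case False
      then have "\<forall>l\<in>#L. l \<le> k" if "a \<le> k" for k using that by force
      then show ?thesis
        using 2 by (intro eqvI) (auto simp: oplus_def)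
    qed
    then show ?thesis using 1 by simp
  qed (use 1 in simp)
next
  case 2
  then have "\<not> (\<forall>k\<in>#L. k \<le> x)" "\<not> (\<forall>k\<in>#L'. k \<le> x)" if "x < a" for x using that by force+
  then show ?thesis
    using 2 by (intro eqvI) (auto simp: oplus_def)
qed

text \<open>The back-and-forth step for ordinals, answering a point that cuts a distance into
  \<open>K1\<close> and \<open>K2\<close>. The left part may drop to rank \<open>d\<close> while the
  right part keeps rank \<open>a\<close>; this asymmetry permits several points to be inserted from
  left to right.\<close>

lemma eqv_split:
  assumes K: "eqv a (K1 \<oplus> K2) K'" and d: "d < a"
  shows "\<exists>K1' K2'. K' = K1' \<oplus> K2' \<and> eqv d K1 K1' \<and> eqv a K2 K2'"
  using K
proof (cases rule: eqv_cases)
  case 1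
  then show ?thesis by (metis eqv_refl)
next
  case 2
  show ?thesis
  proof (cases "\<exists>k\<in>#K2. a \<le> k")
    case True
    then obtain k2 where k2: "k2 \<in># K2" "a \<le> k2" by blast
    \<comment> \<open>The part of \<open>K1\<close> from \<omega>^d upwards shrinks to a single
      \<omega>^d. Hence \<open>K1'\<close> is below \<omega>^a and absorbed by \<open>K'\<close>,
      which can serve as the right part.\<close>
    define K1' where "K1' = filter_mset (\<lambda>x. x < d) K1 + (if \<exists>k\<in>#K1. d \<le> k then {#d#} else {#})"
    have lt: "k < a" if "k \<in># K1'" for k
      using that d by (auto simp: K1'_def split: if_splits)
    obtain k' where k': "k' \<in># K'" "a \<le> k'" using 2(2) by blast
    have "\<not> (\<forall>k\<in>#K'. k \<le> x)" if "x \<in># K1'" for x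
      using lt[OF that] k' by force
    then have "K' = K1' \<oplus> K'"
      by (auto simp: oplus_def filter_mset_eq_conv[of _ _ "{#}"])
    moreover have "eqv d K1 K1'"
      by (auto simp: eqv_def K1'_def not_less intro!: multiset_eqI)
    moreover have "eqv a K2 K'"
    proof (rule eqvI)
      fix x assume x: "x < a"
      then have "\<not> (\<forall>k\<in>#K2. k \<le> x)" using k2 by force
      then show "count K2 x = count K' x" using 2(3)[OF x] by (simp only: count_oplus if_False)
    qed (use True 2 in auto)
    ultimately show ?thesis by blast
  next
    case False
    then have le: "\<forall>l\<in>#K2. l \<le> k" if "a \<le> k" for k using that by force
    \<comment> \<open>Here \<open>K1\<close> carries the multiple of \<omega>^a: this multiple is
      taken from \<open>K'\<close>, the remainder from \<open>K1\<close>, and \<open>K2\<close> is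
      kept.\<close>
    define K1' where "K1' = filter_mset (\<lambda>x. a \<le> x) K' + filter_mset (\<lambda>x. x < a) K1"
    have "K' = K1' \<oplus> K2"
    proof (rule multiset_eqI)
      fix x
      show "count K' x = count (K1' \<oplus> K2) x"
      proof (cases "x < a")
        case True
        then show ?thesis
          using 2(3)[OF True, symmetric] by (auto simp: count_oplus K1'_def not_le)
      next
        case ge: False
        then have "x \<notin># K2" using False by auto
        then show ?thesis
          using ge le[of x] by (auto simp: count_oplus K1'_def count_eq_zero_iff)
      qed
    qed
    moreover have "eqv a K1 K1'"
    proof (rule eqvI)
      obtain k where "k \<in># K1 \<oplus> K2" "a \<le> k" using 2(1) by blast
      then show "\<exists>k\<in>#K1. a \<le> k" using False by (auto simp: oplus_def)
    qed (use 2(2) in \<open>auto simp: K1'_def\<close>)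
    then have "eqv d K1 K1'" using d by (meson eqv_mono order_less_imp_le)
    ultimately show ?thesis by (metis eqv_refl)
  qed
qed

text \<open>Adding \<open>\<omega>^m\<close> leads to the next ordinal all of whose exponents are at least \<open>m\<close>.\<close>

lemma between_add_min_mset:
  fixes M N :: "'a :: linorder multiset"
  assumes "M < N" "N < add_mset m M" "\<forall>x\<in>#M. m \<le> x"
  shows "\<exists>x\<in>#N. x < m"
proof (rule ccontr)
  assume "\<not> (\<exists>x\<in>#N. x < m)"
  then have N: "\<forall>x\<in>#N. m \<le> x" by (auto simp: not_less)
  obtain g where g: "count M g < count N g" "\<And>x. x > g \<Longrightarrow> count M x = count N x"
    using assms(1) by (auto simp: less_multiset_top_difference)
  obtain h where h: "count N h < count (add_mset m M) h" "\<And>x. x > h \<Longrightarrow> count N x = count (add_mset m M) x"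
    using assms(2) by (auto simp: less_multiset_top_difference)
  have "g \<in># N" using g(1) by (metis count_greater_zero_iff less_nat_zero_code gr0I)
  then have "m \<le> g" using N by blast
  have "h \<in># add_mset m M" using h(1) by (metis count_greater_zero_iff less_nat_zero_code gr0I)
  then have "m \<le> h" using assms(3) by auto
  \<comment> \<open>Both top differences lie at or above \<open>m\<close>, while the two bounds on
    \<open>N\<close> differ only by one copy of \<open>m\<close>.\<close>
  consider "g < h" | "h < g" | "g = h" by force
  then show False
  proof cases
    case 1
    then show False using g(2)[of h] h(1) \<open>m \<le> g\<close> by (auto split: if_splits)
  next
    case 2
    then show False using h(2)[of g] g(1) \<open>m \<le> h\<close> by (auto split: if_splits)
  next
    case 3
    then show False using g(1) h(1) by (auto split: if_splits)
  qed
qed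

section \<open>Shuffles of powers of \<open>\<omega>\<close>\<close>

definition ord_on :: "'a :: linorder set \<Rightarrow> 'a rel" where
  "ord_on A = {(x, y). x \<in> A \<and> y \<in> A \<and> x \<le> y}"

section \<open>Properties of points preserved by back-and-forth relations\<close>

lemma bf_less_iff:
  assumes "bf A (ord_on A) B (ord_on B) a \<rho>" "(x, y) \<in> \<rho>" "(x', y') \<in> \<rho>"
  shows "x < x' \<longleftrightarrow> y < y'"
proof -
  have "x \<in> A" "x' \<in> A" "y \<in> B" "y' \<in> B" using bfD(2)[OF assms(1)] assms(2,3) by auto
  then show ?thesis
    using pisoD(2)[OF bfD(3)[OF assms(1)] assms(3,2)] by (auto simp: ord_on_def)
qed

lemma bf_forth1:
  assumes "bf A R B S a \<rho>" "d < a" "x \<in> A"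
  obtains y \<rho>' where "\<rho> \<subseteq> \<rho>'" "(x, y) \<in> \<rho>'" "y \<in> B" "bf A R B S d \<rho>'"
proof -
  obtain \<rho>' where \<rho>': "\<rho> \<subseteq> \<rho>'" "{x} \<subseteq> Domain \<rho>'" "bf A R B S d \<rho>'"
    using bf_forth[OF assms(1,2), of "{x}"] assms(3) by auto
  then obtain y where "(x, y) \<in> \<rho>'" by auto
  then show thesis using that \<rho>' bfD(2)[OF \<rho>'(3)] by blast
qed

lemma bf_back1:
  assumes "bf A R B S a \<rho>" "d < a" "y \<in> B"
  obtains x \<rho>' where "\<rho> \<subseteq> \<rho>'" "(x, y) \<in> \<rho>'" "x \<in> A" "bf A R B S d \<rho>'"
proof -
  obtain \<rho>' where \<rho>': "\<rho> \<subseteq> \<rho>'" "{y} \<subseteq> Range \<rho>'" "bf A R B S d \<rho>'"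
    using bf_back[OF assms(1,2), of "{y}"] assms(3) by auto
  then obtain x where "(x, y) \<in> \<rho>'" by auto
  then show thesis using that \<rho>' bfD(2)[OF \<rho>'(3)] by blast
qed

text \<open>In an ordinal, \<open>deep A g x\<close> says that \<open>x\<close> is a multiple of \<open>\<omega>^g\<close>.\<close>

inductive deep :: "'a :: linorder set \<Rightarrow> cord \<Rightarrow> 'a \<Rightarrow> bool" for A where
  deepI: "(\<And>d y. d < g \<Longrightarrow> y \<in> A \<Longrightarrow> y < x \<Longrightarrow> \<exists>z\<in>A. y < z \<and> z < x \<and> deep A d z) \<Longrightarrow> deep A g x"

lemma deepD:
  assumes "deep A g x" "d < g" "y \<in> A" "y < x"
  obtains z where "z \<in> A" "y < z" "z < x" "deep A d z"
  using assms(1)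
proof cases
  case deepI
  show ?thesis using deepI[OF assms(2-4)] that by blast
qed

text \<open>Each step in the exponent takes a back move for the lower point and a forth move for the
  deep point above it, hence rank \<open>dbl g\<close>.\<close>

lemma deep_bf:
  assumes "bf A (ord_on A) B (ord_on B) a \<rho>" "dbl g \<le> a" "(x, y) \<in> \<rho>" "deep A g x"
  shows "deep B g y"
  using assms
proof (induction g arbitrary: a \<rho> x y rule: less_induct)
  case (less g)
  show ?case
  proof (rule deepI)
    fix d y' assume *: "d < g" "y' \<in> B" "y' < y"
    have "osuc (dbl d) < a"
      using dbl_less[OF *(1)] less.prems(2) by (simp add: osuc_le_iff order.strict_trans2)
    then obtain x' \<rho>1 where 1: "\<rho> \<subseteq> \<rho>1" "(x', y') \<in> \<rho>1" "x' \<in> A"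
        "bf A (ord_on A) B (ord_on B) (osuc (dbl d)) \<rho>1"
      using bf_back1[OF less.prems(1)] *(2) by metis
    have "x' < x" using bf_less_iff[OF 1(4), of x' y' x y] 1 less.prems(3) *(3) by blast
    then obtain z where z: "z \<in> A" "x' < z" "z < x" "deep A d z"
      using deepD[OF less.prems(4) *(1) 1(3)] by metis
    obtain z' \<rho>2 where 2: "\<rho>1 \<subseteq> \<rho>2" "(z, z') \<in> \<rho>2" "z' \<in> B" "bf A (ord_on A) B (ord_on B) (dbl d) \<rho>2"
      using bf_forth1[OF 1(4) less_osuc z(1)] by metis
    have "y' < z'" "z' < y"
      using bf_less_iff[OF 2(4), of x' y' z z'] bf_less_iff[OF 2(4), of z z' x y] 1(1,2) 2(1,2) less.prems(3) z(2,3)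
      by blast+
    moreover have "deep B d z'"
      using less.IH[OF *(1) 2(4) order_refl 2(2) z(4)] .
    ultimately show "\<exists>z\<in>B. y' < z \<and> z < y \<and> deep B d z" using 2(3) by blast
  qed
qed

definition has_succ :: "'a :: linorder set \<Rightarrow> 'a \<Rightarrow> bool" where
  "has_succ A x \<longleftrightarrow> (\<exists>s\<in>A. x < s \<and> \<not> (\<exists>z\<in>A. x < z \<and> z < s))"

text \<open>A forth move supplies the candidate for the successor and a back move refutes points in
  between: rank 2.\<close>

lemma has_succ_bf:
  assumes bf: "bf A (ord_on A) B (ord_on B) a \<rho>" "osuc (osuc 0) \<le> a" "(x, y) \<in> \<rho>" and "has_succ A x"
  shows "has_succ B y"
proof -
  obtain s where s: "s \<in> A" "x < s" "\<not> (\<exists>z\<in>A. x < z \<and> z < s)"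
    using assms(4) by (auto simp: has_succ_def)
  have "osuc 0 < a" using bf(2) by (simp add: osuc_le_iff)
  then obtain s' \<rho>1 where 1: "\<rho> \<subseteq> \<rho>1" "(s, s') \<in> \<rho>1" "s' \<in> B" "bf A (ord_on A) B (ord_on B) (osuc 0) \<rho>1"
    using bf_forth1[OF bf(1) _ s(1)] by metis
  have "y < s'" using bf_less_iff[OF 1(4), of x y s s'] 1 bf(3) s(2) by blast
  moreover have False if z: "z' \<in> B" "y < z'" "z' < s'" for z'
  proof -
    obtain z \<rho>2 where 2: "\<rho>1 \<subseteq> \<rho>2" "(z, z') \<in> \<rho>2" "z \<in> A" "bf A (ord_on A) B (ord_on B) 0 \<rho>2"
      using bf_back1[OF 1(4) less_osuc z(1)] by metis
    have "x < z" "z < s"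
      using bf_less_iff[OF 2(4), of x y z z'] bf_less_iff[OF 2(4), of z z' s s'] 1 2 bf(3) z by blast+
    then show False using s(3) 2(3) by blast
  qed
  ultimately show ?thesis using 1(3) by (auto simp: has_succ_def)
qed

declare mset_lt_single_right_iff [simp del] mset_le_single_right_iff [simp del]

text \<open>Negative indices carry the blocks of \<open>P\<close>, positive ones those of
  \<open>R\<close>, and index 0 the block of type \<omega>^0 + 1 = 2. The ordering \<open>A\<close>
  uses all rationals, \<open>B\<close> all but 0.\<close>

locale shuffle =
  fixes lam :: cord and lab :: "rat \<Rightarrow> cord"
  assumes lim: "limit_ord lam"
    and lab_0: "lab 0 = 0"
    and lab_neg: "q < 0 \<Longrightarrow> lab q < lam"
    and lab_le: "lab q \<le> lam"
    and dense_neg: "x < y \<Longrightarrow> y \<le> 0 \<Longrightarrow> b < lam \<Longrightarrow> \<exists>q. x < q \<and> q < y \<and> lab q = b"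
    and dense_pos: "x < y \<Longrightarrow> 0 \<le> x \<Longrightarrow> b \<le> lam \<Longrightarrow> \<exists>q. x < q \<and> q < y \<and> lab q = b"
begin

text \<open>
  The block with index \<open>q\<close> has order type \<open>\<omega>^(lab q) + 1\<close>; \<open>(q, {#})\<close> is its least and
  \<open>(q, {#lab q#})\<close> its greatest point.
\<close>

definition pts :: "rat set \<Rightarrow> (rat \<times> cord multiset) set" where
  "pts I = {x. fst x \<in> I \<and> snd x \<le> {#lab (fst x)#}}"

abbreviation bfs where "bfs I J \<equiv> bf (pts I) (ord_on (pts I)) (pts J) (ord_on (pts J))"

text \<open>No two blocks are adjacent; therefore block ends have no successor, and block starts are
  limits of whatever blocks precede them.\<close>

definition idense :: "rat set \<Rightarrow> bool" where
  "idense I \<longleftrightarrow> (\<forall>q\<in>I. \<forall>r\<in>I. q < r \<longrightarrow> (\<exists>s\<in>I. q < s \<and> s < r))"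

lemma idenseD: "idense I \<Longrightarrow> q \<in> I \<Longrightarrow> r \<in> I \<Longrightarrow> q < r \<Longrightarrow> \<exists>s\<in>I. q < s \<and> s < r"
  unfolding idense_def by blast

lemma pts_Pair [simp]: "(q, M) \<in> pts I \<longleftrightarrow> q \<in> I \<and> M \<le> {#lab q#}"
  by (simp add: pts_def)

text \<open>Inside a block this is divisibility by \<omega>^g read off from the Cantor normal form.
  Block starts satisfy both sides for every \<open>g\<close>, being limits of the starts of any
  earlier blocks.\<close>

lemma deep_pts:
  assumes I: "idense I"
  shows "(q, M) \<in> pts I \<Longrightarrow> deep (pts I) g (q, M) \<longleftrightarrow> (\<forall>m\<in>#M. g \<le> m)"
proof (induction g arbitrary: q M rule: less_induct)
  case (less g)
  note qM = less.prems
  show ?case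
  proof
    assume deep: "deep (pts I) g (q, M)"
    show "\<forall>m\<in>#M. g \<le> m"
    proof (rule ccontr)
      assume "\<not> (\<forall>m\<in>#M. g \<le> m)"
      then obtain m0 where m0: "m0 \<in># M" "m0 < g" by (auto simp: not_le)
      \<comment> \<open>Removing one copy of the smallest exponent \<open>m < g\<close> leads to a
        point with no multiple of \<omega>^m strictly between it and \<open>M\<close>.\<close>
      define m where "m = Min (set_mset M)"
      have m: "m \<in># M" "\<And>x. x \<in># M \<Longrightarrow> m \<le> x" "m < g"
        using m0 unfolding m_def by (auto intro: Min_in Min_le order.strict_trans1)
      obtain M0 where M0: "M = add_mset m M0" using m(1) by (metis mset_add)
      have "M0 < M" unfolding M0 by (simp add: subset_imp_less_mset)
      then have "(q, M0) \<in> pts I" "(q, M0) < (q, M)" using qM by auto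
      then obtain z where z: "z \<in> pts I" "(q, M0) < z" "z < (q, M)" "deep (pts I) m z"
        using deepD[OF deep m(3)] by metis
      then obtain N where N: "z = (q, N)" "M0 < N" "N < M" by (cases z) auto
      have "\<forall>x\<in>#N. m \<le> x"
        using less.IH[OF m(3)] z(1,4) N(1) by blast
      moreover have "\<exists>x\<in>#N. x < m"
        using between_add_min_mset[of M0 N m] N M0 m(2) by auto
      ultimately show False by force
    qed
  next
    assume ge: "\<forall>m\<in>#M. g \<le> m"
    show "deep (pts I) g (q, M)"
    proof (rule deepI)
      fix d y assume d: "d < g" and y: "y \<in> pts I" "y < (q, M)"
      show "\<exists>z\<in>pts I. y < z \<and> z < (q, M) \<and> deep (pts I) d z"
      proof (cases "fst y < q")
        case True
        then obtain s where s: "s \<in> I" "fst y < s" "s < q"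
          using idenseD[OF I, of "fst y" q] y(1) qM by (cases y) auto
        have "(s, {#}) \<in> pts I" using s by simp
        moreover have "deep (pts I) d (s, {#})"
          using less.IH[OF d] s by simp
        ultimately show ?thesis
          using s by (intro bexI[of _ "(s, {#})"]) (auto simp: less_prod_def)
      next
        case False
        then obtain N where N: "y = (q, N)" "N < M" using y(2) by (cases y) auto
        \<comment> \<open>The next multiple of \<omega>^d after \<open>N\<close>; it stays below
          \<open>M\<close> because all exponents of \<open>M\<close> exceed
          \<open>d\<close>.\<close>
        define Z where "Z = N \<oplus> {#d#}"
        have "N < Z" unfolding Z_def using oplus_less_iff[of N "{#}" "{#d#}"] by simp
        obtain h where h: "count N h < count M h" "\<And>x. x > h \<Longrightarrow> count N x = count M x"
          using N(2) by (auto simp: less_multiset_top_difference)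
        have "h \<in># M" using h(1) by (metis count_greater_zero_iff gr0I less_nat_zero_code)
        then have dh: "d < h" using ge d by force
        have "Z < M"
          unfolding less_multiset_top_difference
          using h dh by (intro exI[of _ h]) (auto simp: Z_def count_oplus)
        have "(q, Z) \<in> pts I" using \<open>Z < M\<close> qM by auto
        moreover have "\<forall>m\<in>#Z. d \<le> m" by (auto simp: Z_def oplus_def)
        ultimately have "deep (pts I) d (q, Z)"
          using less.IH[OF d] by blast
        then show ?thesis
          using \<open>N < Z\<close> \<open>Z < M\<close> \<open>(q, Z) \<in> pts I\<close> N(1) by (intro bexI[of _ "(q, Z)"]) auto
      qed
    qed
  qed
qed

section \<open>Blocks, labels and offsets as back-and-forth invariants\<close>

lemma deep_pts_iff: "idense I \<Longrightarrow> x \<in> pts I \<Longrightarrow> deep (pts I) g x \<longleftrightarrow> (\<forall>m\<in>#snd x. g \<le> m)"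
  using deep_pts[of I "fst x" "snd x" g] by simp

text \<open>Inside a block the successor adds the exponent 0; after the end of a block the density
  of the indices leaves none.\<close>

lemma has_succ_pts:
  assumes I: "idense I" and x: "x \<in> pts I"
  shows "has_succ (pts I) x \<longleftrightarrow> snd x \<noteq> {#lab (fst x)#}"
proof
  assume "has_succ (pts I) x"
  then obtain s where s: "s \<in> pts I" "x < s" "\<not> (\<exists>z\<in>pts I. x < z \<and> z < s)"
    by (auto simp: has_succ_def)
  show "snd x \<noteq> {#lab (fst x)#}"
  proof
    assume "snd x = {#lab (fst x)#}"
    then have "fst x < fst s" using s(1,2) by (cases x; cases s) (auto simp: order_less_le)
    then obtain r where r: "r \<in> I" "fst x < r" "r < fst s"
      using idenseD[OF I] s(1) x by (auto simp: pts_def)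
    then have "(r, {#}) \<in> pts I" "x < (r, {#})" "(r, {#}) < s" by (auto simp: less_prod_def)
    then show False using s(3) by blast
  qed
next
  obtain q M where qM: "x = (q, M)" by (cases x)
  assume "snd x \<noteq> {#lab (fst x)#}"
  then have M: "M < {#lab q#}" using x qM by auto
  have no: "\<not> (M < N \<and> N < add_mset 0 M)" for N
    using between_add_min_mset[of M N 0] zero_le_cord leD by blast
  then have "add_mset 0 M \<le> {#lab q#}" using M by force
  then have "(q, add_mset 0 M) \<in> pts I" using x qM by simp
  moreover have "x < (q, add_mset 0 M)" unfolding qM by (simp add: subset_imp_less_mset)
  moreover have "\<not> (x < z \<and> z < (q, add_mset 0 M))" for z
    using no[of "snd z"] unfolding qM by (cases z) auto
  ultimately show "has_succ (pts I) x" unfolding has_succ_def by blast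
qed

text \<open>Otherwise the end of the block of \<open>y\<close> lies before \<open>y'\<close> and has
  no successor, but its partner lies between \<open>x\<close> and \<open>x'\<close> in a single
  block, before \<open>x'\<close>, and so has one.\<close>

lemma bf_same_block_imp:
  assumes IJ: "idense I" "idense J" and bf: "bfs I J a \<rho>" "osuc (osuc (osuc 0)) \<le> a"
    and xy: "(x, y) \<in> \<rho>" "(x', y') \<in> \<rho>" "fst x = fst x'" "x < x'"
  shows "fst y = fst y'"
proof (rule ccontr)
  assume ne: "fst y \<noteq> fst y'"
  have in_pts: "x \<in> pts I" "x' \<in> pts I" "y \<in> pts J" "y' \<in> pts J"
    using bfD(2)[OF bf(1)] xy(1,2) by auto
  have "y < y'" using bf_less_iff[OF bf(1) xy(1,2)] xy(4) by blast
  then have lt: "fst y < fst y'" using ne by (auto simp: less_prod_def)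
  let ?e' = "(fst y, {#lab (fst y)#})"
  have e': "?e' \<in> pts J" "?e' < y'" "\<not> ?e' < y"
    using in_pts lt by (auto simp: pts_def less_prod_def)
  have "osuc (osuc 0) < a" using bf(2) by (simp add: osuc_le_iff)
  then obtain e \<rho>1 where e: "\<rho> \<subseteq> \<rho>1" "(e, ?e') \<in> \<rho>1" "e \<in> pts I" "bfs I J (osuc (osuc 0)) \<rho>1"
    using bf_back1[OF bf(1) _ e'(1)] by metis
  have "e < x'" "\<not> e < x"
    using bf_less_iff[OF e(4), of e ?e' x' y'] bf_less_iff[OF e(4), of e ?e' x y] e(1,2) xy(1,2) e'(2,3) by blast+
  then have "fst e = fst x'" "snd e < snd x'"
    using xy(3,4) by (auto simp: less_prod_def)
  then have "has_succ (pts I) e"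
    using has_succ_pts[OF IJ(1) e(3)] in_pts(2) by (auto simp: pts_def)
  then have "has_succ (pts J) ?e'"
    using has_succ_bf[OF e(4) order_refl e(2)] by blast
  then show False using has_succ_pts[OF IJ(2) e'(1)] by simp
qed

lemma bf_same_block:
  assumes IJ: "idense I" "idense J" and bf: "bfs I J a \<rho>" "osuc (osuc (osuc 0)) \<le> a"
    and xy: "(x, y) \<in> \<rho>" "(x', y') \<in> \<rho>"
  shows "fst x = fst x' \<longleftrightarrow> fst y = fst y'"
proof -
  have 1: "fst y = fst y'" if "fst x = fst x'"
  proof -
    consider "x < x'" | "x' < x" | "x = x'" by force
    then show ?thesis
      using bf_same_block_imp[OF IJ bf xy] bf_same_block_imp[OF IJ bf xy(2,1)] that
        pisoD(1)[OF bfD(3)[OF bf(1)] xy] by cases auto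
  qed
  have xy': "(y, x) \<in> \<rho>\<inverse>" "(y', x') \<in> \<rho>\<inverse>" using xy by auto
  have 2: "fst x = fst x'" if "fst y = fst y'"
  proof -
    consider "y < y'" | "y' < y" | "y = y'" by force
    then show ?thesis
      using bf_same_block_imp[OF IJ(2,1) bf_converse[OF bf(1)] bf(2) xy']
        bf_same_block_imp[OF IJ(2,1) bf_converse[OF bf(1)] bf(2) xy'(2,1)] that
        pisoD(1)[OF bfD(3)[OF bf(1)] xy] by cases auto
  qed
  show ?thesis using 1 2 by blast
qed

text \<open>If \<open>y\<close> were not first, the start of its block would need a partner before
  \<open>x\<close> in the block of \<open>x\<close>.\<close>

lemma bf_block_start:
  assumes IJ: "idense I" "idense J" and bf: "bfs I J a \<rho>" "osuc (osuc (osuc (osuc 0))) \<le> a"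
    and xy: "(x, y) \<in> \<rho>" "snd x = {#}"
  shows "snd y = {#}"
proof (rule ccontr)
  assume ne: "snd y \<noteq> {#}"
  let ?w' = "(fst y, {#})"
  have y: "y \<in> pts J" using bfD(2)[OF bf(1)] xy(1) by auto
  then have w': "?w' \<in> pts J" "?w' < y" using ne by (auto simp: pts_def less_prod_def)
  have "osuc (osuc (osuc 0)) < a" using bf(2) by (simp add: osuc_le_iff)
  then obtain w \<rho>1 where w: "\<rho> \<subseteq> \<rho>1" "(w, ?w') \<in> \<rho>1" "w \<in> pts I" "bfs I J (osuc (osuc (osuc 0))) \<rho>1"
    using bf_back1[OF bf(1) _ w'(1)] by metis
  have "w < x" using bf_less_iff[OF w(4), of w ?w' x y] w(1,2) xy(1) w'(2) by blast
  moreover have "fst w = fst x"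
    using bf_same_block[OF IJ w(4) order_refl, of w ?w' x y] w(1,2) xy(1) by auto
  ultimately show False using xy(2) by (auto simp: less_prod_def)
qed

lemma four_less_lam: "osuc (osuc (osuc (osuc 0))) < lam"
  using lim by (simp add: limit_ord_osuc_less limit_ord_pos)

lemma three_less_lam: "osuc (osuc (osuc 0)) < lam"
  using lim by (simp add: limit_ord_osuc_less limit_ord_pos)

text \<open>The end of a block reveals the label: it is a multiple of \<omega>^g exactly for
  \<open>g\<close> up to the label. One move finds this end, and the rank left over can be any rank
  below \<open>lam\<close>.\<close>

lemma bf_label_le:
  assumes IJ: "idense I" "idense J" and bf: "bfs I J lam \<rho>" "(x, y) \<in> \<rho>"
    and g: "g < lam" "g \<le> lab (fst x)"
  shows "g \<le> lab (fst y)"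
proof -
  let ?d = "max (osuc (osuc (osuc 0))) (dbl g)"
  have d: "?d < lam" using three_less_lam dbl_less_limit[OF lim g(1)] by simp
  let ?e = "(fst x, {#lab (fst x)#})"
  have x: "x \<in> pts I" using bfD(2)[OF bf(1)] bf(2) by auto
  then have e: "?e \<in> pts I" by (simp add: pts_def)
  obtain e' \<rho>1 where e': "\<rho> \<subseteq> \<rho>1" "(?e, e') \<in> \<rho>1" "e' \<in> pts J" "bfs I J ?d \<rho>1"
    using bf_forth1[OF bf(1) d e] by metis
  have "fst e' = fst y"
    using bf_same_block[OF IJ e'(4) _ e'(2), of x y] e'(1) bf(2) by auto
  have "\<not> has_succ (pts J) e'"
  proof
    assume "has_succ (pts J) e'"
    then have "has_succ (pts I) ?e"
      using has_succ_bf[OF bf_converse[OF e'(4)] _ , of e' ?e] e'(2)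
      by (meson converse_iff less_osuc max.coboundedI1 order_less_imp_le)
    then show False using has_succ_pts[OF IJ(1) e] by simp
  qed
  then have e'_eq: "e' = (fst y, {#lab (fst y)#})"
    using has_succ_pts[OF IJ(2) e'(3)] \<open>fst e' = fst y\<close> by (cases e') auto
  have "deep (pts I) g ?e" using deep_pts[OF IJ(1) e] g(2) by simp
  then have "deep (pts J) g e'"
    using deep_bf[OF e'(4) _ e'(2)] by simp
  then show ?thesis
    using deep_pts[OF IJ(2)] e'(3) unfolding e'_eq by simp
qed

text \<open>\<open>bf_label_le\<close> is applied to the successor of the smaller label, which is
  below \<open>lam\<close> because \<open>lam\<close> is a limit.\<close>

lemma bf_label:
  assumes IJ: "idense I" "idense J" and bf: "bfs I J lam \<rho>" "(x, y) \<in> \<rho>"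
  shows "lab (fst x) = lab (fst y)"
proof (rule antisym)
  have *: "(y, x) \<in> \<rho>\<inverse>" using bf(2) by simp
  show "lab (fst x) \<le> lab (fst y)"
  proof (rule ccontr)
    assume "\<not> ?thesis"
    then have "lab (fst y) < lab (fst x)" by simp
    moreover then have "osuc (lab (fst y)) < lam"
      using lim lab_le[of "fst x"] by (simp add: limit_ord_osuc_less order.strict_trans2)
    ultimately have "osuc (lab (fst y)) \<le> lab (fst y)"
      unfolding osuc_le_iff[of "lab (fst y)" "lab (fst x)", symmetric]
      using bf_label_le[OF IJ bf] by blast
    then show False by (simp add: osuc_le_iff)
  qed
  show "lab (fst y) \<le> lab (fst x)"
  proof (rule ccontr)
    assume "\<not> ?thesis"
    then have "lab (fst x) < lab (fst y)" by simp
    moreover then have "osuc (lab (fst x)) < lam"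
      using lim lab_le[of "fst y"] by (simp add: limit_ord_osuc_less order.strict_trans2)
    ultimately have "osuc (lab (fst x)) \<le> lab (fst x)"
      unfolding osuc_le_iff[of "lab (fst x)" "lab (fst y)", symmetric]
      using bf_label_le[OF IJ(2,1) bf_converse[OF bf(1)] *] by blast
    then show False by (simp add: osuc_le_iff)
  qed
qed

text \<open>The normal form is built up from its largest exponents: adding \<omega>^m leads to the
  first multiple of \<omega>^m after \<open>M\<close>. The rank that names an offset depends on
  \<open>M\<close>, but stays below \<open>lam\<close>.\<close>

lemma bf_offset_level:
  assumes IJ: "idense I" "idense J"
  shows "(\<forall>m\<in>#M. m < lam) \<Longrightarrow>
    \<exists>d<lam. \<forall>\<rho> x y. bfs I J d \<rho> \<longrightarrow> (x, y) \<in> \<rho> \<longrightarrow> snd x = M \<longrightarrow> snd y = M"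
proof (induction M rule: multiset_induct_min)
  case empty
  then show ?case using bf_block_start[OF IJ _ order_refl] four_less_lam by blast
next
  case (add m M)
  then obtain d where d: "d < lam" "\<And>\<rho> x y. bfs I J d \<rho> \<Longrightarrow> (x, y) \<in> \<rho> \<Longrightarrow> snd x = M \<Longrightarrow> snd y = M"
    by auto
  have m: "m < lam" "\<forall>x\<in>#M. m \<le> x" using add by auto
  \<comment> \<open>Enough for locating \<open>M\<close>, for comparing blocks and for recognising
    multiples of \<omega>^m; the two ranks on top of \<open>e\<close> pay for the moves to
    \<open>w'\<close> and \<open>z\<close>.\<close>
  define e where "e = max d (max (osuc (osuc (osuc 0))) (dbl m))"
  have e: "d \<le> e" "osuc (osuc (osuc 0)) \<le> e" "dbl m \<le> e"
    unfolding e_def by (simp_all only: max.cobounded1 max.coboundedI2 max.cobounded2)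
  have "e < lam" using d(1) three_less_lam dbl_less_limit[OF lim m(1)] by (simp add: e_def)
  have "snd y = add_mset m M"
    if bf: "bfs I J (osuc (osuc e)) \<rho>" and xy: "(x, y) \<in> \<rho>" and M: "snd x = add_mset m M" for \<rho> x y
  proof -
    have pts: "x \<in> pts I" "y \<in> pts J" using bfD(2)[OF bf] xy by auto
    let ?w = "(fst x, M)"
    have lt: "M < add_mset m M" by (simp add: subset_imp_less_mset)
    have "M \<le> {#lab (fst x)#}"
      using pts(1) M order_trans[OF order_less_imp_le[OF lt]] by (simp add: pts_def)
    then have w: "?w \<in> pts I" "?w < x" using pts(1) M lt by (auto simp: pts_def less_prod_def)
    obtain w' \<rho>1 where w': "\<rho> \<subseteq> \<rho>1" "(?w, w') \<in> \<rho>1" "w' \<in> pts J" "bfs I J (osuc e) \<rho>1"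
      using bf_forth1[OF bf less_osuc w(1)] by metis
    have bfe: "bfs I J e \<rho>1" using bf_mono[OF w'(4) order_refl] less_osuc[of e] by simp
    have xy1: "(x, y) \<in> \<rho>1" using w'(1) xy by blast
    have "fst w' = fst y"
      using bf_same_block[OF IJ bfe e(2) w'(2) xy1] by simp
    moreover have "snd w' = M"
      using d(2)[OF bf_mono[OF bfe order_refl e(1)] w'(2)] by simp
    ultimately have w'_eq: "w' = (fst y, M)" by (cases w') auto
    have "w' < y" using bf_less_iff[OF bfe w'(2) xy1] w(2) by blast
    then have My: "M < snd y" unfolding w'_eq by (auto simp: less_prod_def)
    have "deep (pts I) m x"
      using deep_pts_iff[OF IJ(1) pts(1)] m(2) M by simp
    then have "deep (pts J) m y" by (rule deep_bf[OF bfe e(3) xy1])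
    then have ge: "\<forall>n\<in>#snd y. m \<le> n"
      using deep_pts_iff[OF IJ(2) pts(2)] by simp
    have "\<not> snd y < add_mset m M"
      using between_add_min_mset[OF My _ m(2)] ge leD by blast
    moreover have "\<not> add_mset m M < snd y"
    proof
      assume gt: "add_mset m M < snd y"
      let ?z' = "(fst y, add_mset m M)"
      have z': "?z' \<in> pts J" "w' < ?z'" "?z' < y"
        using gt pts(2) lt unfolding w'_eq by (auto simp: pts_def less_prod_def)
      obtain z \<rho>2 where z: "\<rho>1 \<subseteq> \<rho>2" "(z, ?z') \<in> \<rho>2" "z \<in> pts I" "bfs I J e \<rho>2"
        using bf_back1[OF w'(4) less_osuc z'(1)] by metis
      have "deep (pts J) m ?z'"
        using deep_pts[OF IJ(2) z'(1)] m(2) by simp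
      then have "deep (pts I) m z"
        using deep_bf[OF bf_converse[OF z(4)] e(3), of ?z' z] z(2) by simp
      then have gez: "\<forall>n\<in>#snd z. m \<le> n"
        using deep_pts_iff[OF IJ(1) z(3)] by simp
      have "?w < z" "z < x"
        using bf_less_iff[OF z(4), of ?w w' z ?z'] bf_less_iff[OF z(4), of z ?z' x y] z(1,2) w'(2) xy1 z'(2,3)
        by blast+
      then have "M < snd z" "snd z < add_mset m M"
        using M by (auto simp: less_prod_def)
      then show False
        using between_add_min_mset[OF _ _ m(2)] gez leD by blast
    qed
    ultimately show ?thesis by force
  qed
  moreover have "osuc (osuc e) < lam" using \<open>e < lam\<close> lim by (simp add: limit_ord_osuc_less)
  ultimately show ?case by blast
qed

text \<open>A block end is recognised by its missing successor and its label. Every other offset has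
  all exponents below \<open>lam\<close> and is named at some rank below \<open>lam\<close>.\<close>

lemma bf_offset:
  assumes IJ: "idense I" "idense J" and bf: "bfs I J lam \<rho>" "(x, y) \<in> \<rho>"
  shows "snd x = snd y"
proof -
  have pts: "x \<in> pts I" "y \<in> pts J" using bfD(2)[OF bf(1)] bf(2) by auto
  show ?thesis
  proof (cases "snd x = {#lab (fst x)#}")
    case True
    have "\<not> has_succ (pts J) y"
    proof
      assume "has_succ (pts J) y"
      moreover have "osuc (osuc 0) \<le> lam"
        using lim by (simp add: limit_ord_osuc_less limit_ord_pos order_less_imp_le)
      ultimately have "has_succ (pts I) x"
        using has_succ_bf[OF bf_converse[OF bf(1)], of y x] bf(2) by simp
      then show False using has_succ_pts[OF IJ(1) pts(1)] True by simp
    qed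
    then show ?thesis
      using has_succ_pts[OF IJ(2) pts(2)] True bf_label[OF IJ bf] by simp
  next
    case False
    then have "snd x < {#lab (fst x)#}" using pts(1) by (auto simp: pts_def)
    then have "\<forall>m\<in>#snd x. m < lam"
      using lab_le[of "fst x"] by (auto simp: mset_lt_single_right_iff intro: order.strict_trans2)
    then obtain d where d: "d < lam" "\<And>\<rho> x' y. bfs I J d \<rho> \<Longrightarrow> (x', y) \<in> \<rho> \<Longrightarrow> snd x' = snd x \<Longrightarrow> snd y = snd x"
      using bf_offset_level[OF IJ] by metis
    show ?thesis
      using d(2)[OF bf_mono[OF bf(1) order_refl] bf(2) refl] d(1) by simp
  qed
qed

section \<open>Back-and-forth equivalence from comparable distances\<close>

definition matching :: "cord \<Rightarrow> rat \<times> cord multiset \<Rightarrow> rat \<times> cord multiset \<Rightarrow>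
    rat \<times> cord multiset \<Rightarrow> rat \<times> cord multiset \<Rightarrow> bool" where
  "matching a x y x' y' \<longleftrightarrow> (fst x < fst x' \<longleftrightarrow> fst y < fst y') \<and> (fst x = fst x' \<longleftrightarrow> fst y = fst y') \<and>
     (fst x = fst x' \<longrightarrow> (snd x \<le> snd x' \<longleftrightarrow> snd y \<le> snd y') \<and>
        (snd x \<le> snd x' \<longrightarrow> eqv a (snd x' \<ominus> snd x) (snd y' \<ominus> snd y)))"

text \<open>
  Since \<open>eqv a\<close> is a congruence for addition, it may be required for the distances of all pairs of
  points in a block rather than of consecutive ones only.
\<close>

definition good :: "rat set \<Rightarrow> rat set \<Rightarrow> cord \<Rightarrow> ((rat \<times> cord multiset) \<times> (rat \<times> cord multiset)) set \<Rightarrow> bool" where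
  "good I J a \<rho> \<longleftrightarrow> finite \<rho> \<and> \<rho> \<subseteq> pts I \<times> pts J \<and>
    (\<forall>x y. (x, y) \<in> \<rho> \<longrightarrow> ((fst x, {#}), (fst y, {#})) \<in> \<rho> \<and>
       ((fst x, {#lab (fst x)#}), (fst y, {#lab (fst y)#})) \<in> \<rho>) \<and>
    (\<forall>x y x' y'. (x, y) \<in> \<rho> \<longrightarrow> (x', y') \<in> \<rho> \<longrightarrow> matching a x y x' y')"

lemma goodD:
  assumes "good I J a \<rho>"
  shows "finite \<rho>" "\<rho> \<subseteq> pts I \<times> pts J"
    "(x, y) \<in> \<rho> \<Longrightarrow> ((fst x, {#}), (fst y, {#})) \<in> \<rho>"
    "(x, y) \<in> \<rho> \<Longrightarrow> ((fst x, {#lab (fst x)#}), (fst y, {#lab (fst y)#})) \<in> \<rho>"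
    "(x, y) \<in> \<rho> \<Longrightarrow> (x', y') \<in> \<rho> \<Longrightarrow> matching a x y x' y'"
  using assms unfolding good_def by blast+

lemma matchingD:
  assumes "matching a x y x' y'"
  shows "fst x < fst x' \<longleftrightarrow> fst y < fst y'" "fst x = fst x' \<longleftrightarrow> fst y = fst y'"
    "fst x = fst x' \<Longrightarrow> snd x \<le> snd x' \<longleftrightarrow> snd y \<le> snd y'"
    "fst x = fst x' \<Longrightarrow> snd x \<le> snd x' \<Longrightarrow> eqv a (snd x' \<ominus> snd x) (snd y' \<ominus> snd y)"
  using assms unfolding matching_def by blast+

lemma matching_mono: "matching a x y x' y' \<Longrightarrow> d \<le> a \<Longrightarrow> matching d x y x' y'"
  unfolding matching_def using eqv_mono by blast

lemma good_mono: "good I J a \<rho> \<Longrightarrow> d \<le> a \<Longrightarrow> good I J d \<rho>"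
  unfolding good_def using matching_mono by blast

lemma matching_le_iff: "matching a x y x' y' \<Longrightarrow> x \<le> x' \<longleftrightarrow> y \<le> y'"
  unfolding matching_def less_eq_prod_def by (metis order_le_less)

lemma good_eq_iff:
  assumes "good I J a \<rho>" "(x, y) \<in> \<rho>" "(x', y') \<in> \<rho>"
  shows "x = x' \<longleftrightarrow> y = y'"
  using matching_le_iff[OF goodD(5)[OF assms]] matching_le_iff[OF goodD(5)[OF assms(1,3,2)]]
  by (metis order_antisym_conv order_refl)

lemma good_piso: "good I J a \<rho> \<Longrightarrow> piso (ord_on (pts I)) (ord_on (pts J)) \<rho>"
  unfolding piso_def
proof (intro allI impI)
  fix x y x' y' assume good: "good I J a \<rho>" and xy: "(x, y) \<in> \<rho>" "(x', y') \<in> \<rho>"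
  have "x \<in> pts I" "x' \<in> pts I" "y \<in> pts J" "y' \<in> pts J" using goodD(2)[OF good] xy by auto
  then show "(x = x' \<longleftrightarrow> y = y') \<and> ((x, x') \<in> ord_on (pts I) \<longleftrightarrow> (y, y') \<in> ord_on (pts J))"
    using good_eq_iff[OF good xy] matching_le_iff[OF goodD(5)[OF good xy]] by (simp add: ord_on_def)
qed

lemma matching_sym: "matching a x y x' y' \<Longrightarrow> matching a y x y' x'"
  unfolding matching_def using eqv_sym by metis

lemma good_converse: "good I J a \<rho> \<Longrightarrow> good J I a (\<rho>\<inverse>)"
  unfolding good_def[of J I]
proof (intro conjI allI impI)
  assume good: "good I J a \<rho>"
  show "finite (\<rho>\<inverse>)" "\<rho>\<inverse> \<subseteq> pts J \<times> pts I" using goodD(1,2)[OF good] by auto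
  fix x y assume xy: "(x, y) \<in> \<rho>\<inverse>"
  then show "((fst x, {#}), (fst y, {#})) \<in> \<rho>\<inverse>" "((fst x, {#lab (fst x)#}), (fst y, {#lab (fst y)#})) \<in> \<rho>\<inverse>"
    using goodD(3,4)[OF good, of y x] by (auto simp only: converse_iff)
  fix x' y' assume "(x', y') \<in> \<rho>\<inverse>"
  then show "matching a x y x' y'"
    using xy goodD(5)[OF good, of y x y' x'] matching_sym by (simp only: converse_iff)
qed

text \<open>Only labels below \<open>lam\<close> are asked for, since at ranks below
  \<open>lam\<close> a block with label \<open>lam\<close> is imitated by one with a smaller label.
  Empty \<open>L\<close> or \<open>U\<close> excludes extreme indices.\<close>

definition full :: "rat set \<Rightarrow> bool" where
  "full I \<longleftrightarrow> (\<forall>L U b. finite L \<longrightarrow> finite U \<longrightarrow> L \<subseteq> I \<longrightarrow> U \<subseteq> I \<longrightarrow> (\<forall>l\<in>L. \<forall>u\<in>U. l < u) \<longrightarrow> b < lam \<longrightarrow>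
     (\<exists>q\<in>I. lab q = b \<and> (\<forall>l\<in>L. l < q) \<and> (\<forall>u\<in>U. q < u)))"

lemma matching_other_block:
  assumes "fst x < fst x'" "fst y < fst y'"
  shows "matching a x y x' y'" "matching a x' y' x y"
  using assms unfolding matching_def by auto

lemma matching_block_ends:
  assumes "fst x = q" "fst y = q'" "fst x' = q" "fst y' = q'" "eqv a {#lab q#} {#lab q'#}"
    "(snd x = {#} \<and> snd y = {#}) \<or> (snd x = {#lab q#} \<and> snd y = {#lab q'#})"
    "(snd x' = {#} \<and> snd y' = {#}) \<or> (snd x' = {#lab q#} \<and> snd y' = {#lab q'#})"
  shows "matching a x y x' y'"
  using assms unfolding matching_def by auto

text \<open>A new block enters with its two ends only, so the distance between them is the single
  new one to compare.\<close>

lemma good_add_block: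
  assumes good: "good I J a \<rho>" and a: "a < lam" and J: "full J" and q: "q \<in> I"
  shows "\<exists>\<rho>'. \<rho> \<subseteq> \<rho>' \<and> good I J a \<rho>' \<and> q \<in> fst ` Domain \<rho>'"
proof (cases "q \<in> fst ` Domain \<rho>")
  case True
  then show ?thesis using good by blast
next
  case False
  define L where "L = {fst y | x y. (x, y) \<in> \<rho> \<and> fst x < q}"
  define U where "U = {fst y | x y. (x, y) \<in> \<rho> \<and> q < fst x}"
  have "L \<subseteq> fst ` snd ` \<rho>" "U \<subseteq> fst ` snd ` \<rho>" by (force simp: L_def U_def)+
  then have fin: "finite L" "finite U" using goodD(1)[OF good] by (auto intro: finite_subset)
  have sub: "L \<subseteq> J" "U \<subseteq> J"
    using goodD(2)[OF good] by (auto simp: L_def U_def pts_def)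
  have LU: "l < u" if lu: "l \<in> L" "u \<in> U" for l u
  proof -
    obtain x y x' y' where *: "l = fst y" "u = fst y'" "(x, y) \<in> \<rho>" "(x', y') \<in> \<rho>" "fst x < q" "q < fst x'"
      using lu unfolding L_def U_def by blast
    then show ?thesis using matchingD(1)[OF goodD(5)[OF good *(3,4)]] by simp
  qed
  \<comment> \<open>For label \<open>lam\<close> the rank \<open>a\<close> itself serves as label:
    \<omega>^lam and \<omega>^a both have remainder zero and nonzero quotient modulo
    \<omega>^a.\<close>
  define b where "b = (if lab q < lam then lab q else a)"
  have "b < lam" using a by (auto simp: b_def)
  then obtain q' where q': "q' \<in> J" "lab q' = b" "\<And>l. l \<in> L \<Longrightarrow> l < q'" "\<And>u. u \<in> U \<Longrightarrow> q' < u"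
    using J fin sub LU unfolding full_def by metis
  have eqv: "eqv a {#lab q#} {#lab q'#}"
  proof (cases "lab q < lam")
    case False
    then have "lab q = lam" using lab_le[of q] by simp
    then show ?thesis using a q'(2) False by (intro eqvI) (auto simp: b_def)
  qed (simp add: q'(2) b_def)
  let ?N = "{((q, {#}), (q', {#})), ((q, {#lab q#}), (q', {#lab q'#}))}"
  have new: "fst x = q \<and> fst y = q' \<and> ((snd x = {#} \<and> snd y = {#}) \<or> (snd x = {#lab q#} \<and> snd y = {#lab q'#}))"
    if "(x, y) \<in> ?N" for x y using that by auto
  have other: "matching a x y x' y' \<and> matching a x' y' x y" if "(x, y) \<in> ?N" "(x', y') \<in> \<rho>" for x y x' y'
  proof -
    have f: "fst x = q" "fst y = q'" using new[OF that(1)] by auto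
    have "fst x' \<noteq> q" using False that(2) by force
    then consider "fst x' < q" | "q < fst x'" by force
    then show ?thesis
    proof cases
      case 1
      then have "fst y' < q'" using q'(3) that(2) unfolding L_def by blast
      then show ?thesis using matching_other_block[of x' x y' y a] f 1 by simp
    next
      case 2
      then have "q' < fst y'" using q'(4) that(2) unfolding U_def by blast
      then show ?thesis using matching_other_block[of x x' y y' a] f 2 by simp
    qed
  qed
  have match: "matching a x y x' y'" if xy: "(x, y) \<in> \<rho> \<union> ?N" "(x', y') \<in> \<rho> \<union> ?N" for x y x' y'
  proof -
    consider "(x, y) \<in> \<rho>" "(x', y') \<in> \<rho>" | "(x, y) \<in> ?N" "(x', y') \<in> \<rho>" | "(x, y) \<in> \<rho>" "(x', y') \<in> ?N"
      | "(x, y) \<in> ?N" "(x', y') \<in> ?N"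
      using xy by blast
    then show ?thesis
    proof cases
      case 1
      then show ?thesis by (rule goodD(5)[OF good])
    next
      case 2
      then show ?thesis using other by blast
    next
      case 3
      then show ?thesis using other by blast
    next
      case 4
      then show ?thesis
        using new[OF 4(1)] new[OF 4(2)] eqv by (intro matching_block_ends[of x q y q']) auto
    qed
  qed
  have "good I J a (\<rho> \<union> ?N)"
    unfolding good_def
  proof (intro conjI)
    show "finite (\<rho> \<union> ?N)" using goodD(1)[OF good] by simp
    show "\<rho> \<union> ?N \<subseteq> pts I \<times> pts J" using goodD(2)[OF good] q q'(1) by auto
    show "\<forall>x y. (x, y) \<in> \<rho> \<union> ?N \<longrightarrow> ((fst x, {#}), (fst y, {#})) \<in> \<rho> \<union> ?N \<and>
       ((fst x, {#lab (fst x)#}), (fst y, {#lab (fst y)#})) \<in> \<rho> \<union> ?N"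
      using goodD(3,4)[OF good] by auto
    show "\<forall>x y x' y'. (x, y) \<in> \<rho> \<union> ?N \<longrightarrow> (x', y') \<in> \<rho> \<union> ?N \<longrightarrow> matching a x y x' y'"
      using match by blast
  qed
  moreover have "q \<in> fst ` Domain (\<rho> \<union> ?N)" by force
  ultimately show ?thesis by (intro exI[of _ "\<rho> \<union> ?N"] conjI) auto
qed

lemma good_add_blocks:
  assumes "finite Q" "Q \<subseteq> I" and good: "good I J a \<rho>" and a: "a < lam" and J: "full J"
  shows "\<exists>\<rho>'. \<rho> \<subseteq> \<rho>' \<and> good I J a \<rho>' \<and> Q \<subseteq> fst ` Domain \<rho>'"
  using assms(1,2)
proof (induction Q)
  case empty
  then show ?case using good by blast
next
  case (insert q Q)
  then obtain \<rho>1 where 1: "\<rho> \<subseteq> \<rho>1" "good I J a \<rho>1" "Q \<subseteq> fst ` Domain \<rho>1" by auto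
  obtain \<rho>2 where 2: "\<rho>1 \<subseteq> \<rho>2" "good I J a \<rho>2" "q \<in> fst ` Domain \<rho>2"
    using good_add_block[OF 1(2) a J, of q] insert.prems by auto
  have "fst ` Domain \<rho>1 \<subseteq> fst ` Domain \<rho>2" using 2(1) by (intro image_mono Domain_mono)
  then show ?case using 1 2 by (intro exI[of _ \<rho>2]) auto
qed

text \<open>
  New points are inserted from left to right: distances to a point of the original \<open>\<rho>\<close> on the right
  keep the rank \<open>a\<close>, while all other distances drop to rank \<open>d\<close>.
\<close>

lemma good_add_points:
  assumes good: "good I J a \<rho>" and d: "d < a"
  shows "finite D \<Longrightarrow> D \<subseteq> pts I \<Longrightarrow> fst ` D \<subseteq> fst ` Domain \<rho> \<Longrightarrow>
    \<exists>\<rho>'. \<rho> \<subseteq> \<rho>' \<and> good I J d \<rho>' \<and> Domain \<rho>' = Domain \<rho> \<union> D \<and>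
      (\<forall>x y x' y'. (x, y) \<in> \<rho>' \<longrightarrow> (x', y') \<in> \<rho> \<longrightarrow> matching a x y x' y')"
proof (induction D rule: finite_linorder_max_induct)
  case empty
  then show ?case
    using good good_mono[OF good] d goodD(5)[OF good] by (intro exI[of _ \<rho>]) auto
next
  case (insert b D)
  then obtain \<rho>' where \<rho>': "\<rho> \<subseteq> \<rho>'" "good I J d \<rho>'" "Domain \<rho>' = Domain \<rho> \<union> D"
    and old: "\<And>x y x' y'. (x, y) \<in> \<rho>' \<Longrightarrow> (x', y') \<in> \<rho> \<Longrightarrow> matching a x y x' y'"
    by auto
  show ?case
  proof (cases "b \<in> Domain \<rho>")
    case True
    then have "Domain \<rho> \<union> insert b D = Domain \<rho> \<union> D" by blast
    then show ?thesis using \<rho>' old by (intro exI[of _ \<rho>']) simp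
  next
    case False
    have bD: "b \<notin> Domain \<rho>'" using False \<rho>'(3) insert.hyps(2) by blast
    obtain q M where b: "b = (q, M)" by (cases b)
    have bI: "q \<in> I" "M \<le> {#lab q#}" using insert.prems(1) b by auto
    obtain x0 y0 where xy0: "(x0, y0) \<in> \<rho>" "fst x0 = q"
      using insert.prems(2) b by auto
    define q' where "q' = fst y0"
    have start: "((q, {#}), (q', {#})) \<in> \<rho>" and fin: "((q, {#lab q#}), (q', {#lab q'#})) \<in> \<rho>"
      using goodD(3,4)[OF good xy0(1)] xy0(2) by (auto simp: q'_def)
    have blk: "fst x = q \<longleftrightarrow> fst y = q'" "fst x < q \<longleftrightarrow> fst y < q'" if "(x, y) \<in> \<rho>'" for x y
      using matchingD(1,2)[OF old[OF that start]] by auto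
    have blk2: "q < fst x \<longleftrightarrow> q' < fst y" if "(x, y) \<in> \<rho>'" for x y
      using blk[OF that] by auto
    have finD: "finite (Domain \<rho>')" using goodD(1)[OF \<rho>'(2)] by (rule finite_Domain)
    \<comment> \<open>The candidates for the neighbours of \<open>b\<close> in its block; both sets
      are nonempty because the ends of the block are already matched.\<close>
    define P where "P = {x \<in> Domain \<rho>'. fst x = q \<and> x < b}"
    define S where "S = {x \<in> Domain \<rho>'. fst x = q \<and> b < x}"
    have "(q, {#}) \<in> Domain \<rho>" "(q, {#lab q#}) \<in> Domain \<rho>" using start fin by blast+
    then have "M \<noteq> {#}" "M \<noteq> {#lab q#}" using False b by auto
    then have "(q, {#}) \<in> P" "(q, {#lab q#}) \<in> S"
      using start fin \<rho>'(1) bI b by (auto simp: P_def S_def)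
    then have "P \<noteq> {}" "S \<noteq> {}" by auto
    moreover have "finite P" "finite S" using finD by (simp_all add: P_def S_def)
    ultimately have p: "Max P \<in> P" "\<And>x. x \<in> P \<Longrightarrow> x \<le> Max P" and s: "Min S \<in> S" "\<And>x. x \<in> S \<Longrightarrow> Min S \<le> x"
      by (simp_all del: mem_Collect_eq)
    define p s where "p = Max P" and "s = Min S"
    note p = p[folded p_def] and s = s[folded s_def]
    obtain p' where p': "(p, p') \<in> \<rho>'" using p(1) by (auto simp: P_def)
    \<comment> \<open>Points are added in increasing order, so whatever lies right of
      \<open>b\<close> belongs to the original \<rho>, and distances up to it still have rank
      \<open>a\<close>.\<close>
    have right_old: "(x, y) \<in> \<rho>" if xy: "(x, y) \<in> \<rho>'" "b < x" for x y
    proof -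
      have "x \<in> Domain \<rho>" using xy \<rho>'(3) insert.hyps(2) less_asym by blast
      then obtain y2 where "(x, y2) \<in> \<rho>" by blast
      moreover then have "y = y2" using good_eq_iff[OF \<rho>'(2) xy(1)] \<rho>'(1) by blast
      ultimately show ?thesis by simp
    qed
    obtain s' where s': "(s, s') \<in> \<rho>'" using s(1) by (auto simp: S_def)
    then have s'_old: "(s, s') \<in> \<rho>" using right_old s(1) by (auto simp: S_def)
    have fq: "fst p = q" "fst s = q" "fst p' = q'" "fst s' = q'"
      using p(1) s(1) blk p' s' by (auto simp: P_def S_def)
    have ord: "snd p < M" "M < snd s"
      using p(1) s(1) fq b by (auto simp: P_def S_def less_prod_def)
    then have ps: "snd p \<le> snd s" by simp
    note ms = matchingD(3,4)[OF old[OF p' s'_old]]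
    have ps': "snd p' \<le> snd s'" using ms(1) ps fq by simp
    define K1 K2 where "K1 = M \<ominus> snd p" and "K2 = snd s \<ominus> M"
    have K: "snd s \<ominus> snd p = K1 \<oplus> K2"
      unfolding K1_def K2_def using ord by (intro ominus_trans) auto
    \<comment> \<open>The rank \<open>a\<close> distance from \<open>p\<close> to \<open>s\<close>
      splits at the new point into rank \<open>d\<close> on the left and rank \<open>a\<close> on
      the right.\<close>
    have "eqv a (K1 \<oplus> K2) (snd s' \<ominus> snd p')" using ms(2) ps fq K by simp
    then obtain K1' K2' where K': "snd s' \<ominus> snd p' = K1' \<oplus> K2'" "eqv d K1 K1'" "eqv a K2 K2'"
      using eqv_split[OF _ d] by blast
    define M' where "M' = snd p' \<oplus> K1'"
    have s'_eq: "snd s' = M' \<oplus> K2'"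
      unfolding M'_def oplus_assoc K'(1)[symmetric] using oplus_ominus[OF ps'] by simp
    have ne: "K1 \<noteq> {#}" "K2 \<noteq> {#}"
      using ord ominus_eq_empty_iff[of "snd p" M] ominus_eq_empty_iff[of M "snd s"] by (auto simp: K1_def K2_def)
    then have ne': "K1' \<noteq> {#}" "K2' \<noteq> {#}" using eqv_empty_iff K'(2,3) by blast+
    have ord': "snd p' < M'" "M' < snd s'"
      unfolding s'_eq using oplus_less_iff[of "snd p'" "{#}" K1'] oplus_less_iff[of M' "{#}" K2'] ne'
      by (auto simp: M'_def)
    let ?b' = "(q', M')"
    have b'J: "?b' \<in> pts J"
      using goodD(2)[OF \<rho>'(2)] s' fq ord'(2) by (auto simp: pts_def)
    have left: "fst x = q \<longrightarrow> snd x \<le> snd p \<and> snd y \<le> snd p' \<and> eqv d (M \<ominus> snd x) (M' \<ominus> snd y)"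
      if xy: "(x, y) \<in> \<rho>'" "x < b" for x y
    proof
      assume x: "fst x = q"
      then have "x \<in> P" using xy by (auto simp: P_def)
      then have xp: "snd x \<le> snd p" using p(2) x fq by (fastforce simp: less_eq_prod_def)
      have m: "matching d x y p p'" using goodD(5)[OF \<rho>'(2) xy(1) p'] .
      have yp: "snd y \<le> snd p'" using matchingD(3)[OF m] x fq xp by simp
      have "M \<ominus> snd x = (snd p \<ominus> snd x) \<oplus> K1"
        unfolding K1_def using xp ord by (intro ominus_trans) auto
      moreover have "M' \<ominus> snd y = (snd p' \<ominus> snd y) \<oplus> K1'"
        using ominus_trans[OF yp, of M'] ord' by (simp add: M'_def ominus_oplus)
      ultimately have "eqv d (M \<ominus> snd x) (M' \<ominus> snd y)"
        using matchingD(4)[OF m] x fq xp K'(2) by (simp add: eqv_oplus)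
      then show "snd x \<le> snd p \<and> snd y \<le> snd p' \<and> eqv d (M \<ominus> snd x) (M' \<ominus> snd y)"
        using xp yp by blast
    qed
    have right: "fst x = q \<longrightarrow> snd s \<le> snd x \<and> snd s' \<le> snd y \<and> eqv a (snd x \<ominus> M) (snd y \<ominus> M')"
      if xy: "(x, y) \<in> \<rho>'" "b < x" for x y
    proof
      assume x: "fst x = q"
      then have "x \<in> S" using xy by (auto simp: S_def)
      then have sx: "snd s \<le> snd x" using s(2) x fq by (fastforce simp: less_eq_prod_def)
      have m: "matching a s s' x y" using goodD(5)[OF good s'_old right_old[OF xy]] .
      have sy: "snd s' \<le> snd y" using matchingD(3)[OF m] x fq sx by simp
      have "snd x \<ominus> M = K2 \<oplus> (snd x \<ominus> snd s)"
        unfolding K2_def using sx ord by (intro ominus_trans) auto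
      moreover have "snd y \<ominus> M' = K2' \<oplus> (snd y \<ominus> snd s')"
        using ominus_trans[OF _ sy, of M'] ord' ominus_oplus[of M' K2'] s'_eq by simp
      ultimately have "eqv a (snd x \<ominus> M) (snd y \<ominus> M')"
        using matchingD(4)[OF m] x fq sx K'(3) by (simp add: eqv_oplus)
      then show "snd s \<le> snd x \<and> snd s' \<le> snd y \<and> eqv a (snd x \<ominus> M) (snd y \<ominus> M')"
        using sx sy by blast
    qed
    have new1: "matching d x y b ?b'" if xy: "(x, y) \<in> \<rho>'" for x y
    proof -
      have "x \<noteq> b" using xy bD by blast
      then consider "x < b" | "b < x" by force
      then show ?thesis
      proof cases
        case 1
        then show ?thesis
          using left[OF xy 1] blk[OF xy] ord ord' b unfolding matching_def
          by (auto intro: order_trans order_less_imp_le)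
      next
        case 2
        then show ?thesis
          using right[OF xy 2] blk[OF xy] ord ord' b unfolding matching_def
          by (auto dest: order.strict_trans2 order_trans)
      qed
    qed
    \<comment> \<open>The rank depends on the side: distances from \<open>b\<close> to the right
      keep rank \<open>a\<close>, as the next insertion requires.\<close>
    have new2: "matching (if b < x then a else d) b ?b' x y" if xy: "(x, y) \<in> \<rho>'" for x y
    proof -
      have "x \<noteq> b" using xy bD by blast
      then consider "x < b" | "b < x" by force
      then show ?thesis
      proof cases
        case 1
        then show ?thesis
          using left[OF xy 1] blk[OF xy] blk2[OF xy] ord ord' b unfolding matching_def
          by (auto dest: order.strict_trans2 order_trans)
      next
        case 2
        then show ?thesis
          using right[OF xy 2] blk[OF xy] blk2[OF xy] ord ord' b unfolding matching_def
          by (auto intro: order_trans order_less_imp_le)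
      qed
    qed
    have self: "matching d b ?b' b ?b'" using b by (simp add: matching_def)
    let ?\<rho> = "insert (b, ?b') \<rho>'"
    have match: "matching d x y x' y'" if xy: "(x, y) \<in> ?\<rho>" "(x', y') \<in> ?\<rho>" for x y x' y'
    proof -
      have n2: "matching d b ?b' x y" if "(x, y) \<in> \<rho>'" for x y
        by (rule matching_mono[OF new2[OF that]]) (use d in auto)
      consider "(x, y) = (b, ?b')" "(x', y') = (b, ?b')" | "(x, y) \<in> \<rho>'" "(x', y') = (b, ?b')"
        | "(x, y) = (b, ?b')" "(x', y') \<in> \<rho>'" | "(x, y) \<in> \<rho>'" "(x', y') \<in> \<rho>'"
        using xy by blast
      then show ?thesis
      proof cases
        case 1
        then show ?thesis using self by simp
      next
        case 2
        then show ?thesis using new1 by simp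
      next
        case 3
        then show ?thesis using n2 by simp
      next
        case 4
        then show ?thesis by (rule goodD(5)[OF \<rho>'(2)])
      qed
    qed
    have "good I J d ?\<rho>"
      unfolding good_def
    proof (intro conjI)
      show "finite ?\<rho>" using goodD(1)[OF \<rho>'(2)] by simp
      show "?\<rho> \<subseteq> pts I \<times> pts J" using goodD(2)[OF \<rho>'(2)] b'J insert.prems(1) by auto
      show "\<forall>x y. (x, y) \<in> ?\<rho> \<longrightarrow> ((fst x, {#}), (fst y, {#})) \<in> ?\<rho> \<and>
          ((fst x, {#lab (fst x)#}), (fst y, {#lab (fst y)#})) \<in> ?\<rho>"
        using goodD(3,4)[OF \<rho>'(2)] start fin \<rho>'(1) b by auto
      show "\<forall>x y x' y'. (x, y) \<in> ?\<rho> \<longrightarrow> (x', y') \<in> ?\<rho> \<longrightarrow> matching d x y x' y'"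
        using match by blast
    qed
    moreover have "matching a x y x' y'" if xy: "(x, y) \<in> ?\<rho>" "(x', y') \<in> \<rho>" for x y x' y'
    proof (cases "(x, y) \<in> \<rho>'")
      case True
      then show ?thesis using old xy(2) by blast
    next
      case nxy: False
      then have eq: "x = b" "y = ?b'" using xy(1) by auto
      have xy': "(x', y') \<in> \<rho>'" using xy(2) \<rho>'(1) by blast
      show ?thesis
      proof (cases "b < x'")
        case True
        then show ?thesis using new2[OF xy'] eq by simp
      next
        case nb: False
        have m: "matching d b ?b' x' y'" using match[of b ?b' x' y'] xy' by simp
        \<comment> \<open>A point on the left imposes no condition on a distance starting at
          \<open>b\<close>, so here rank \<open>d\<close> already yields rank
          \<open>a\<close>.\<close>
        have "\<not> (fst b = fst x' \<and> snd b \<le> snd x')"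
          using nb xy' bD by (cases x') (auto simp: b order_le_less)
        then show ?thesis
          using m eq unfolding matching_def by blast
      qed
    qed
    moreover have "Domain ?\<rho> = Domain \<rho> \<union> insert b D" using \<rho>'(3) by auto
    ultimately show ?thesis
      using \<rho>'(1) by (intro exI[of _ ?\<rho>]) (simp add: subset_insertI2)
  qed
qed

text \<open>Blocks can be added only at ranks below \<open>lam\<close>, while \<open>a\<close> may
  equal \<open>lam\<close>. The intermediate rank \<open>d + 1\<close> is below \<open>lam\<close>
  and leaves one rank for adding points.\<close>

lemma good_forth:
  assumes good: "good I J a \<rho>" and a: "a \<le> lam" and J: "full J" and d: "d < a"
    and C: "finite C" "C \<subseteq> pts I"
  shows "\<exists>\<rho>'. \<rho> \<subseteq> \<rho>' \<and> C \<subseteq> Domain \<rho>' \<and> good I J d \<rho>'"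
proof -
  have e: "osuc d \<le> a" "osuc d < lam"
    using d a lim by (auto simp: osuc_le_iff limit_ord_osuc_less order.strict_trans2)
  have "finite (fst ` C)" "fst ` C \<subseteq> I" using C by (auto simp: pts_def)
  from good_add_blocks[OF this good_mono[OF good e(1)] e(2) J]
  obtain \<rho>1 where 1: "\<rho> \<subseteq> \<rho>1" "good I J (osuc d) \<rho>1" "fst ` C \<subseteq> fst ` Domain \<rho>1"
    by (elim exE conjE)
  from good_add_points[OF 1(2) less_osuc C 1(3)]
  obtain \<rho>2 where "\<rho>1 \<subseteq> \<rho>2" "good I J d \<rho>2" "Domain \<rho>2 = Domain \<rho>1 \<union> C"
    by (elim exE conjE)
  then show ?thesis using 1(1) by (intro exI[of _ \<rho>2]) auto
qed

lemma good_bf: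
  assumes IJ: "full I" "full J"
  shows "good I J a \<rho> \<Longrightarrow> a \<le> lam \<Longrightarrow> bfs I J a \<rho>"
proof (induction a arbitrary: \<rho> rule: less_induct)
  case (less a)
  note good = less.prems(1)
  show ?case
  proof (rule bfI)
    show "finite \<rho>" "\<rho> \<subseteq> pts I \<times> pts J" "piso (ord_on (pts I)) (ord_on (pts J)) \<rho>"
      using goodD(1,2)[OF good] good_piso[OF good] by auto
  next
    fix d C assume d: "d < a" "finite C" "C \<subseteq> pts I"
    obtain \<rho>' where "\<rho> \<subseteq> \<rho>'" "C \<subseteq> Domain \<rho>'" "good I J d \<rho>'"
      using good_forth[OF good less.prems(2) IJ(2) d] by blast
    then show "\<exists>\<rho>'. \<rho> \<subseteq> \<rho>' \<and> C \<subseteq> Domain \<rho>' \<and> bfs I J d \<rho>'"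
      using less.IH[OF d(1), of \<rho>'] d(1) less.prems(2) by auto
  next
    fix d C assume d: "d < a" "finite C" "C \<subseteq> pts J"
    obtain \<rho>' where "\<rho>\<inverse> \<subseteq> \<rho>'" "C \<subseteq> Domain \<rho>'" "good J I d \<rho>'"
      using good_forth[OF good_converse[OF good] less.prems(2) IJ(1) d] by blast
    then have "\<rho> \<subseteq> \<rho>'\<inverse>" "C \<subseteq> Range (\<rho>'\<inverse>)" "good I J d (\<rho>'\<inverse>)"
      using good_converse by auto
    then show "\<exists>\<rho>'. \<rho> \<subseteq> \<rho>' \<and> C \<subseteq> Range \<rho>' \<and> bfs I J d \<rho>'"
      using less.IH[OF d(1), of "\<rho>'\<inverse>"] d(1) less.prems(2) by (intro exI[of _ "\<rho>'\<inverse>"]) auto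
  qed
qed

section \<open>Label-preserving maps of indices\<close>

definition exact :: "rat set \<Rightarrow> rat set \<Rightarrow> (rat \<times> rat) set \<Rightarrow> bool" where
  "exact I J \<sigma> \<longleftrightarrow> finite \<sigma> \<and> \<sigma> \<subseteq> I \<times> J \<and> (\<forall>q q'. (q, q') \<in> \<sigma> \<longrightarrow> lab q = lab q') \<and>
    (\<forall>q q' r r'. (q, q') \<in> \<sigma> \<longrightarrow> (r, r') \<in> \<sigma> \<longrightarrow> (q < r \<longleftrightarrow> q' < r'))"

lemma exactD:
  assumes "exact I J \<sigma>"
  shows "finite \<sigma>" "\<sigma> \<subseteq> I \<times> J" "(q, q') \<in> \<sigma> \<Longrightarrow> lab q = lab q'"
    "(q, q') \<in> \<sigma> \<Longrightarrow> (r, r') \<in> \<sigma> \<Longrightarrow> q < r \<longleftrightarrow> q' < r'"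
  using assms unfolding exact_def by blast+

lemma exact_eq_iff: "exact I J \<sigma> \<Longrightarrow> (q, q') \<in> \<sigma> \<Longrightarrow> (r, r') \<in> \<sigma> \<Longrightarrow> q = r \<longleftrightarrow> q' = r'"
  using exactD(4)[of I J \<sigma> q q' r r'] exactD(4)[of I J \<sigma> r r' q q'] by (metis linorder_neqE order_less_irrefl)

lemma exact_converse: "exact I J \<sigma> \<Longrightarrow> exact J I (\<sigma>\<inverse>)"
  unfolding exact_def by auto

text \<open>Offsets are copied unchanged, so all distances agree and the relation is good at every
  rank. The set \<open>F\<close> selects a finite part, and block starts and ends are included as
  \<open>good\<close> demands.\<close>

definition blocks_rel :: "(rat \<times> rat) set \<Rightarrow> cord multiset set \<Rightarrow> ((rat \<times> cord multiset) \<times> (rat \<times> cord multiset)) set" where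
  "blocks_rel \<sigma> F = {(x, y). (fst x, fst y) \<in> \<sigma> \<and> snd x = snd y \<and> snd x \<le> {#lab (fst x)#} \<and>
     (snd x \<in> F \<or> snd x = {#} \<or> snd x = {#lab (fst x)#})}"

lemma good_blocks_rel:
  assumes ex: "exact I J \<sigma>" and F: "finite F"
  shows "good I J a (blocks_rel \<sigma> F)"
  unfolding good_def
proof (intro conjI allI impI)
  let ?E = "F \<union> {{#}} \<union> (\<lambda>p. {#lab (fst p)#}) ` \<sigma>"
  have "blocks_rel \<sigma> F \<subseteq> (\<lambda>(p, M). ((fst p, M), (snd p, M))) ` (\<sigma> \<times> ?E)"
  proof
    fix t assume "t \<in> blocks_rel \<sigma> F"
    then obtain q q' M where t: "t = ((q, M), (q', M))" "(q, q') \<in> \<sigma>" "M \<in> F \<or> M = {#} \<or> M = {#lab q#}"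
      by (cases t) (auto simp: blocks_rel_def)
    then have "M \<in> ?E" by force
    then have "((q, q'), M) \<in> \<sigma> \<times> ?E" using t(2) by blast
    then show "t \<in> (\<lambda>(p, M). ((fst p, M), (snd p, M))) ` (\<sigma> \<times> ?E)"
      by (rule rev_image_eqI) (simp add: t(1))
  qed
  moreover have "finite (\<sigma> \<times> ?E)" using F exactD(1)[OF ex] by simp
  ultimately show "finite (blocks_rel \<sigma> F)" by (rule finite_surj[rotated])
  show "blocks_rel \<sigma> F \<subseteq> pts I \<times> pts J"
    using exactD(2,3)[OF ex] by (auto simp: blocks_rel_def pts_def)
  fix x y assume xy: "(x, y) \<in> blocks_rel \<sigma> F"
  then show "((fst x, {#}), (fst y, {#})) \<in> blocks_rel \<sigma> F"
    "((fst x, {#lab (fst x)#}), (fst y, {#lab (fst y)#})) \<in> blocks_rel \<sigma> F"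
    using exactD(3)[OF ex] by (auto simp: blocks_rel_def)
  fix x' y' assume "(x', y') \<in> blocks_rel \<sigma> F"
  then show "matching a x y x' y'"
    using xy exactD(4)[OF ex, of "fst x" "fst y" "fst x'" "fst y'"]
      exact_eq_iff[OF ex, of "fst x" "fst y" "fst x'" "fst y'"]
    by (simp add: blocks_rel_def matching_def)
qed

lemma exact_bf:
  assumes "full I" "full J" "exact I J \<sigma>" "finite F" "\<rho> \<subseteq> blocks_rel \<sigma> F" "a \<le> lam"
  shows "bfs I J a \<rho>"
  using bf_mono[OF good_bf[OF assms(1,2) good_blocks_rel[OF assms(3,4)] assms(6)] assms(5) order_refl] .

text \<open>Whoever fills the gap learns that \<open>L\<close> and \<open>U\<close> contain the
  images of the smaller and larger matched indices and that \<open>q\<close> is new. A distinguished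
  matched index can thus decide on which side of it the gap lies.\<close>

lemma exact_extend:
  assumes ex: "exact I J \<sigma>" and q: "q \<in> I"
    and gap: "\<And>L U. finite L \<Longrightarrow> finite U \<Longrightarrow> L \<subseteq> J \<Longrightarrow> U \<subseteq> J \<Longrightarrow> (\<forall>l\<in>L. \<forall>u\<in>U. l < u) \<Longrightarrow>
      (\<forall>r r'. (r, r') \<in> \<sigma> \<longrightarrow> (r < q \<longrightarrow> r' \<in> L) \<and> (q < r \<longrightarrow> r' \<in> U)) \<Longrightarrow> q \<notin> Domain \<sigma> \<Longrightarrow>
      \<exists>q'\<in>J. lab q' = lab q \<and> (\<forall>l\<in>L. l < q') \<and> (\<forall>u\<in>U. q' < u)"
  shows "\<exists>q'. exact I J (insert (q, q') \<sigma>)"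
proof (cases "q \<in> Domain \<sigma>")
  case True
  then obtain q' where "(q, q') \<in> \<sigma>" by blast
  then show ?thesis using ex by (metis insert_absorb)
next
  case False
  define L where "L = snd ` {p \<in> \<sigma>. fst p < q}"
  define U where "U = snd ` {p \<in> \<sigma>. q < fst p}"
  have fin: "finite L" "finite U" using exactD(1)[OF ex] by (simp_all add: L_def U_def)
  have sub: "L \<subseteq> J" "U \<subseteq> J" using exactD(2)[OF ex] by (auto simp: L_def U_def)
  have LU: "\<forall>l\<in>L. \<forall>u\<in>U. l < u"
    using exactD(4)[OF ex] by (fastforce simp: L_def U_def)
  have mem: "r < q \<longrightarrow> r' \<in> L" "q < r \<longrightarrow> r' \<in> U" if "(r, r') \<in> \<sigma>" for r r'
    using that by (force simp: L_def U_def)+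
  obtain q' where q': "q' \<in> J" "lab q' = lab q" "\<And>l. l \<in> L \<Longrightarrow> l < q'" "\<And>u. u \<in> U \<Longrightarrow> q' < u"
    using gap[OF fin sub LU _ False] mem by blast
  have new: "(r < q \<longleftrightarrow> r' < q') \<and> (q < r \<longleftrightarrow> q' < r')" if "(r, r') \<in> \<sigma>" for r r'
  proof -
    have "r \<noteq> q" using that False by blast
    then consider "r < q" | "q < r" by force
    then show ?thesis
      using mem[OF that] q'(3)[of r'] q'(4)[of r'] by cases auto
  qed
  have "exact I J (insert (q, q') \<sigma>)"
    unfolding exact_def
  proof (intro conjI allI impI)
    show "finite (insert (q, q') \<sigma>)" using exactD(1)[OF ex] by simp
    show "insert (q, q') \<sigma> \<subseteq> I \<times> J" using exactD(2)[OF ex] q q'(1) by simp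
    show "lab r = lab r'" if "(r, r') \<in> insert (q, q') \<sigma>" for r r'
      using that exactD(3)[OF ex] q'(2) by auto
    fix r r' s s' assume "(r, r') \<in> insert (q, q') \<sigma>" "(s, s') \<in> insert (q, q') \<sigma>"
    then show "r < s \<longleftrightarrow> r' < s'" using exactD(4)[OF ex] new by auto
  qed
  then show ?thesis by blast
qed

lemma exact_extend_full:
  assumes ex: "exact I J \<sigma>" and J: "full J" and q: "q \<in> I" "lab q < lam"
  shows "\<exists>q'. exact I J (insert (q, q') \<sigma>)"
proof (rule exact_extend[OF ex q(1)])
  fix L U assume "finite L" "finite U" "L \<subseteq> J" "U \<subseteq> J" "\<forall>l\<in>L. \<forall>u\<in>U. l < u"
  then show "\<exists>q'\<in>J. lab q' = lab q \<and> (\<forall>l\<in>L. l < q') \<and> (\<forall>u\<in>U. q' < u)"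
    using J q(2) unfolding full_def by simp
qed

text \<open>Fullness provides only labels below \<open>lam\<close>, so indices with label
  \<open>lam\<close> have to be matched beforehand.\<close>

lemma exact_extend_full_set:
  assumes J: "full J"
  shows "finite Q \<Longrightarrow> Q \<subseteq> I \<Longrightarrow> exact I J \<sigma> \<Longrightarrow> (\<forall>q\<in>Q. q \<in> Domain \<sigma> \<or> lab q < lam) \<Longrightarrow>
    \<exists>\<sigma>'. \<sigma> \<subseteq> \<sigma>' \<and> exact I J \<sigma>' \<and> Q \<subseteq> Domain \<sigma>'"
proof (induction Q rule: finite_induct)
  case empty
  then show ?case by blast
next
  case (insert q Q)
  then obtain \<sigma>1 where 1: "\<sigma> \<subseteq> \<sigma>1" "exact I J \<sigma>1" "Q \<subseteq> Domain \<sigma>1" by auto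
  show ?case
  proof (cases "q \<in> Domain \<sigma>")
    case True
    then show ?thesis using 1 by (intro exI[of _ \<sigma>1]) auto
  next
    case False
    then obtain q' where "exact I J (Set.insert (q, q') \<sigma>1)"
      using exact_extend_full[OF 1(2) J, of q] insert.prems by auto
    then show ?thesis using 1 by (intro exI[of _ "Set.insert (q, q') \<sigma>1"]) auto
  qed
qed

text \<open>\<open>c\<close> plays the separator: label \<open>lam\<close> occurs only to its right.
  On each side every label occurring there is available in every gap, so label-preserving maps that
  match separators always extend.\<close>

definition cut :: "rat set \<Rightarrow> rat \<Rightarrow> bool" where
  "cut I c \<longleftrightarrow> c \<in> I \<and> (\<forall>q\<in>I. q < c \<longrightarrow> lab q < lam) \<and>
    (\<forall>L U b. finite L \<longrightarrow> finite U \<longrightarrow> L \<subseteq> I \<longrightarrow> U \<subseteq> I \<longrightarrow> (\<forall>l\<in>L. \<forall>u\<in>U. l < u) \<longrightarrow>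
      (c \<in> U \<and> b < lam \<or> c \<in> L \<and> b \<le> lam) \<longrightarrow> (\<exists>q\<in>I. lab q = b \<and> (\<forall>l\<in>L. l < q) \<and> (\<forall>u\<in>U. q < u)))"

lemma cutD:
  assumes "cut I c" "finite L" "finite U" "L \<subseteq> I" "U \<subseteq> I" "\<forall>l\<in>L. \<forall>u\<in>U. l < u"
    "c \<in> U \<and> b < lam \<or> c \<in> L \<and> b \<le> lam"
  shows "\<exists>q\<in>I. lab q = b \<and> (\<forall>l\<in>L. l < q) \<and> (\<forall>u\<in>U. q < u)"
  using assms(1)[unfolded cut_def, THEN conjunct2, THEN conjunct2] assms(2-7) by blast

lemma exact_extend_cut:
  assumes ex: "exact I J \<sigma>" "(c, d) \<in> \<sigma>" and I: "cut I c" and J: "cut J d" and q: "q \<in> I"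
  shows "\<exists>q'. exact I J (insert (q, q') \<sigma>)"
proof (rule exact_extend[OF ex(1) q])
  fix L U assume *: "finite L" "finite U" "L \<subseteq> J" "U \<subseteq> J" "\<forall>l\<in>L. \<forall>u\<in>U. l < u"
    and mem: "\<forall>r r'. (r, r') \<in> \<sigma> \<longrightarrow> (r < q \<longrightarrow> r' \<in> L) \<and> (q < r \<longrightarrow> r' \<in> U)" and "q \<notin> Domain \<sigma>"
  then have "q \<noteq> c" using ex(2) by blast
  then have "d \<in> U \<and> lab q < lam \<or> d \<in> L \<and> lab q \<le> lam"
    using mem ex(2) I q lab_le[of q] unfolding cut_def by (metis linorder_neqE)
  then show "\<exists>q'\<in>J. lab q' = lab q \<and> (\<forall>l\<in>L. l < q') \<and> (\<forall>u\<in>U. q' < u)"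
    by (rule cutD[OF J *])
qed

section \<open>Index sets for \<open>A\<close>, for \<open>B\<close> and for the substructures of
  \<open>B\<close>\<close>

lemma gap_low:
  assumes "finite L" "finite U" "\<forall>l\<in>L. \<forall>u\<in>U. l < u" "u0 \<in> U" "u0 \<le> c" "c \<le> 0" "b < lam"
  shows "\<exists>q<c. lab q = b \<and> (\<forall>l\<in>L. l < q) \<and> (\<forall>u\<in>U. q < u)"
proof -
  define y where "y = Min U"
  \<comment> \<open>Without a lower bound, any interval ending at \<open>Min U\<close> will
    do.\<close>
  define x where "x = (if L = {} then y - 1 else Max L)"
  have y: "y \<in> U" "\<And>u. u \<in> U \<Longrightarrow> y \<le> u" using assms(2,4) unfolding y_def by (auto intro!: Min_in)
  have "x < y" using assms(1,3) y(1) by (auto simp: x_def)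
  moreover have "y \<le> c" using y(2)[OF assms(4)] assms(5) by simp
  ultimately obtain q where q: "x < q" "q < y" "lab q = b"
    using dense_neg[of x y b] assms(6,7) by auto
  have "l < q" if "l \<in> L" for l
  proof -
    have "l \<le> x" using that assms(1) by (auto simp: x_def)
    then show ?thesis using q(1) by simp
  qed
  then show ?thesis using q \<open>y \<le> c\<close> y(2) by (intro exI[of _ q]) (auto intro: order.strict_trans2)
qed

lemma gap_high:
  assumes "finite L" "finite U" "\<forall>l\<in>L. \<forall>u\<in>U. l < u" "\<forall>u\<in>U. 0 < u" "b \<le> lam"
  shows "\<exists>q>0. lab q = b \<and> (\<forall>l\<in>L. l < q) \<and> (\<forall>u\<in>U. q < u)"
proof -
  define x where "x = Max (insert 0 L)"
  define y where "y = (if U = {} then x + 1 else Min U)"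
  have x: "x \<in> insert 0 L" "\<And>l. l \<in> insert 0 L \<Longrightarrow> l \<le> x"
    unfolding x_def using Max_in[of "insert 0 L"] Max_ge[of "insert 0 L"] assms(1) by blast+
  have "x < y" using assms x(1) by (auto simp: y_def)
  moreover have "0 \<le> x" using x(2)[of 0] by simp
  ultimately obtain q where q: "x < q" "q < y" "lab q = b"
    using dense_pos[of x y b] assms(5) by auto
  have "q < u" if "u \<in> U" for u
  proof -
    have "y \<le> u" using that assms(2) by (auto simp: y_def)
    then show ?thesis using q(2) by simp
  qed
  moreover have "l < q" if "l \<in> L" for l using x(2)[of l] that q(1) by simp
  ultimately show ?thesis using q \<open>0 \<le> x\<close> by (intro exI[of _ q]) auto
qed

text \<open>For \<open>c = 0\<close> this is everything. For \<open>c < 0\<close> with label 0,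
  block \<open>c\<close> takes over as separator while block 0 is gone, so the substructure lies in
  \<open>B\<close>.\<close>

definition idx :: "rat \<Rightarrow> rat set" where
  "idx c = {q. q \<le> c \<or> 0 < q}"

lemma full_idx: "c \<le> 0 \<Longrightarrow> full (idx c)"
  unfolding full_def
proof (intro allI impI)
  fix L U :: "rat set" and b assume c: "c \<le> 0" and *: "finite L" "finite U" "L \<subseteq> idx c" "U \<subseteq> idx c" "\<forall>l\<in>L. \<forall>u\<in>U. l < u" "b < lam"
  show "\<exists>q\<in>idx c. lab q = b \<and> (\<forall>l\<in>L. l < q) \<and> (\<forall>u\<in>U. q < u)"
  proof (cases "\<exists>u\<in>U. u \<le> c")
    case True
    then obtain u where u: "u \<in> U" "u \<le> c" by blast
    obtain q where "q < c" "lab q = b" "\<forall>l\<in>L. l < q" "\<forall>u\<in>U. q < u"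
      using gap_low[OF *(1,2,5) u c *(6)] by blast
    then show ?thesis by (intro bexI[of _ q]) (auto simp: idx_def)
  next
    case False
    then have "\<forall>u\<in>U. 0 < u" using *(4) by (auto simp: idx_def)
    then obtain q where "0 < q" "lab q = b" "\<forall>l\<in>L. l < q" "\<forall>u\<in>U. q < u"
      using gap_high[OF *(1,2,5) _ order_less_imp_le[OF *(6)]] by blast
    then show ?thesis by (intro bexI[of _ q]) (auto simp: idx_def)
  qed
qed

lemma full_nonzero: "full {q. q \<noteq> 0}"
  unfolding full_def
proof (intro allI impI)
  fix L U :: "rat set" and b assume *: "finite L" "finite U" "L \<subseteq> {q. q \<noteq> 0}" "U \<subseteq> {q. q \<noteq> 0}" "\<forall>l\<in>L. \<forall>u\<in>U. l < u" "b < lam"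
  show "\<exists>q\<in>{q. q \<noteq> 0}. lab q = b \<and> (\<forall>l\<in>L. l < q) \<and> (\<forall>u\<in>U. q < u)"
  proof (cases "\<exists>u\<in>U. u \<le> 0")
    case True
    then obtain u where u: "u \<in> U" "u \<le> 0" by blast
    obtain q where "q < 0" "lab q = b" "\<forall>l\<in>L. l < q" "\<forall>u\<in>U. q < u"
      using gap_low[OF *(1,2,5) u order_refl *(6)] by blast
    then show ?thesis by (intro bexI[of _ q]) auto
  next
    case False
    then have "\<forall>u\<in>U. 0 < u" by auto
    then obtain q where "0 < q" "lab q = b" "\<forall>l\<in>L. l < q" "\<forall>u\<in>U. q < u"
      using gap_high[OF *(1,2,5) _ order_less_imp_le[OF *(6)]] by blast
    then show ?thesis by (intro bexI[of _ q]) auto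
  qed
qed

lemma cut_idx:
  assumes c: "c \<le> 0"
  shows "cut (idx c) c"
  unfolding cut_def
proof (intro conjI allI impI ballI)
  show "c \<in> idx c" by (simp add: idx_def)
  show "lab q < lam" if "q < c" for q using lab_neg[of q] that c by simp
  fix L U :: "rat set" and b assume *: "finite L" "finite U" "L \<subseteq> idx c" "U \<subseteq> idx c" "\<forall>l\<in>L. \<forall>u\<in>U. l < u"
    "c \<in> U \<and> b < lam \<or> c \<in> L \<and> b \<le> lam"
  from *(6) show "\<exists>q\<in>idx c. lab q = b \<and> (\<forall>l\<in>L. l < q) \<and> (\<forall>u\<in>U. q < u)"
  proof
    assume "c \<in> U \<and> b < lam"
    then obtain q where "q < c" "lab q = b" "\<forall>l\<in>L. l < q" "\<forall>u\<in>U. q < u"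
      using gap_low[OF *(1,2,5) _ order_refl c] by blast
    then show ?thesis by (intro bexI[of _ q]) (auto simp: idx_def)
  next
    assume cL: "c \<in> L \<and> b \<le> lam"
    then have "\<forall>u\<in>U. 0 < u" using *(4,5) by (fastforce simp: idx_def)
    then obtain q where "0 < q" "lab q = b" "\<forall>l\<in>L. l < q" "\<forall>u\<in>U. q < u"
      using gap_high[OF *(1,2,5) _ conjunct2[OF cL]] by blast
    then show ?thesis by (intro bexI[of _ q]) (auto simp: idx_def)
  qed
qed

lemma idense_full: "full I \<Longrightarrow> idense I"
  unfolding idense_def
proof (intro ballI impI)
  fix q r assume "full I" "q \<in> I" "r \<in> I" "q < r"
  then show "\<exists>s\<in>I. q < s \<and> s < r"
    using limit_ord_pos[OF lim] unfolding full_def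
    by (elim allE[of _ "{q}"] allE[of _ "{r}"] allE[of _ 0]) auto
qed

section \<open>Extension of rank \<open>lam\<close> equivalences, and approximation of
  \<open>B\<close> by copies of \<open>A\<close>\<close>

lemma idx_0: "idx 0 = UNIV"
  by (auto simp: idx_def)

abbreviation "A0 \<equiv> pts UNIV"

lemma full_UNIV: "full UNIV" and cut_UNIV: "cut UNIV 0"
  using full_idx[of 0] cut_idx[of 0] by (simp_all add: idx_0)

text \<open>Rank \<open>lam\<close> forces equal labels and offsets, so \<rho> comes from an
  \<open>exact\<close> map of indices that fixes 0. Such a map extends by
  \<open>exact_extend_cut\<close>, and every \<open>exact\<close> map gives back rank
  \<open>lam\<close>.\<close>

lemma bf_lam_extend:
  assumes bf: "bfs UNIV UNIV lam \<rho>" "((0, {#}), (0, {#})) \<in> \<rho>" and x: "x \<in> A0"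
  shows "\<exists>y. bfs UNIV UNIV lam (insert (x, y) \<rho>)"
proof -
  have d: "idense UNIV" using full_UNIV by (rule idense_full)
  define \<sigma> where "\<sigma> = (\<lambda>(x, y). (fst x, fst y)) ` \<rho>"
  have ex: "exact UNIV UNIV \<sigma>"
    unfolding exact_def
  proof (intro conjI allI impI)
    show "finite \<sigma>" using bfD(1)[OF bf(1)] by (simp add: \<sigma>_def)
    show "lab q = lab q'" if "(q, q') \<in> \<sigma>" for q q'
      using bf_label[OF d d bf(1)] that by (auto simp: \<sigma>_def)
    fix q q' r r' assume "(q, q') \<in> \<sigma>" "(r, r') \<in> \<sigma>"
    then obtain x y x' y' where *: "(x, y) \<in> \<rho>" "(x', y') \<in> \<rho>" "q = fst x" "q' = fst y" "r = fst x'" "r' = fst y'"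
      by (auto simp: \<sigma>_def)
    have "x < x' \<longleftrightarrow> y < y'" using bf_less_iff[OF bf(1) *(1,2)] .
    moreover have "fst x = fst x' \<longleftrightarrow> fst y = fst y'"
      using bf_same_block[OF d d bf(1) order_less_imp_le[OF three_less_lam] *(1,2)] .
    ultimately show "q < r \<longleftrightarrow> q' < r'"
      using * by (auto simp: less_prod_def order_less_le)
  qed simp
  have "(0, 0) \<in> \<sigma>" using bf(2) by (force simp: \<sigma>_def)
  then obtain q' where q': "exact UNIV UNIV (insert (fst x, q') \<sigma>)"
    using exact_extend_cut[OF ex _ cut_UNIV cut_UNIV, of "fst x"] by auto
  let ?F = "insert (snd x) (snd ` fst ` \<rho>)"
  have "insert (x, (q', snd x)) \<rho> \<subseteq> blocks_rel (insert (fst x, q') \<sigma>) ?F"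
  proof
    fix t assume t: "t \<in> insert (x, (q', snd x)) \<rho>"
    obtain u v where uv: "t = (u, v)" by (cases t)
    show "t \<in> blocks_rel (insert (fst x, q') \<sigma>) ?F"
    proof (cases "t \<in> \<rho>")
      case True
      then have "(u, v) \<in> \<rho>" using uv by simp
      then have "u \<in> A0" "snd u = snd v" "(fst u, fst v) \<in> \<sigma>" "snd u \<in> ?F"
        using bfD(2)[OF bf(1)] bf_offset[OF d d bf(1), of u v]
        by (blast, simp, simp add: \<sigma>_def rev_image_eqI, metis fst_conv image_eqI insertI2)
      then show ?thesis using uv unfolding blocks_rel_def pts_def by blast
    next
      case False
      then have "u = x" "v = (q', snd x)" using t uv by auto
      then show ?thesis using uv x by (simp add: blocks_rel_def pts_def)
    qed
  qed
  moreover have "finite ?F" using bfD(1)[OF bf(1)] by simp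
  ultimately show ?thesis
    using exact_bf[OF full_UNIV full_UNIV q' _ _ order_refl] by blast
qed

lemma countable_pts: "countable (pts I)"
proof -
  have "{M. set_mset M \<subseteq> {..lam}} \<subseteq> mset ` lists {..lam}"
  proof
    fix M assume M: "M \<in> {M. set_mset M \<subseteq> {..lam}}"
    obtain xs where "mset xs = M" by (metis ex_mset)
    then show "M \<in> mset ` lists {..lam}" using M by (auto simp: lists_eq_set)
  qed
  then have "countable {M. set_mset M \<subseteq> {..lam}}"
    using countable_atMost_cord by (meson countable_image countable_lists countable_subset)
  moreover have "pts I \<subseteq> UNIV \<times> {M. set_mset M \<subseteq> {..lam}}"
  proof
    fix x assume "x \<in> pts I"
    then have "snd x = {#lab (fst x)#} \<or> (\<forall>m\<in>#snd x. m < lab (fst x))"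
      by (simp add: pts_def mset_le_single_right_iff)
    then have "m \<le> lam" if "m \<in># snd x" for m
      using that lab_le[of "fst x"] by auto
    then show "x \<in> UNIV \<times> {M. set_mset M \<subseteq> {..lam}}" by (cases x) auto
  qed
  ultimately show ?thesis by (meson countable_SIGMA countable_subset countableI_type)
qed

text \<open>Both index sets have a separator with label 0, and the finite label-preserving maps that
  match the separators form a back-and-forth family.\<close>

lemma isomorphic_idx:
  assumes c: "c \<le> 0" "lab c = 0"
  shows "isomorphic A0 (ord_on A0) (pts (idx c)) (ord_on (pts (idx c)))"
proof -
  let ?B = "pts (idx c)"
  let ?P = "\<lambda>\<rho>. \<exists>\<sigma> F. finite F \<and> exact UNIV (idx c) \<sigma> \<and> (0, c) \<in> \<sigma> \<and> \<rho> \<subseteq> blocks_rel \<sigma> F"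
  show ?thesis
  proof (rule isomorphic_if_back_and_forth[where P = ?P])
    show "countable A0" "countable ?B" by (rule countable_pts)+
    have "(0, {#}) \<in> A0" "(c, {#}) \<in> ?B" by (simp_all add: idx_def)
    then show "A0 \<noteq> {}" "?B \<noteq> {}" by blast+
    have "exact UNIV (idx c) {(0, c)}" using c lab_0 by (auto simp: exact_def idx_def)
    then show "?P {}" by blast
  next
    fix \<rho> assume "?P \<rho>"
    then obtain \<sigma> F where *: "finite F" "exact UNIV (idx c) \<sigma>" "\<rho> \<subseteq> blocks_rel \<sigma> F" by blast
    note g = good_blocks_rel[OF *(2,1), of 0]
    show "\<rho> \<subseteq> A0 \<times> ?B \<and> piso (ord_on A0) (ord_on ?B) \<rho>"
      using goodD(2)[OF g] piso_subset[OF good_piso[OF g] *(3)] *(3) by auto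
  next
    fix \<rho> x assume "?P \<rho>" and x: "x \<in> A0"
    then obtain \<sigma> F where *: "finite F" "exact UNIV (idx c) \<sigma>" "(0, c) \<in> \<sigma>" "\<rho> \<subseteq> blocks_rel \<sigma> F" by blast
    obtain q' where q': "exact UNIV (idx c) (insert (fst x, q') \<sigma>)"
      using exact_extend_cut[OF *(2,3) cut_UNIV cut_idx[OF c(1)], of "fst x"] by auto
    have "insert (x, (q', snd x)) \<rho> \<subseteq> blocks_rel (insert (fst x, q') \<sigma>) (insert (snd x) F)"
      using *(4) x by (auto simp: blocks_rel_def pts_def)
    then show "\<exists>y. ?P (insert (x, y) \<rho>)"
      using q' *(1,3) by (metis finite_insert insertI2)
  next
    fix \<rho> y assume "?P \<rho>" and y: "y \<in> ?B"
    then obtain \<sigma> F where *: "finite F" "exact UNIV (idx c) \<sigma>" "(0, c) \<in> \<sigma>" "\<rho> \<subseteq> blocks_rel \<sigma> F" by blast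
    have "exact (idx c) UNIV (\<sigma>\<inverse>)" "(c, 0) \<in> \<sigma>\<inverse>" using *(2,3) exact_converse by auto
    from exact_extend_cut[OF this cut_idx[OF c(1)] cut_UNIV, of "fst y"] y
    obtain q where "exact (idx c) UNIV (insert (fst y, q) (\<sigma>\<inverse>))" by (auto simp: pts_def)
    from exact_converse[OF this] have q: "exact UNIV (idx c) (insert (q, fst y) \<sigma>)"
      by (simp add: converse_insert)
    then have "lab q = lab (fst y)" by (rule exactD(3)) simp
    then have "insert ((q, snd y), y) \<rho> \<subseteq> blocks_rel (insert (q, fst y) \<sigma>) (insert (snd y) F)"
      using *(4) y by (auto simp: blocks_rel_def pts_def)
    then show "\<exists>x. ?P (insert (x, y) \<rho>)"
      using q *(1,3) by (metis finite_insert insertI2)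
  qed
qed

text \<open>The rank exceeds \<open>lam\<close> by one because the first move is answered by an
  \<open>exact\<close> map, which itself has rank \<open>lam\<close>. Points of the substructure are
  answered by themselves; any other point of \<open>B\<close> lies in a removed block, whose label
  is below \<open>lam\<close>, and fullness finds a place for it.\<close>

lemma bf_Id_on_idx:
  assumes c: "c < 0" and C: "finite C" "C \<subseteq> pts (idx c)"
  shows "bfs (idx c) {q. q \<noteq> 0} (osuc lam) (Id_on C)"
proof -
  let ?I = "idx c" and ?J = "{q :: rat. q \<noteq> 0}"
  have IJ: "?I \<subseteq> ?J" using c by (auto simp: idx_def)
  then have sub: "pts ?I \<subseteq> pts ?J" by (auto simp: pts_def)
  have fI: "full ?I" using c by (intro full_idx) simp
  show ?thesis
  proof (rule bfI)
    show "finite (Id_on C)" using C(1) by (simp add: Id_on_def)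
    show "Id_on C \<subseteq> pts ?I \<times> pts ?J" using C(2) sub by auto
    show "piso (ord_on (pts ?I)) (ord_on (pts ?J)) (Id_on C)"
      using C(2) sub by (auto simp: piso_def ord_on_def)
  next
    fix d D assume d: "d < osuc lam" and D: "finite D" "D \<subseteq> pts ?I"
    let ?E = "C \<union> D"
    have E: "finite ?E" "?E \<subseteq> pts ?I" using C D by auto
    have ex: "exact ?I ?J (Id_on (fst ` ?E))"
      using E IJ by (auto simp: exact_def pts_def Id_on_def)
    have "Id_on ?E \<subseteq> blocks_rel (Id_on (fst ` ?E)) (snd ` ?E)"
    proof
      fix t assume "t \<in> Id_on ?E"
      then obtain x where x: "t = (x, x)" "x \<in> ?E" by (auto simp: Id_on_def)
      then have "(fst x, fst x) \<in> Id_on (fst ` ?E)" "snd x \<in> snd ` ?E" "snd x \<le> {#lab (fst x)#}"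
        using E(2) by (auto simp: pts_def)
      then show "t \<in> blocks_rel (Id_on (fst ` ?E)) (snd ` ?E)"
        unfolding x(1) blocks_rel_def by simp
    qed
    then have "bfs ?I ?J d (Id_on ?E)"
      using exact_bf[OF fI full_nonzero ex, of "snd ` ?E"] E(1) d by (simp add: less_osuc_iff)
    then show "\<exists>\<rho>'. Id_on C \<subseteq> \<rho>' \<and> D \<subseteq> Domain \<rho>' \<and> bfs ?I ?J d \<rho>'"
      by (intro exI[of _ "Id_on ?E"]) auto
  next
    fix d D assume d: "d < osuc lam" and D: "finite D" "D \<subseteq> pts ?J"
    \<comment> \<open>Points of \<open>D\<close> that already lie in the substructure stay fixed;
      these include all points in blocks with label \<open>lam\<close>.\<close>
    let ?E = "C \<union> (D \<inter> pts ?I)" and ?F = "C \<union> D"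
    have E: "finite ?E" "?E \<subseteq> pts ?I" using C D by auto
    have ex: "exact ?J ?I (Id_on (fst ` ?E))"
      using E IJ by (auto simp: exact_def pts_def Id_on_def)
    have Q: "finite (fst ` ?F)" "fst ` ?F \<subseteq> ?J" using C D sub by (auto simp: pts_def)
    have "q \<in> Domain (Id_on (fst ` ?E)) \<or> lab q < lam" if qF: "q \<in> fst ` ?F" for q
    proof -
      obtain x where x: "x \<in> ?F" "q = fst x" using qF by blast
      show ?thesis
      proof (cases "x \<in> ?E")
        case True
        then show ?thesis using x(2) by auto
      next
        case False
        then have "x \<in> D" "x \<notin> pts ?I" using x(1) by auto
        then have "\<not> 0 < q" "q \<noteq> 0" using D(2) x(2) by (auto simp: pts_def idx_def)
        then show ?thesis using lab_neg[of q] by simp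
      qed
    qed
    then obtain \<sigma> where \<sigma>: "Id_on (fst ` ?E) \<subseteq> \<sigma>" "exact ?J ?I \<sigma>" "fst ` ?F \<subseteq> Domain \<sigma>"
      using exact_extend_full_set[OF fI Q ex] by blast
    have bf: "bfs ?I ?J d (blocks_rel (\<sigma>\<inverse>) (snd ` ?F))"
      using exact_bf[OF fI full_nonzero exact_converse[OF \<sigma>(2)], of "snd ` ?F"] C(1) D(1) d
      by (simp add: less_osuc_iff)
    have "Id_on C \<subseteq> blocks_rel (\<sigma>\<inverse>) (snd ` ?F)"
    proof
      fix t assume "t \<in> Id_on C"
      then obtain x where x: "t = (x, x)" "x \<in> C" by (auto simp: Id_on_def)
      have "(fst x, fst x) \<in> Id_on (fst ` ?E)" using x(2) by auto
      then have "(fst x, fst x) \<in> \<sigma>\<inverse>" using \<sigma>(1) by auto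
      moreover have "snd x \<in> snd ` ?F" "snd x \<le> {#lab (fst x)#}"
        using x(2) C(2) by (auto simp: pts_def)
      ultimately show "t \<in> blocks_rel (\<sigma>\<inverse>) (snd ` ?F)"
        unfolding x(1) blocks_rel_def by simp
    qed
    moreover have "D \<subseteq> Range (blocks_rel (\<sigma>\<inverse>) (snd ` ?F))"
    proof
      fix y assume y: "y \<in> D"
      then obtain q where q: "(fst y, q) \<in> \<sigma>" using \<sigma>(3) by blast
      have "lab (fst y) = lab q" using exactD(3)[OF \<sigma>(2) q] .
      moreover have "snd y \<le> {#lab (fst y)#}" using y D(2) by (auto simp: pts_def)
      moreover have "snd y \<in> snd ` ?F" using y by blast
      ultimately have "((q, snd y), y) \<in> blocks_rel (\<sigma>\<inverse>) (snd ` ?F)"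
        using q unfolding blocks_rel_def by simp
      then show "y \<in> Range (blocks_rel (\<sigma>\<inverse>) (snd ` ?F))" by blast
    qed
    ultimately show "\<exists>\<rho>'. Id_on C \<subseteq> \<rho>' \<and> D \<subseteq> Range \<rho>' \<and> bfs ?I ?J d \<rho>'"
      using bf by blast
  qed
qed

text \<open>A finite set of points of \<open>B\<close> lies in \<open>pts (idx c)\<close> once
  \<open>c\<close> exceeds its negative indices, and such a \<open>c\<close> with label 0 exists by
  density.\<close>

lemma Pi_preserved:
  assumes p: "sentence p" "Pi_in (osuc (osuc (osuc lam))) p" "models A0 (ord_on A0) p"
  shows "models (pts {q. q \<noteq> 0}) (ord_on (pts {q. q \<noteq> 0})) p"
proof (rule Pi_transfer_from_substructures[where R = ord_on, OF p(1,2)])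
  fix D assume D: "finite D" "D \<subseteq> pts {q. q \<noteq> 0}"
  define N where "N = {q \<in> fst ` D. q < 0}"
  have N: "finite N" using D(1) by (simp add: N_def)
  have "\<forall>q\<in>N. \<forall>u\<in>{0}. q < u" by (simp add: N_def)
  from gap_low[OF N _ this _ order_refl order_refl limit_ord_pos[OF lim]]
  obtain c where c: "c < 0" "lab c = 0" "\<forall>q\<in>N. q < c" by auto
  have "D \<subseteq> pts (idx c)"
  proof
    fix x assume x: "x \<in> D"
    then have "fst x \<noteq> 0" "snd x \<le> {#lab (fst x)#}" using D(2) by (auto simp: pts_def)
    moreover have "fst x < c" if "fst x < 0" using c(3) x that by (auto simp: N_def)
    ultimately show "x \<in> pts (idx c)" using linorder_neqE by (auto simp: pts_def idx_def not_less)
  qed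
  moreover have "pts (idx c) \<subseteq> pts {q. q \<noteq> 0}" using c(1) by (auto simp: pts_def idx_def)
  moreover have "models (pts (idx c)) (ord_on (pts (idx c))) p"
    using isomorphic_idx[of c] c(1,2) models_iso_map[OF _ p(3)] unfolding isomorphic_iso_map
    by (metis order_less_imp_le)
  moreover have "\<forall>C. finite C \<longrightarrow> C \<subseteq> pts (idx c) \<longrightarrow> bfs (idx c) {q. q \<noteq> 0} (osuc lam) (Id_on C)"
    using bf_Id_on_idx[OF c(1)] by blast
  ultimately show "\<exists>A. D \<subseteq> A \<and> A \<subseteq> pts {q. q \<noteq> 0} \<and> models A (ord_on A) p \<and>
      (\<forall>C. finite C \<longrightarrow> C \<subseteq> A \<longrightarrow> bf A (ord_on A) (pts {q. q \<noteq> 0}) (ord_on (pts {q. q \<noteq> 0})) (osuc lam) (Id_on C))"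
    by blast
qed

section \<open>Isomorphism invariants that separate the two orderings\<close>

lemma iso_map_deep:
  assumes f: "iso_map A (ord_on A) B (ord_on B) f" and x: "x \<in> A" "deep A g x"
  shows "deep B g (f x)"
proof -
  have "bf A (ord_on A) A (ord_on A) (dbl g) (Id_on {x})" using x(1) by (intro bf_Id_on) auto
  from bf_iso_map[OF f this] have "bf A (ord_on A) B (ord_on B) (dbl g) {(x, f x)}"
    by (simp add: Id_on_def)
  then show ?thesis using deep_bf[OF _ order_refl] x(2) by blast
qed

lemma iso_map_less:
  assumes f: "iso_map A (ord_on A) B (ord_on B) f" and x: "x \<in> A" "y \<in> A"
  shows "f x < f y \<longleftrightarrow> x < y"
proof -
  have "f x \<in> B" "f y \<in> B" using f x by (auto simp: iso_map_def bij_betw_def)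
  moreover have "(y, x) \<in> ord_on A \<longleftrightarrow> (f y, f x) \<in> ord_on B" using f x by (auto simp: iso_map_def)
  ultimately show ?thesis using x by (auto simp: ord_on_def)
qed

text \<open>Excluding depth \<open>lam + 1\<close> discards the block starts, which are deep at
  every rank.\<close>

lemma limit_block_end_iff:
  assumes I: "idense I" and x: "x \<in> pts I"
  shows "deep (pts I) lam x \<and> \<not> deep (pts I) (osuc lam) x \<longleftrightarrow> x = (fst x, {#lam#}) \<and> lab (fst x) = lam"
proof
  assume *: "deep (pts I) lam x \<and> \<not> deep (pts I) (osuc lam) x"
  then have ge: "\<forall>m\<in>#snd x. lam \<le> m" and "snd x \<noteq> {#}"
    using deep_pts_iff[OF I x] by auto
  then obtain m where m: "m \<in># snd x" "lam \<le> m" by auto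
  have "snd x = {#lab (fst x)#} \<or> (\<forall>m\<in>#snd x. m < lab (fst x))"
    using x by (simp add: pts_def mset_le_single_right_iff)
  then have "snd x = {#lab (fst x)#}"
    using m lab_le[of "fst x"] by (meson leD order.strict_trans2)
  moreover then have "lab (fst x) = lam" using ge lab_le[of "fst x"] by auto
  ultimately show "x = (fst x, {#lam#}) \<and> lab (fst x) = lam" by (cases x) auto
next
  assume "x = (fst x, {#lam#}) \<and> lab (fst x) = lam"
  then have "snd x = {#lam#}" by (metis snd_conv)
  then show "deep (pts I) lam x \<and> \<not> deep (pts I) (osuc lam) x"
    using deep_pts_iff[OF I x] less_osuc[of lam] by simp
qed

text \<open>
  The end of block \<open>0\<close> is the infimum of the ends of the blocks with label \<open>lam\<close>, whereas
  these ends have no infimum once block \<open>0\<close> is removed.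
\<close>

lemma not_isomorphic_nonzero:
  "\<not> isomorphic A0 (ord_on A0) (pts {q. q \<noteq> 0}) (ord_on (pts {q. q \<noteq> 0}))"
proof
  let ?J = "{q :: rat. q \<noteq> 0}"
  assume "isomorphic A0 (ord_on A0) (pts ?J) (ord_on (pts ?J))"
  then obtain f where f: "iso_map A0 (ord_on A0) (pts ?J) (ord_on (pts ?J)) f"
    by (auto simp: isomorphic_iso_map)
  define g where "g = inv_into A0 f"
  have g: "iso_map (pts ?J) (ord_on (pts ?J)) A0 (ord_on A0) g"
    unfolding g_def by (rule iso_map_inv[OF f])
  have fg: "f (g y) = y" "g y \<in> A0" if "y \<in> pts ?J" for y
    using f g that by (auto simp: g_def iso_map_def bij_betw_def f_inv_into_f)
  have gf: "g (f x) = x" "f x \<in> pts ?J" if "x \<in> A0" for x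
    using f that by (auto simp: g_def iso_map_def bij_betw_def)
  have dU: "idense UNIV" "idense ?J" using full_UNIV full_nonzero idense_full by auto
  have fV: "lab (fst (f x)) = lam" if x: "x \<in> A0" "x = (fst x, {#lam#})" "lab (fst x) = lam" for x
    using iffD2[OF limit_block_end_iff[OF dU(1) x(1)]] x(2,3) limit_block_end_iff[OF dU(2) gf(2)[OF x(1)]]
      iso_map_deep[OF f x(1)] iso_map_deep[OF g gf(2)[OF x(1)]] gf(1)[OF x(1)] by metis
  have gV: "lab (fst (g y)) = lam" if y: "y \<in> pts ?J" "y = (fst y, {#lam#})" "lab (fst y) = lam" for y
    using iffD2[OF limit_block_end_iff[OF dU(2) y(1)]] y(2,3) limit_block_end_iff[OF dU(1) fg(2)[OF y(1)]]
      iso_map_deep[OF g y(1)] iso_map_deep[OF f fg(2)[OF y(1)]] fg(1)[OF y(1)] by metis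
  \<comment> \<open>The greater of the two points of block 0, with offset \<omega>^0.\<close>
  define a where "a = (0 :: rat, {#0 :: cord#})"
  have a: "a \<in> A0" using lab_0 by (simp add: a_def)
  have after: "0 < fst x" if "x \<in> A0" "a < x" for x
    using that lab_0 by (cases x) (auto simp: a_def order_less_le)
  have fa: "f a \<in> pts ?J" using gf a by blast
  then have "fst (f a) \<noteq> 0" by (auto simp: pts_def)
  then consider "fst (f a) < 0" | "0 < fst (f a)" by force
  then show False
  proof cases
    case 1
    \<comment> \<open>Just right of the image of \<open>a\<close> there are only blocks of
      \<open>P\<close>, none with label \<open>lam\<close>, whereas ends of blocks with label
      \<open>lam\<close> accumulate at \<open>a\<close> from the right.\<close>
    obtain r where r: "fst (f a) < r" "r < 0" using dense[OF 1] by blast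
    let ?y = "(r, {#})"
    have y: "?y \<in> pts ?J" "f a < ?y" using r by (auto simp: less_prod_def)
    have "a < g ?y" using iso_map_less[OF g fa y(1)] y(2) gf(1)[OF a] by simp
    then have "0 < fst (g ?y)" using after fg(2)[OF y(1)] by blast
    then obtain q where q: "0 < q" "q < fst (g ?y)" "lab q = lam"
      using dense_pos[of 0 "fst (g ?y)" lam] by auto
    let ?v = "(q, {#lam#})"
    have v: "?v \<in> A0" "?v < g ?y" using q by (auto simp: less_prod_def)
    have "f ?v < ?y" using iso_map_less[OF f v(1) fg(2)[OF y(1)]] v(2) fg(1)[OF y(1)] by simp
    then have "fst (f ?v) < 0" using r(2) by (cases "f ?v") auto
    then show False using lab_neg fV[OF v(1)] q(3) by force
  next
    case 2
    \<comment> \<open>Now an end of a block with label \<open>lam\<close> occurs below the image of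
      \<open>a\<close>, but none occurs below \<open>a\<close>.\<close>
    then obtain q where q: "0 < q" "q < fst (f a)" "lab q = lam"
      using dense_pos[of 0 "fst (f a)" lam] by auto
    let ?v = "(q, {#lam#})"
    have v: "?v \<in> pts ?J" "?v < f a" using q by (auto simp: less_prod_def)
    have "g ?v < a" using iso_map_less[OF g v(1) fa] v(2) gf(1)[OF a] by simp
    then have "fst (g ?v) \<le> 0" by (cases "g ?v") (auto simp: a_def)
    then have "lab (fst (g ?v)) < lam"
      using lab_neg lab_0 limit_ord_pos[OF lim] by (cases "fst (g ?v) = 0") auto
    then show False using gV[OF v(1)] q(3) by force
  qed
qed

theorem scott_complexity_shuffle:
  "\<exists>(A :: nat set) R. A \<noteq> {} \<and> linear_order_on A R \<and>
    scott_complexity A R (Sigma_class (osuc (osuc (osuc lam))))"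
proof -
  let ?k = "osuc (osuc (osuc lam))" and ?B = "pts {q. q \<noteq> 0}"
  \<comment> \<open>Scott sentences are tested on structures over sets of natural numbers, so both
    orderings are transferred there.\<close>
  have copy: "\<exists>(A :: nat set) R f. iso_map X (ord_on X) A R f \<and> linear_order_on A R \<and> is_struct A R"
    if "countable X" "X \<noteq> {}" for X :: "(rat \<times> cord multiset) set"
  proof -
    define f where "f = to_nat_on X"
    have inj: "inj_on f X" unfolding f_def using that(1) by (rule inj_on_to_nat_on)
    define R where "R = {(f x, f y) | x y. x \<in> X \<and> y \<in> X \<and> x \<le> y}"
    have R: "(f x, f y) \<in> R \<longleftrightarrow> x \<le> y" if "x \<in> X" "y \<in> X" for x y
    proof
      assume "(f x, f y) \<in> R"
      then obtain x' y' where "f x = f x'" "f y = f y'" "x' \<in> X" "y' \<in> X" "x' \<le> y'"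
        unfolding R_def by blast
      then show "x \<le> y" using inj_onD[OF inj] \<open>x \<in> X\<close> \<open>y \<in> X\<close> by metis
    qed (use that in \<open>unfold R_def, blast\<close>)
    have sub: "R \<subseteq> f ` X \<times> f ` X" by (auto simp: R_def)
    have "iso_map X (ord_on X) (f ` X) R f"
      using inj R by (auto simp: iso_map_def bij_betw_def ord_on_def)
    moreover have "linear_order_on (f ` X) R"
      unfolding linear_order_on_def partial_order_on_def preorder_on_def
    proof (intro conjI)
      show "refl_on (f ` X) R" using R by (auto simp: refl_on_def simp del: split_paired_All)
      show "trans R"
      proof (rule transI)
        fix u v w assume "(u, v) \<in> R" "(v, w) \<in> R"
        moreover then obtain x y z where "u = f x" "v = f y" "w = f z" "x \<in> X" "y \<in> X" "z \<in> X"
          using sub by blast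
        ultimately show "(u, w) \<in> R" using R order_trans by metis
      qed
      show "antisym R"
      proof (rule antisymI)
        fix u v assume "(u, v) \<in> R" "(v, u) \<in> R"
        moreover then obtain x y where "u = f x" "v = f y" "x \<in> X" "y \<in> X"
          using sub by blast
        ultimately show "u = v" using R order_antisym by metis
      qed
      show "total_on (f ` X) R" using R by (auto simp: total_on_def)
      show "R \<subseteq> f ` X \<times> f ` X" by (fact sub)
    qed
    ultimately show ?thesis using that(2) sub by (fastforce simp: is_struct_def)
  qed
  have a0: "(0, {#}) \<in> A0" by simp
  obtain A :: "nat set" and R f where A: "iso_map A0 (ord_on A0) A R f" "linear_order_on A R" "is_struct A R"
    using copy[OF countable_pts] a0 by blast
  have b0: "(1, {#}) \<in> ?B" by simp
  obtain B :: "nat set" and S h where B: "iso_map ?B (ord_on ?B) B S h" "is_struct B S"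
    using copy[OF countable_pts] b0 by blast
  have isoA: "isomorphic A0 (ord_on A0) A R" and isoB: "isomorphic ?B (ord_on ?B) B S"
    using A(1) B(1) by (auto simp: isomorphic_iso_map)
  have "is_struct A0 (ord_on A0)" unfolding is_struct_def ord_on_def using a0 by blast
  from Sigma_scott_sentence_exists[OF countable_pts this a0 lim bf_lam_extend]
  obtain p where p: "scott_sentence A0 (ord_on A0) p" "Sigma_in ?k p" by blast
  have "isomorphic A0 (ord_on A0) C T \<longleftrightarrow> isomorphic A R C T" for C :: "nat set" and T
    using isomorphic_trans[OF isoA, of C T] isomorphic_trans[OF isomorphic_sym[OF isoA], of C T] by blast
  then have sA: "scott_sentence A R p" using p(1) by (simp add: scott_sentence_def)
  have "\<not> Pi_in ?k q" if q: "scott_sentence A R q" for q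
  proof
    assume Pi: "Pi_in ?k q"
    have "isomorphic A R A R" using isomorphic_trans[OF isomorphic_sym[OF isoA] isoA] .
    then have "models A R q" using q A(3) by (simp add: scott_sentence_def)
    then have "models A0 (ord_on A0) q" using models_iso_map[OF iso_map_inv[OF A(1)]] by blast
    then have "models ?B (ord_on ?B) q"
      using Pi_preserved[OF _ Pi] q by (simp add: scott_sentence_def)
    then have "models B S q" using models_iso_map[OF B(1)] by blast
    then have "isomorphic A R B S" using q B(2) by (simp add: scott_sentence_def)
    then have "isomorphic A0 (ord_on A0) ?B (ord_on ?B)"
      using isomorphic_trans[OF isomorphic_trans[OF isoA] isomorphic_sym[OF isoB]] by blast
    then show False using not_isomorphic_nonzero by blast
  qed
  then have "scott_complexity A R (Sigma_class ?k)"
    using scott_complexity_SigmaI[OF sA p(2)] by simp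
  then show ?thesis using A(2,3) by (auto simp: is_struct_def)
qed

end

text \<open>The requests for a colour in an interval are enumerated and served in turn by fresh
  points of the interval, so that no point has to take two colours.\<close>

lemma dense_colouring_rat: "\<exists>h :: rat \<Rightarrow> nat. \<forall>n x y. x < y \<longrightarrow> (\<exists>z. x < z \<and> z < y \<and> h z = n)"
proof -
  define req :: "nat \<Rightarrow> nat \<times> rat \<times> rat" where "req = from_nat"
  let ?lo = "\<lambda>k. fst (snd (req k))" and ?hi = "\<lambda>k. snd (snd (req k))"
  let ?P = "\<lambda>(g :: nat \<Rightarrow> rat) k r. ?lo k < ?hi k \<longrightarrow> ?lo k < r \<and> r < ?hi k \<and> r \<notin> g ` {..<k}"
  have "\<exists>g. \<forall>k. ?P g k (g k)"
  proof (rule dependent_wf_choice[of less_than ?P])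
    fix k and g :: "nat \<Rightarrow> rat"
    show "\<exists>r. ?P g k r"
    proof (cases "?lo k < ?hi k")
      case True
      then have "infinite {?lo k<..<?hi k}" by (rule infinite_Ioo)
      then have "infinite ({?lo k<..<?hi k} - g ` {..<k})" by (simp add: Diff_infinite_finite)
      then have "{?lo k<..<?hi k} - g ` {..<k} \<noteq> {}" by (metis finite.emptyI)
      then show ?thesis by force
    qed simp
  next
    fix f g :: "nat \<Rightarrow> rat" and k r assume eq: "\<And>z. (z, k) \<in> less_than \<Longrightarrow> f z = g z"
    have "f ` {..<k} = g ` {..<k}" using eq by (intro image_cong) auto
    then show "?P f k r = ?P g k r" by simp
  qed simp
  then obtain g where g: "\<And>k. ?P g k (g k)" by blast
  \<comment> \<open>A point takes the colour of the request it serves; the condition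
    \<open>?lo k < ?hi k\<close> discards void requests, for which \<open>g k\<close> is
    arbitrary.\<close>
  define h where "h z = fst (req (LEAST k. ?lo k < ?hi k \<and> g k = z))" for z
  have "\<exists>z. x < z \<and> z < y \<and> h z = n" if xy: "x < y" for n x y
  proof -
    define k where "k = to_nat (n, x, y)"
    have k: "req k = (n, x, y)" by (simp add: req_def k_def)
    have "(LEAST j. ?lo j < ?hi j \<and> g j = g k) = k"
    proof (rule Least_equality)
      show "?lo k < ?hi k \<and> g k = g k" using k xy by simp
      fix j assume j: "?lo j < ?hi j \<and> g j = g k"
      show "k \<le> j"
      proof (rule ccontr)
        assume "\<not> k \<le> j"
        then have "g j \<in> g ` {..<k}" by simp
        then show False using g[of k] j k xy by auto
      qed
    qed
    then have "h (g k) = n" using k by (simp add: h_def)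
    moreover have "x < g k" "g k < y" using g[of k] k xy by auto
    ultimately show ?thesis by blast
  qed
  then show ?thesis by blast
qed

theorem mainTheorem6:
  fixes lam :: cord
  assumes "limit_ord lam"
  shows "\<exists>(A :: nat set) R. A \<noteq> {} \<and> linear_order_on A R \<and>
    scott_complexity A R (Sigma_class (osuc (osuc (osuc lam))))"
proof -
  obtain h :: "rat \<Rightarrow> nat" where h: "\<And>n x y. x < y \<Longrightarrow> \<exists>z. x < z \<and> z < y \<and> h z = n"
    using dense_colouring_rat by blast
  define lab where "lab q = (if q < 0 then from_nat_into {..<lam} (h q)
    else if q = 0 then 0 else from_nat_into {..lam} (h q))" for q
  have pos: "0 < lam" using assms by (rule limit_ord_pos)
  have ne: "{..<lam} \<noteq> {}" using pos by auto
  have lt: "from_nat_into {..<lam} n < lam" for n using from_nat_into[OF ne] by auto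
  have le: "from_nat_into {..lam} n \<le> lam" for n using from_nat_into[of "{..lam}" n] by auto
  interpret shuffle lam lab
  proof
    show "limit_ord lam" by fact
    show "lab 0 = 0" by (simp add: lab_def)
    show "lab q < lam" if "q < 0" for q using that lt by (simp add: lab_def)
    show "lab q \<le> lam" for q using lt le pos by (simp add: lab_def order_less_imp_le)
    show "\<exists>q. x < q \<and> q < y \<and> lab q = b" if "x < y" "y \<le> 0" and b: "b < lam" for x y b
    proof -
      obtain n where "from_nat_into {..<lam} n = b"
        using from_nat_into_surj[OF countable_lessThan_cord, of b lam] b by auto
      moreover obtain q where "x < q" "q < y" "h q = n" using h[OF \<open>x < y\<close>] by blast
      ultimately show ?thesis using \<open>y \<le> 0\<close> by (intro exI[of _ q]) (simp add: lab_def)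
    qed
    show "\<exists>q. x < q \<and> q < y \<and> lab q = b" if "x < y" "0 \<le> x" and b: "b \<le> lam" for x y b
    proof -
      obtain n where "from_nat_into {..lam} n = b"
        using from_nat_into_surj[OF countable_atMost_cord, of b lam] b by auto
      moreover obtain q where "x < q" "q < y" "h q = n" using h[OF \<open>x < y\<close>] by blast
      ultimately show ?thesis using \<open>0 \<le> x\<close> by (intro exI[of _ q]) (simp add: lab_def)
    qed
  qed
  show ?thesis by (rule scott_complexity_shuffle)
qed

end
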